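(* Let $h:(\mathbb{C}^n,0)\to(\mathbb{C}^n,0)$ be a bi-Lipschitz homeomorphism germ, and let $A,B\subset\mathbb{C}^n$ be germs at $0$ of complex analytic varieties with $0\in A\cap B$, such that $h(A)$ and $h(B)$ are also germs at $0$ of complex analytic varieties. Then $A$ and $B$ are transverse at $0\in\mathbb{C}^n$ if and only if $h(A)$ and $h(B)$ are transverse at $0\in\mathbb{C}^n$.
   Context: A bi-Lipschitz homeomorphism germ $h:(\mathbb{C}^n,0)\to(\mathbb{C}^n,0)$ is a homeomorphism germ with $h(0)=0$ for which there are constants $0<K_1\le K_2$ with $K_1\|x-y\|\le\|h(x)-h(y)\|\le K_2\|x-y\|$ for $x,y$ near $0$. For a set-germ $A\subset\mathbb{C}^n$ at $0$ with $0\in\overline{A}$, its complex tangent cone is $LD^*(A)=\{v\in\mathbb{C}^n:\ \exists\, c_i\in\mathbb{C},\ \exists\, v_i\in A\setminus\{0\},\ v_i\to0,\ c_iv_i\to v\}$. For a complex analytic variety $A$ through $0$, $LD^*(A)$ is a complex analytic variety (a cone). Two analytic variety germs $A,B$ through $0$ are called transverse at $0$ if $\dim_{\mathbb{C}}LD^*(A)+\dim_{\mathbb{C}}LD^*(B)-n=\dim_{\mathbb{C}}(LD^*(A)\cap LD^*(B))$. *)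

theory Defs
  imports "HOL-Analysis.Analysis"
begin

text \<open>Complex n-space is modelled as \<open>complex ^ 'n\<close>, with n = CARD('n).
  Complex scalar multiplication is \<open>(*s)\<close>; \<open>vec.dim\<close>, \<open>vec.subspace\<close>
  are the complex-linear notions of dimension and subspace.\<close>

text \<open>Holomorphic (complex Frechet differentiable) maps on an open set, several variables.\<close>
definition holo_fun_on :: "(complex ^ 'n \<Rightarrow> complex) \<Rightarrow> (complex ^ 'n) set \<Rightarrow> bool" where
  "holo_fun_on f V \<longleftrightarrow> open V \<and> (\<forall>z\<in>V. \<exists>D. (f has_derivative D) (at z)
       \<and> Vector_Spaces.linear (*s) (*) D)"

definition holo_map_on :: "(complex ^ 'n \<Rightarrow> complex ^ 'm) \<Rightarrow> (complex ^ 'n) set \<Rightarrow> bool" where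
  "holo_map_on f V \<longleftrightarrow> open V \<and> (\<forall>z\<in>V. \<exists>D. (f has_derivative D) (at z)
       \<and> Vector_Spaces.linear (*s) (*s) D)"

text \<open>A is (a representative of) the germ at 0 of a complex analytic variety:
  near 0 it is the common zero set of finitely many holomorphic functions.\<close>
definition analytic_germ_at0 :: "(complex ^ 'n) set \<Rightarrow> bool" where
  "analytic_germ_at0 A \<longleftrightarrow> (\<exists>V F. open V \<and> 0 \<in> V \<and> finite F \<and> (\<forall>f\<in>F. holo_fun_on f V)
       \<and> A \<inter> V = {z\<in>V. \<forall>f\<in>F. f z = 0})"

text \<open>Complex tangent cone LD*(A).\<close>
definition LD_star :: "(complex ^ 'n) set \<Rightarrow> (complex ^ 'n) set" where
  "LD_star A = {v. \<exists>(c::nat \<Rightarrow> complex) (w::nat \<Rightarrow> complex ^ 'n).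
      (\<forall>i. w i \<in> A - {0}) \<and> w \<longlonglongrightarrow> 0 \<and> (\<lambda>i. c i *s w i) \<longlonglongrightarrow> v}"

text \<open>p is a regular point of X of complex dimension d: near p, X is a d-dimensional
  complex submanifold, i.e. after a biholomorphic change of coordinates it is an open piece
  of a d-dimensional complex linear subspace.\<close>
definition regular_point_dim :: "(complex ^ 'n) set \<Rightarrow> complex ^ 'n \<Rightarrow> nat \<Rightarrow> bool" where
  "regular_point_dim X p d \<longleftrightarrow> p \<in> X \<and>
     (\<exists>V W (\<phi>::complex ^ 'n \<Rightarrow> complex ^ 'n) \<psi> L. open V \<and> p \<in> V \<and> open W \<and> holo_map_on \<phi> V \<and> holo_map_on \<psi> W
        \<and> homeomorphism V W \<phi> \<psi>
        \<and> vec.subspace L \<and> vec.dim L = d \<and> \<phi> ` (X \<inter> V) = W \<inter> L)"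

text \<open>Complex dimension of an analytic set: maximal dimension at regular points.\<close>
definition cdim :: "(complex ^ 'n) set \<Rightarrow> nat" where
  "cdim X = Sup {d. \<exists>p. regular_point_dim X p d}"

definition transverse_at0 :: "(complex ^ 'n) set \<Rightarrow> (complex ^ 'n) set \<Rightarrow> bool" where
  "transverse_at0 A B \<longleftrightarrow>
     int (cdim (LD_star A)) + int (cdim (LD_star B)) - int CARD('n)
       = int (cdim (LD_star A \<inter> LD_star B))"

text \<open>h is a bi-Lipschitz homeomorphism germ at 0, realised on the open neighbourhood U of 0.\<close>
definition bilip_homeo_germ :: "(complex ^ 'n \<Rightarrow> complex ^ 'n) \<Rightarrow> (complex ^ 'n) set \<Rightarrow> bool" where
  "bilip_homeo_germ h U \<longleftrightarrow> open U \<and> 0 \<in> U \<and> h 0 = 0 \<and> open (h ` U)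
     \<and> (\<exists>g. homeomorphism U (h ` U) h g)
     \<and> (\<exists>K1 K2. 0 < K1 \<and> K1 \<le> K2 \<and> (\<forall>x\<in>U. \<forall>y\<in>U.
            K1 * dist x y \<le> dist (h x) (h y) \<and> dist (h x) (h y) \<le> K2 * dist x y))"

end

theory Submission
  imports Defs "HOL-Complex_Analysis.Complex_Analysis"
begin

text \<open>Rescalings \<open>h (x / i) * i\<close> of a bi-Lipschitz germ subconverge to a bi-Lipschitz homeomorphism \<open>h'\<close> of
  the whole space. Every tangent vector of an analytic germ is approximated by points of the germ at every scale, so
  \<open>h'\<close> maps the tangent cones of \<open>A\<close> and \<open>B\<close> onto those of their images, and hence also the intersection of
  the two cones. The tangent cone is cut out by lowest homogeneous parts of functions vanishing on the germ. Common
  zero sets of entire functions have dense regular points, so by invariance of domain their dimension is a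
  topological invariant. Both facts on tangent cones are proved by elimination: induction on dimension, projecting
  along a line and taking norms over the roots of one equation.\<close>

section \<open>Several complex variables via complex lines\<close>

text \<open>Transversality compares the dimensions of three sets only: two tangent cones and their
  intersection. That intersection is in general not the cone of \<open>A \<inter> B\<close>, so one
  homeomorphism must match both cones at once; a single limit \<open>h'\<close>, taken along one
  subsequence for \<open>h\<close> and its inverse, does this. The obstacle is that compactness
  dictates the subsequence: a vector of \<open>LD_star A\<close> comes with scales of its own, while
  \<open>h'\<close> sees only those of the subsequence. Hence the need for points of
  \<open>A\<close> at every scale (\<open>LD_star_sequence\<close>), where analyticity enters.
  Moreover \<open>h'\<close> may send a regular point of one cone to a singular point of the other,
  so regular points must be dense. Density is derived from pointwise separation alone: at each
  vector outside the set, some entire function vanishing on the set is nonzero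
  (\<open>LD_star_separation\<close>). This property passes to intersections, and no finite system
  of equations for a cone is ever produced. The eliminations accept infinite systems, because norms
  of all linear combinations form such systems.\<close>

lemma norm_smult_vec: "norm (c *s v) = norm c * norm (v :: complex ^ 'n)"
  unfolding norm_vec_def by (simp add: norm_mult L2_set_right_distrib)

lemma smult_of_real_vec: "complex_of_real r *s v = r *\<^sub>R (v :: complex ^ 'n)"
  by (simp add: vec_eq_iff scaleR_conv_of_real[where 'a = complex])

lemma bounded_bilinear_smult_vec: "bounded_bilinear ((*s) :: complex \<Rightarrow> complex ^ 'n \<Rightarrow> _)"
proof
  show "\<exists>K. \<forall>a b. norm (a *s (b :: complex ^ 'n)) \<le> norm a * norm b * K"
    by (rule exI[of _ 1]) (simp add: norm_smult_vec)
qed (auto simp: vec_eq_iff algebra_simps)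

lemmas continuous_on_smult_vec [continuous_intros] =
  bounded_bilinear.continuous_on[OF bounded_bilinear_smult_vec]
lemmas tendsto_smult_vec [tendsto_intros] =
  bounded_bilinear.tendsto[OF bounded_bilinear_smult_vec]

lemma clinear_scaleR:
  assumes "Vector_Spaces.linear (*s) (*s) (L :: complex ^ 'n \<Rightarrow> complex ^ 'm)"
  shows "bounded_linear L"
proof -
  interpret l: Vector_Spaces.linear "(*s)" "(*s)" L by fact
  have "linear L"
    by (rule linearI) (simp_all add: l.add l.scale flip: smult_of_real_vec)
  then show ?thesis by (simp add: linear_conv_bounded_linear)
qed

lemma clinear_functional_bounded:
  assumes "Vector_Spaces.linear (*s) (*) (L :: complex ^ 'n \<Rightarrow> complex)"
  shows "bounded_linear L"
proof -
  interpret l: Vector_Spaces.linear "(*s)" "(*)" L by fact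
  have "linear L"
    by (rule linearI) (simp_all add: l.add l.scale scaleR_conv_of_real[where 'a = complex] flip: smult_of_real_vec)
  then show ?thesis by (simp add: linear_conv_bounded_linear)
qed

text \<open>Agrees with \<open>holo_fun_on\<close>, but is preserved by parameter integrals without any bound on derivatives.\<close>

definition ghol :: "(complex ^ 'n \<Rightarrow> complex) \<Rightarrow> (complex ^ 'n) set \<Rightarrow> bool" where
  "ghol f S \<longleftrightarrow> open S \<and> continuous_on S f \<and>
     (\<forall>p\<in>S. \<forall>v. (\<lambda>\<zeta>. f (p + \<zeta> *s v)) field_differentiable (at 0))"

lemma ghol_open: "ghol f S \<Longrightarrow> open S"
  and ghol_continuous: "ghol f S \<Longrightarrow> continuous_on S f"
  by (auto simp: ghol_def)

lemma open_line_preimage: "open S \<Longrightarrow> open {\<zeta>. p + \<zeta> *s (v :: complex ^ 'n) \<in> S}"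
proof -
  assume "open S"
  have "open ((\<lambda>\<zeta>. p + \<zeta> *s v) -` S)"
    by (rule open_vimage[OF \<open>open S\<close>]) (intro continuous_intros)
  then show ?thesis by (simp add: vimage_def)
qed

text \<open>The definition speaks of the parameter 0 only; recentring the line at
  \<open>p + \<zeta> *s v\<close> gives every other parameter.\<close>

lemma ghol_line:
  assumes "ghol f S"
  shows "(\<lambda>\<zeta>. f (p + \<zeta> *s v)) holomorphic_on {\<zeta>. p + \<zeta> *s v \<in> S}"
proof -
  have op: "open {\<zeta>. p + \<zeta> *s v \<in> S}" using assms by (auto simp: ghol_def intro: open_line_preimage)
  have "(\<lambda>\<zeta>. f (p + \<zeta> *s v)) field_differentiable (at \<zeta>)" if "p + \<zeta> *s v \<in> S" for \<zeta>
  proof -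
    have "(\<lambda>\<eta>. f ((p + \<zeta> *s v) + \<eta> *s v)) field_differentiable (at 0)"
      using assms that by (auto simp: ghol_def)
    then obtain D where "((\<lambda>\<eta>. f ((p + \<zeta> *s v) + \<eta> *s v)) has_field_derivative D) (at 0)"
      by (auto simp: field_differentiable_def)
    then have "((\<lambda>\<eta>. f (p + (\<zeta> + \<eta>) *s v)) has_field_derivative D) (at 0)"
      by (simp add: vec.scale_left_distrib add.assoc)
    then have "((\<lambda>\<eta>. f (p + \<eta> *s v)) has_field_derivative D) (at \<zeta>)"
      using DERIV_shift[of "\<lambda>\<eta>. f (p + \<eta> *s v)" D 0 \<zeta>] by (simp add: add.commute[of \<zeta>])
    then show ?thesis by (auto simp: field_differentiable_def)
  qed
  then show ?thesis using op by (simp add: holomorphic_on_def field_differentiable_at_within)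
qed

section \<open>Closure properties of line-wise holomorphic functions\<close>

lemma ghol_const [intro]: "open S \<Longrightarrow> ghol (\<lambda>_. c) S"
  by (auto simp: ghol_def)

lemma ghol_add: "ghol f S \<Longrightarrow> ghol g S \<Longrightarrow> ghol (\<lambda>z. f z + g z) S"
  unfolding ghol_def by (auto intro!: continuous_intros field_differentiable_add)

lemma ghol_diff: "ghol f S \<Longrightarrow> ghol g S \<Longrightarrow> ghol (\<lambda>z. f z - g z) S"
  unfolding ghol_def by (auto intro!: continuous_intros field_differentiable_diff)

lemma ghol_mult: "ghol f S \<Longrightarrow> ghol g S \<Longrightarrow> ghol (\<lambda>z. f z * g z) S"
  unfolding ghol_def by (auto intro!: continuous_intros field_differentiable_mult)

lemma ghol_divide:
  "ghol f S \<Longrightarrow> ghol g S \<Longrightarrow> (\<And>z. z \<in> S \<Longrightarrow> g z \<noteq> 0) \<Longrightarrow> ghol (\<lambda>z. f z / g z) S"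
  unfolding ghol_def by (auto intro!: continuous_intros field_differentiable_divide)

lemma ghol_sum: "open S \<Longrightarrow> (\<And>i. i \<in> I \<Longrightarrow> ghol (f i) S) \<Longrightarrow> ghol (\<lambda>z. \<Sum>i\<in>I. f i z) S"
  by (induction I rule: infinite_finite_induct) (auto intro: ghol_add)

lemma ghol_subset: "ghol f S \<Longrightarrow> T \<subseteq> S \<Longrightarrow> open T \<Longrightarrow> ghol f T"
  unfolding ghol_def by (auto intro: continuous_on_subset)

lemma ghol_cong:
  fixes f g :: "complex ^ 'n \<Rightarrow> complex"
  shows "ghol f S \<Longrightarrow> (\<And>z. z \<in> S \<Longrightarrow> f z = g z) \<Longrightarrow> ghol g S"
  unfolding ghol_def
proof (intro conjI ballI allI; elim conjE)
  fix p v :: "complex ^ 'n" assume a: "open S" "continuous_on S f" "p \<in> S"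
    "\<forall>p\<in>S. \<forall>v. (\<lambda>\<zeta>. f (p + \<zeta> *s v)) field_differentiable at 0"
    and eq: "\<And>z. z \<in> S \<Longrightarrow> f z = g z"
  have "open {\<zeta>. p + \<zeta> *s v \<in> S}" by (rule open_line_preimage[OF a(1)])
  moreover have "0 \<in> {\<zeta>. p + \<zeta> *s v \<in> S}" using a by simp
  moreover obtain D where "((\<lambda>\<zeta>. f (p + \<zeta> *s v)) has_field_derivative D) (at 0)"
    using a by (auto simp: field_differentiable_def)
  ultimately have "((\<lambda>\<zeta>. g (p + \<zeta> *s v)) has_field_derivative D) (at 0)"
    by (rule_tac has_field_derivative_transform_within_open[where S = "{\<zeta>. p + \<zeta> *s v \<in> S}"
          and f = "\<lambda>\<zeta>. f (p + \<zeta> *s v)"]) (auto simp: eq)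
  then show "(\<lambda>\<zeta>. g (p + \<zeta> *s v)) field_differentiable at 0" by (auto simp: field_differentiable_def)
qed (auto intro: continuous_on_eq)

lemma ghol_local:
  assumes "open S" "\<And>p. p \<in> S \<Longrightarrow> \<exists>O'. open O' \<and> p \<in> O' \<and> ghol f O'"
  shows "ghol f S"
  unfolding ghol_def
proof (intro conjI ballI allI)
  show "continuous_on S f"
  proof (rule continuous_at_imp_continuous_on, rule ballI)
    fix p assume "p \<in> S"
    from assms(2)[OF this] obtain O' where "open O'" "p \<in> O'" "ghol f O'" by blast
    then show "isCont f p" by (simp add: ghol_def continuous_on_eq_continuous_at)
  qed
  show "(\<lambda>\<zeta>. f (p + \<zeta> *s v)) field_differentiable at 0" if "p \<in> S" for p v
    using assms(2)[OF that] by (auto simp: ghol_def)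
qed fact

text \<open>The last assumption says that \<open>L\<close> carries complex lines to complex lines
  with the same parameter, so differentiability along lines transfers verbatim.\<close>

lemma ghol_comp_affine:
  fixes L :: "complex ^ 'm \<Rightarrow> complex ^ 'n"
  assumes "ghol f S" "open S'" "continuous_on S' L" "L ` S' \<subseteq> S"
    and "\<And>p v. \<exists>v'. \<forall>\<zeta>. L (p + \<zeta> *s v) = L p + \<zeta> *s v'"
  shows "ghol (\<lambda>z. f (L z)) S'"
  unfolding ghol_def
proof (intro conjI ballI allI)
  show "continuous_on S' (\<lambda>z. f (L z))"
    using assms by (auto simp: ghol_def intro: continuous_on_compose2)
  fix p v :: "complex ^ 'm" assume "p \<in> S'"
  obtain v' where "\<forall>\<zeta>. L (p + \<zeta> *s v) = L p + \<zeta> *s v'" using assms(5) by blast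
  then show "(\<lambda>\<zeta>. f (L (p + \<zeta> *s v))) field_differentiable at 0"
    using assms(1,4) \<open>p \<in> S'\<close> by (auto simp: ghol_def)
qed fact

lemma ghol_translate:
  assumes "ghol f S" "open S'" "\<And>z. z \<in> S' \<Longrightarrow> z + a \<in> S"
  shows "ghol (\<lambda>z. f (z + a)) S'"
  by (rule ghol_comp_affine[OF assms(1)])
     (use assms in \<open>auto intro!: continuous_intros simp: algebra_simps\<close>)

lemma ghol_comp_clinear:
  fixes L :: "complex ^ 'm \<Rightarrow> complex ^ 'n"
  assumes "ghol f S" "open S'" "Vector_Spaces.linear (*s) (*s) L" "\<And>z. z \<in> S' \<Longrightarrow> L z \<in> S"
  shows "ghol (\<lambda>z. f (L z)) S'"
proof -
  interpret l: Vector_Spaces.linear "(*s)" "(*s)" L by fact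
  show ?thesis
    by (rule ghol_comp_affine[OF assms(1,2)])
       (use assms in \<open>auto intro!: linear_continuous_on clinear_scaleR simp: l.add l.scale\<close>)
qed

lemma ghol_functional:
  assumes "Vector_Spaces.linear (*s) (*) \<tau>" "open S"
  shows "ghol \<tau> S"
proof -
  interpret l: Vector_Spaces.linear "(*s)" "(*)" \<tau> by fact
  have "(\<lambda>\<zeta>. \<tau> (p + \<zeta> *s v)) field_differentiable (at 0)" for p v
    unfolding l.add l.scale
    by (intro field_differentiable_add field_differentiable_const field_differentiable_mult
        field_differentiable_ident)
  then show ?thesis using assms
    by (simp add: ghol_def linear_continuous_on clinear_functional_bounded)
qed

lemma ghol_if_holo_fun_on:
  fixes f :: "complex ^ 'n \<Rightarrow> complex"
  assumes "holo_fun_on f S"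
  shows "ghol f S"
  unfolding ghol_def
proof (intro conjI ballI allI)
  show "open S" using assms by (simp add: holo_fun_on_def)
  show "continuous_on S f"
    using assms by (auto simp: holo_fun_on_def intro!: continuous_at_imp_continuous_on
      dest!: has_derivative_continuous)
  fix p v :: "complex ^ 'n" assume "p \<in> S"
  then obtain D where D: "(f has_derivative D) (at p)" "Vector_Spaces.linear (*s) (*) D"
    using assms by (auto simp: holo_fun_on_def)
  interpret l: Vector_Spaces.linear "(*s)" "(*)" D by fact
  have bl: "bounded_linear (\<lambda>\<zeta>. \<zeta> *s v)"
    by (rule bounded_bilinear.bounded_linear_left[OF bounded_bilinear_smult_vec])
  have 1: "((\<lambda>\<zeta>. p + \<zeta> *s v) has_derivative (\<lambda>\<zeta>. \<zeta> *s v)) (at 0)"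
    using has_derivative_add[OF has_derivative_const bounded_linear.has_derivative[OF bl has_derivative_ident]] by simp
  have "(f has_derivative D) (at (p + 0 *s v))" using D by simp
  from diff_chain_at[OF 1 this]
  have "((\<lambda>\<zeta>. f (p + \<zeta> *s v)) has_derivative (\<lambda>\<zeta>. D (\<zeta> *s v))) (at 0)" by (simp add: o_def)
  then have "((\<lambda>\<zeta>. f (p + \<zeta> *s v)) has_field_derivative D v) (at 0)"
    by (simp add: has_field_derivative_def l.scale mult_commute_abs)
  then show "(\<lambda>\<zeta>. f (p + \<zeta> *s v)) field_differentiable at 0" by (auto simp: field_differentiable_def)
qed

section \<open>Means over circles and Cauchy's formulas\<close>

definition cmean :: "real \<Rightarrow> (complex \<Rightarrow> complex) \<Rightarrow> complex" where
  "cmean r G = integral {0..1} (\<lambda>t. G (circlepath 0 r t))"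

lemma circlepath_in_sphere: "0 \<le> r \<Longrightarrow> circlepath 0 r t \<in> sphere 0 r"
  by (simp add: circlepath norm_mult)

lemma continuous_on_cmean:
  fixes G :: "'a::topological_space \<Rightarrow> complex \<Rightarrow> complex"
  assumes "continuous_on (X \<times> sphere 0 r) (\<lambda>(x, \<eta>). G x \<eta>)" "0 \<le> r"
  shows "continuous_on X (\<lambda>x. cmean r (G x))"
proof -
  have "continuous_on (X \<times> cbox 0 1) ((\<lambda>(x, \<eta>). G x \<eta>) \<circ> (\<lambda>(x, t). (x, circlepath 0 r t)))"
    by (rule continuous_on_compose[OF _ continuous_on_subset[OF assms(1)]])
       (use assms(2) in \<open>auto simp: case_prod_unfold circlepath norm_mult intro!: continuous_intros\<close>)
  then have "continuous_on (X \<times> cbox 0 1) (\<lambda>(x, t). G x (circlepath 0 r t))"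
    by (simp add: o_def case_prod_unfold)
  from integral_continuous_on_param[OF this] show ?thesis by (simp add: cmean_def)
qed

text \<open>On the circle d\<eta> = 2 pi i \<eta> dt, hence the extra factor \<eta> in every Cauchy
  formula below. Means of total mass one inherit bounds without constants.\<close>

lemma contour_integral_circlepath_eq_cmean:
  "contour_integral (circlepath 0 r) f = 2 * pi * \<i> * cmean r (\<lambda>\<eta>. f \<eta> * \<eta>)"
proof -
  have "contour_integral (circlepath 0 r) f
      = integral {0..1} (\<lambda>t. f (circlepath 0 r t) * vector_derivative (circlepath 0 r) (at t))"
    by (rule contour_integral_integral)
  also have "\<dots> = integral {0..1} (\<lambda>t. (2 * pi * \<i>) * (f (circlepath 0 r t) * circlepath 0 r t))"
    by (rule integral_cong) (simp only: vector_derivative_circlepath, simp add: circlepath)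
  finally show ?thesis by (simp add: cmean_def)
qed

lemma cmean_Cauchy:
  assumes "f holomorphic_on ball 0 R" "0 < r" "r < R" "norm z < r"
  shows "cmean r (\<lambda>\<eta>. f \<eta> * \<eta> / (\<eta> - z)) = f z"
proof -
  have "f holomorphic_on cball 0 r" "continuous_on (cball 0 r) f"
    using assms by (auto intro!: holomorphic_on_imp_continuous_on intro: holomorphic_on_subset)
  then have "((\<lambda>u. f u / (u - z)) has_contour_integral 2 * of_real pi * \<i> * f z) (circlepath 0 r)"
    using assms by (intro Cauchy_integral_circlepath) (auto intro: holomorphic_on_subset)
  from contour_integral_unique[OF this] contour_integral_circlepath_eq_cmean[of r "\<lambda>u. f u / (u - z)"]
  show ?thesis by simp
qed

lemma cmean_deriv:
  assumes "f holomorphic_on ball 0 R" "0 < r" "r < R"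
  shows "cmean r (\<lambda>\<eta>. f \<eta> / \<eta>) = deriv f 0"
proof -
  have h: "f holomorphic_on cball 0 r" "continuous_on (cball 0 r) f"
    using assms by (auto intro!: holomorphic_on_imp_continuous_on intro: holomorphic_on_subset)
  have "contour_integral (circlepath 0 r) (\<lambda>u. f u / (u - 0) ^ 2) = 2 * pi * \<i> * deriv f 0"
    using h assms by (intro Cauchy_contour_integral_circlepath_2) (auto intro: holomorphic_on_subset)
  moreover have "cmean r (\<lambda>\<eta>. f \<eta> / \<eta>\<^sup>2 * \<eta>) = cmean r (\<lambda>\<eta>. f \<eta> / \<eta>)"
    unfolding cmean_def by (rule integral_cong) (simp add: power2_eq_square)
  ultimately show ?thesis
    using contour_integral_circlepath_eq_cmean[of r "\<lambda>u. f u / (u - 0) ^ 2"] by simp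
qed

text \<open>The candidate derivative \<open>D\<close> is itself a Cauchy mean of \<open>G\<close>,
  so its joint continuity, which the Leibniz rule demands, follows from that of
  \<open>G\<close>.\<close>

lemma holomorphic_param_integral:
  fixes G :: "complex \<Rightarrow> real \<Rightarrow> complex"
  assumes "open U" "continuous_on (U \<times> {0..1}) (\<lambda>(s, t). G s t)"
    and hol: "\<And>t. t \<in> {0..1} \<Longrightarrow> (\<lambda>s. G s t) holomorphic_on U"
  shows "(\<lambda>s. integral {0..1} (G s)) holomorphic_on U"
proof -
  have "(\<lambda>s. integral {0..1} (G s)) field_differentiable (at p)" if "p \<in> U" for p
  proof -
    obtain e where e: "e > 0" "ball p e \<subseteq> U" using openE[OF assms(1) \<open>p \<in> U\<close>] by blast
    define D where "D = (\<lambda>s t. cmean (e/2) (\<lambda>\<eta>. G (s + \<eta>) t / \<eta>))"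
    have sub: "s + \<eta> \<in> U" if "s \<in> ball p (e/2)" "norm \<eta> \<le> e/2" for s \<eta>
    proof -
      have "dist p (s + \<eta>) \<le> dist p s + norm \<eta>"
        by (metis add.commute add_diff_cancel_left' dist_norm dist_triangle norm_minus_commute)
      then show ?thesis using that e by auto
    qed
    have "continuous_on ((ball p (e/2) \<times> {0..1}) \<times> sphere 0 (e/2)) ((\<lambda>(s,t). G s t) \<circ> (\<lambda>((s,t),\<eta>). (s + \<eta>, t)))"
      by (rule continuous_on_compose[OF _ continuous_on_subset[OF assms(2)]])
         (use sub in \<open>auto simp: case_prod_unfold intro!: continuous_intros\<close>)
    then have c: "continuous_on ((ball p (e/2) \<times> {0..1}) \<times> sphere 0 (e/2)) (\<lambda>(x, \<eta>). G (fst x + \<eta>) (snd x) / \<eta>)"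
      using e by (auto simp: case_prod_unfold o_def intro!: continuous_intros)
    have contD: "continuous_on (ball p (e/2) \<times> {0..1}) (\<lambda>(s, t). D s t)"
      using continuous_on_cmean[OF c] e by (simp add: D_def case_prod_unfold)
    have der: "((\<lambda>s. G s t) has_field_derivative D s t) (at s)" if "s \<in> ball p (e/2)" "t \<in> {0..1}" for s t
    proof -
      have "(\<lambda>\<eta>. G (s + \<eta>) t) holomorphic_on ball 0 (e - dist p s)"
      proof -
        have "((\<lambda>s. G s t) \<circ> (\<lambda>\<eta>. s + \<eta>)) holomorphic_on ball 0 (e - dist p s)"
        proof (rule holomorphic_on_compose[OF _ holomorphic_on_subset[OF hol]])
          show "(+) s ` ball 0 (e - dist p s) \<subseteq> U"
          proof clarify
            fix \<eta> :: complex assume "\<eta> \<in> ball 0 (e - dist p s)"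
            moreover have "dist p (s + \<eta>) \<le> dist p s + norm \<eta>"
              by (metis add.commute add_diff_cancel_left' dist_norm dist_triangle norm_minus_commute)
            ultimately show "s + \<eta> \<in> U" using e by auto
          qed
        qed (use that in \<open>auto intro!: holomorphic_intros\<close>)
        then show ?thesis by (simp add: o_def)
      qed
      moreover have "0 < e / 2" "e / 2 < e - dist p s" using e that by (auto simp: dist_commute)
      ultimately have "D s t = deriv (\<lambda>\<eta>. G (s + \<eta>) t) 0"
        unfolding D_def by (rule cmean_deriv)
      also have "\<dots> = deriv (\<lambda>s. G s t) s"
        by (simp add: deriv_shift_0[of _ s] o_def)
      finally have eq: "D s t = deriv (\<lambda>s. G s t) s" .
      have "s \<in> U" using sub[of s 0] that e by auto
      show ?thesis
        unfolding eq by (rule holomorphic_derivI[OF hol[OF that(2)] assms(1) \<open>s \<in> U\<close>])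
    qed
    have "(\<lambda>s. integral (cbox 0 1) (G s)) holomorphic_on ball p (e/2)"
    proof (rule leibniz_rule_holomorphic[where fx = D])
      fix s assume "s \<in> ball p (e/2)"
      have "s \<in> U" using sub[of s 0] e \<open>s \<in> ball p (e/2)\<close> by auto
      have "continuous_on {0..1} ((\<lambda>(s,t). G s t) \<circ> (\<lambda>t. (s,t)))"
        by (rule continuous_on_compose[OF _ continuous_on_subset[OF assms(2)]])
           (use \<open>s \<in> U\<close> in \<open>auto intro!: continuous_intros\<close>)
      then show "G s integrable_on cbox 0 1" by (auto simp: o_def intro!: integrable_continuous_interval)
    qed (use der contD in \<open>auto intro: has_field_derivative_at_within\<close>)
    then show ?thesis using e by (auto simp: holomorphic_on_open field_differentiable_def)
  qed
  then show ?thesis by (auto simp: holomorphic_on_def field_differentiable_at_within)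
qed

text \<open>On a complex line the mean becomes a one-variable parameter integral. This is how the
  functions built below by Cauchy integrals are seen to be holomorphic.\<close>

lemma ghol_cmean:
  fixes G :: "complex ^ 'n \<Rightarrow> complex \<Rightarrow> complex"
  assumes "open S" "0 \<le> r" "continuous_on (S \<times> sphere 0 r) (\<lambda>(u, \<eta>). G u \<eta>)"
    and g: "\<And>\<eta>. \<eta> \<in> sphere 0 r \<Longrightarrow> ghol (\<lambda>u. G u \<eta>) S"
  shows "ghol (\<lambda>u. cmean r (G u)) S"
  unfolding ghol_def
proof (intro conjI ballI allI)
  show "continuous_on S (\<lambda>u. cmean r (G u))" using assms by (intro continuous_on_cmean)
  fix p v :: "complex ^ 'n" assume "p \<in> S"
  let ?U = "{\<zeta>. p + \<zeta> *s v \<in> S}"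
  have U: "open ?U" by (rule open_line_preimage[OF assms(1)])
  have "continuous_on (?U \<times> {0..1}) ((\<lambda>(u, \<eta>). G u \<eta>) \<circ> (\<lambda>(s,t). (p + s *s v, circlepath 0 r t)))"
    by (rule continuous_on_compose[OF _ continuous_on_subset[OF assms(3)]])
       (use assms(2) in \<open>auto simp: case_prod_unfold circlepath norm_mult intro!: continuous_intros\<close>)
  then have "continuous_on (?U \<times> {0..1}) (\<lambda>(s,t). G (p + s *s v) (circlepath 0 r t))"
    by (simp add: o_def case_prod_unfold)
  then have "(\<lambda>s. integral {0..1} (\<lambda>t. G (p + s *s v) (circlepath 0 r t))) holomorphic_on ?U"
    by (rule holomorphic_param_integral[OF U])
       (rule ghol_line[OF g[OF circlepath_in_sphere[OF assms(2)]]])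
  moreover have "0 \<in> ?U" using \<open>p \<in> S\<close> by simp
  ultimately show "(\<lambda>\<zeta>. cmean r (G (p + \<zeta> *s v))) field_differentiable at 0"
    unfolding cmean_def using U holomorphic_on_imp_differentiable_at by blast
qed fact

lemma cmean_cong:
  "0 \<le> r \<Longrightarrow> (\<And>\<eta>. norm \<eta> = r \<Longrightarrow> F \<eta> = G \<eta>) \<Longrightarrow> cmean r F = cmean r G"
  unfolding cmean_def by (rule integral_cong) (simp add: circlepath norm_mult)

lemma continuous_circle:
  assumes "continuous_on (sphere 0 r) G" "0 \<le> r"
  shows "continuous_on {0..1} (\<lambda>t. G (circlepath 0 r t))"
  by (rule continuous_on_compose2[OF assms(1)])
     (use assms in \<open>auto simp: circlepath norm_mult intro!: continuous_intros\<close>)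

lemma cmean_add:
  assumes "continuous_on (sphere 0 r) F" "continuous_on (sphere 0 r) G" "0 \<le> r"
  shows "cmean r (\<lambda>\<eta>. F \<eta> + G \<eta>) = cmean r F + cmean r G"
  unfolding cmean_def
  by (intro integral_add integrable_continuous_interval continuous_circle assms)

lemma norm_cmean_le:
  assumes "continuous_on (sphere 0 r) G" "0 \<le> r" "\<And>\<eta>. norm \<eta> = r \<Longrightarrow> norm (G \<eta>) \<le> B"
  shows "norm (cmean r G) \<le> B"
proof -
  have "norm (integral {0..1} (\<lambda>t. G (circlepath 0 r t))) \<le> B * (1 - 0)"
    using assms(2,3) by (intro integral_bound continuous_circle[OF assms(1,2)]) (auto simp: circlepath norm_mult)
  then show ?thesis by (simp add: cmean_def)
qed

text \<open>The quotient of \<phi> by \<open>t ^ q\<close> is obtained, at \<open>t = 0\<close> as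
  well, from values of \<phi> on a circle that avoids both 0 and \<open>t\<close>; parameters in
  \<phi> therefore do no harm.\<close>

lemma cmean_factor:
  assumes "\<psi> holomorphic_on ball 0 R" "0 < \<rho>" "\<rho> < R" "norm t < \<rho>"
    and "\<And>\<eta>. \<eta> \<in> ball 0 R \<Longrightarrow> \<phi> \<eta> = \<eta> ^ q * \<psi> \<eta>"
  shows "cmean \<rho> (\<lambda>\<eta>. \<phi> \<eta> * \<eta> / (\<eta> ^ q * (\<eta> - t))) = \<psi> t"
proof -
  have "cmean \<rho> (\<lambda>\<eta>. \<phi> \<eta> * \<eta> / (\<eta> ^ q * (\<eta> - t))) = cmean \<rho> (\<lambda>\<eta>. \<psi> \<eta> * \<eta> / (\<eta> - t))"
    by (rule cmean_cong) (use assms in auto)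
  then show ?thesis using cmean_Cauchy[OF assms(1-4)] by simp
qed

text \<open>\<open>zorder\<close> supplies the cofactor on a small disc. Away from 0 it is
  \<open>\<phi> \<eta> / \<eta> ^ q\<close>, and gluing the two covers the whole disc.\<close>

lemma holomorphic_factor_at_0:
  fixes \<phi> :: "complex \<Rightarrow> complex"
  assumes "\<phi> holomorphic_on ball 0 R" "\<eta>0 \<in> ball 0 R" "\<phi> \<eta>0 \<noteq> 0"
  shows "\<exists>q \<psi>. \<psi> holomorphic_on ball 0 R \<and> (\<forall>\<eta>\<in>ball 0 R. \<phi> \<eta> = \<eta> ^ q * \<psi> \<eta>) \<and> \<psi> 0 \<noteq> 0"
proof -
  have R: "0 < R" using assms(2) norm_ge_zero[of \<eta>0] unfolding mem_ball_0 by linarith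
  have ex: "\<exists>w\<in>ball 0 R. \<phi> w \<noteq> 0" using assms(2,3) by blast
  have 0: "0 \<in> ball 0 R" using R by simp
  obtain r where r: "r > 0" "cball (0 :: complex) r \<subseteq> ball 0 R" "zor_poly \<phi> 0 holomorphic_on cball 0 r"
    "\<And>w. w \<in> cball 0 r \<Longrightarrow> \<phi> w = zor_poly \<phi> 0 w * (w - 0) ^ nat (zorder \<phi> 0) \<and> zor_poly \<phi> 0 w \<noteq> 0"
    using conjunct2[OF zorder_exist_zero[OF assms(1) open_ball connected_ball 0 ex]] by blast
  have z0: "zor_poly \<phi> 0 0 \<noteq> 0" using r(4)[of 0] r(1) by simp
  define q where "q = nat (zorder \<phi> 0)"
  define \<psi> where "\<psi> = (\<lambda>\<eta>. if \<eta> = 0 then zor_poly \<phi> 0 0 else \<phi> \<eta> / \<eta> ^ q)"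
  have eq: "\<psi> w = zor_poly \<phi> 0 w" if "w \<in> ball 0 r" for w
    using r(4)[of w] that by (auto simp: \<psi>_def q_def)
  have "\<psi> holomorphic_on ball 0 r"
    using r(3) by (rule_tac holomorphic_transform[OF holomorphic_on_subset[of "zor_poly \<phi> 0" _ "ball 0 r"]]) (auto simp: eq)
  moreover have "\<psi> holomorphic_on (ball 0 R - {0})"
  proof (rule holomorphic_transform)
    show "(\<lambda>\<eta>. \<phi> \<eta> / \<eta> ^ q) holomorphic_on (ball 0 R - {0})"
      by (intro holomorphic_intros holomorphic_on_subset[OF assms(1)]) auto
  qed (auto simp: \<psi>_def)
  ultimately have "\<psi> holomorphic_on (ball 0 r \<union> (ball 0 R - {0}))"
    by (intro holomorphic_on_Un) auto
  moreover have "ball 0 r \<union> (ball 0 R - {0}) = ball (0 :: complex) R"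
    using centre_in_ball[of 0 r] r(1) order_trans[OF ball_subset_cball r(2)] by blast
  moreover have "\<forall>\<eta>\<in>ball 0 R. \<phi> \<eta> = \<eta> ^ q * \<psi> \<eta>"
    using r(4)[of 0] r(1) by (auto simp: \<psi>_def q_def)
  moreover have "\<psi> 0 \<noteq> 0" using z0 by (simp add: \<psi>_def)
  ultimately show ?thesis by metis
qed

text \<open>\<open>q\<close> is the least order of vanishing at 0 among the members that are not
  identically zero, attained at \<open>v0\<close>; identically zero members get the cofactor 0.
  Radii depend on the member because members will be restrictions to lines whose directions differ
  in length.\<close>

lemma holomorphic_family_factor:
  fixes \<Phi> :: "'v \<Rightarrow> complex \<Rightarrow> complex"
  assumes hol: "\<And>v. v \<in> V \<Longrightarrow> \<Phi> v holomorphic_on ball 0 (R v)"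
    and ex: "\<exists>v\<in>V. \<exists>\<eta>\<in>ball 0 (R v). \<Phi> v \<eta> \<noteq> 0"
  obtains q v0 \<psi> where "v0 \<in> V" "\<psi> v0 0 \<noteq> 0"
    "\<And>v. v \<in> V \<Longrightarrow> \<psi> v holomorphic_on ball 0 (R v)"
    "\<And>v \<eta>. v \<in> V \<Longrightarrow> \<eta> \<in> ball 0 (R v) \<Longrightarrow> \<Phi> v \<eta> = \<eta> ^ q * \<psi> v \<eta>"
proof -
  define P where "P = (\<lambda>v q \<psi>. \<psi> holomorphic_on ball 0 (R v) \<and>
    (\<forall>\<eta>\<in>ball 0 (R v). \<Phi> v \<eta> = \<eta> ^ q * \<psi> \<eta>) \<and> \<psi> 0 \<noteq> 0)"
  have "\<exists>q. \<exists>v\<in>V. \<exists>\<psi>. P v q \<psi>"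
    using ex holomorphic_factor_at_0[OF hol] unfolding P_def by blast
  then obtain q where q: "\<exists>v\<in>V. \<exists>\<psi>. P v q \<psi>" and least: "\<And>q'. q' < q \<Longrightarrow> \<not> (\<exists>v\<in>V. \<exists>\<psi>. P v q' \<psi>)"
    using exists_least_iff[of "\<lambda>q. \<exists>v\<in>V. \<exists>\<psi>. P v q \<psi>"] by auto
  from q obtain v0 \<psi>0 where v0: "v0 \<in> V" "P v0 q \<psi>0" by blast
  have "\<exists>\<psi>. \<psi> holomorphic_on ball 0 (R v) \<and> (\<forall>\<eta>\<in>ball 0 (R v). \<Phi> v \<eta> = \<eta> ^ q * \<psi> \<eta>)"
    if "v \<in> V" for v
  proof (cases "\<exists>\<eta>\<in>ball 0 (R v). \<Phi> v \<eta> \<noteq> 0")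
    case True
    then obtain q' \<psi> where p: "P v q' \<psi>"
      using holomorphic_factor_at_0[OF hol[OF \<open>v \<in> V\<close>]] unfolding P_def by blast
    then have "q \<le> q'" using least that not_le by blast
    then have "(\<lambda>\<eta>. \<eta> ^ (q' - q) * \<psi> \<eta>) holomorphic_on ball 0 (R v)"
      "\<forall>\<eta>\<in>ball 0 (R v). \<Phi> v \<eta> = \<eta> ^ q * (\<eta> ^ (q' - q) * \<psi> \<eta>)"
      using p unfolding P_def by (auto intro!: holomorphic_intros simp flip: power_add mult.assoc)
    then show ?thesis by blast
  next
    case False
    then show ?thesis by (intro exI[of _ "\<lambda>_. 0"]) auto
  qed
  then obtain \<psi> where \<psi>: "\<And>v. v \<in> V \<Longrightarrow> \<psi> v holomorphic_on ball 0 (R v) \<and> (\<forall>\<eta>\<in>ball 0 (R v). \<Phi> v \<eta> = \<eta> ^ q * \<psi> v \<eta>)"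
    by metis
  show ?thesis
    by (rule that[of v0 "\<psi>(v0 := \<psi>0)" q]) (use v0 \<psi> in \<open>auto simp: P_def\<close>)
qed

text \<open>Identity theorem on the complex line through \<open>p\<close> and \<open>q\<close>: it
  stays in \<open>T\<close>, and its part in the ball is convex, hence connected.\<close>

lemma ghol_nonzero_near:
  fixes f :: "complex ^ 'n \<Rightarrow> complex"
  assumes "ghol f (ball 0 R)" "vec.subspace T" "p \<in> T" "p \<in> ball 0 R" "q \<in> T" "q \<in> ball 0 R" "f q \<noteq> 0" "0 < e"
  shows "\<exists>z\<in>T. z \<in> ball 0 R \<and> dist p z < e \<and> f z \<noteq> 0"
proof (rule ccontr)
  assume contra: "\<not> ?thesis"
  define U where "U = {\<zeta>. p + \<zeta> *s (q - p) \<in> ball 0 R}"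
  have op: "open U" unfolding U_def by (rule open_line_preimage) simp
  have hol: "(\<lambda>\<zeta>. f (p + \<zeta> *s (q - p))) holomorphic_on U" unfolding U_def by (rule ghol_line[OF assms(1)])
  have "convex U"
  proof (rule convexI)
    fix x y :: complex and u v :: real assume xy: "x \<in> U" "y \<in> U" "0 \<le> u" "0 \<le> v" "u + v = 1"
    have "p + (u *\<^sub>R x + v *\<^sub>R y) *s (q - p) = u *\<^sub>R (p + x *s (q - p)) + v *\<^sub>R (p + y *s (q - p))"
    proof -
      have "p = (u + v) *\<^sub>R p" using xy by simp
      then show ?thesis
        by (simp only: scaleR_add_right vec.scale_left_distrib scaleR_add_left)
           (simp add: vec_eq_iff scaleR_conv_of_real[where 'a = complex] algebra_simps)
    qed
    then show "u *\<^sub>R x + v *\<^sub>R y \<in> U"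
      using convexD[OF convex_ball, of "p + x *s (q - p)" 0 R "p + y *s (q - p)" u v] xy by (simp add: U_def)
  qed
  then have con: "connected U" by (rule convex_connected)
  have 0: "0 \<in> U" "1 \<in> U" using assms by (auto simp: U_def)
  define V where "V = U \<inter> {\<zeta>. p + \<zeta> *s (q - p) \<in> ball p e}"
  have opV: "open V" unfolding V_def by (intro open_Int op open_line_preimage) simp
  have T: "p + \<zeta> *s (q - p) \<in> T" for \<zeta>
    using assms by (intro vec.subspace_add vec.subspace_scale vec.subspace_diff)
  have z: "f (p + \<zeta> *s (q - p)) = 0" if "\<zeta> \<in> V" for \<zeta>
    using contra T[of \<zeta>] that by (auto simp: V_def U_def)
  have "(\<lambda>\<zeta>. f (p + \<zeta> *s (q - p))) 1 = 0"
  proof (rule analytic_continuation_open[of V U "\<lambda>\<zeta>. f (p + \<zeta> *s (q - p))" "\<lambda>_. 0"])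
    show "V \<noteq> {}" using 0 assms by (auto simp: V_def)
  qed (use opV op con hol z 0 in \<open>auto simp: V_def\<close>)
  then show False using assms by simp
qed

section \<open>Directional derivatives and total differentiability\<close>

definition dder :: "(complex ^ 'n \<Rightarrow> complex) \<Rightarrow> complex ^ 'n \<Rightarrow> complex ^ 'n \<Rightarrow> complex" where
  "dder f v p = deriv (\<lambda>\<zeta>. f (p + \<zeta> *s v)) 0"

lemma dder_has_derivative:
  assumes "ghol f S" "p + t *s v \<in> S"
  shows "((\<lambda>\<zeta>. f (p + \<zeta> *s v)) has_field_derivative dder f v (p + t *s v)) (at t)"
proof -
  have "((\<lambda>\<zeta>. f (p + t *s v + \<zeta> *s v)) has_field_derivative dder f v (p + t *s v)) (at 0)"
    unfolding dder_def DERIV_deriv_iff_field_differentiable using assms by (auto simp: ghol_def)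
  then have "((\<lambda>\<zeta>. f (p + (\<zeta> + t) *s v)) has_field_derivative dder f v (p + t *s v)) (at 0)"
    by (simp add: vec.scale_left_distrib add.assoc add.commute[of "t *s v"])
  then show ?thesis using DERIV_shift[of "\<lambda>\<zeta>. f (p + \<zeta> *s v)" _ 0 t] by simp
qed

lemma dder_scale:
  assumes "ghol f S" "p \<in> S"
  shows "dder f (c *s v) p = c * dder f v p"
proof -
  have "((\<lambda>\<zeta>. f (p + \<zeta> *s v)) has_field_derivative dder f v p) (at (0 * c))"
    using dder_has_derivative[OF assms(1), of p 0 v] assms(2) by simp
  then have "((\<lambda>\<zeta>. f (p + (\<zeta> * c) *s v)) has_field_derivative dder f v p * c) (at 0)"
    by (rule DERIV_chain2) (auto intro!: derivative_eq_intros)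
  then show ?thesis unfolding dder_def[of f "c *s v"]
    by (simp add: DERIV_imp_deriv mult.commute)
qed

lemma line_in_ball:
  fixes v :: "complex ^ 'n"
  assumes "norm v \<le> 1" "norm \<eta> \<le> r" "u \<in> ball p e"
  shows "u + \<eta> *s v \<in> ball p (e + r)"
proof -
  have "norm (\<eta> *s v) \<le> r * 1" unfolding norm_smult_vec by (rule mult_mono) (use assms in \<open>auto intro: order_trans[OF norm_ge_zero]\<close>)
  moreover have "dist p (u + \<eta> *s v) \<le> dist p u + norm (\<eta> *s v)"
    by (metis add.commute add_diff_cancel_left' dist_norm dist_triangle norm_minus_commute)
  ultimately show ?thesis using assms by auto
qed

lemma dder_eq_cmean:
  assumes "ghol f S" "ball p (2 * e) \<subseteq> S" "0 < e" "norm v \<le> 1" "u \<in> ball p e" "0 < r" "r < e"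
  shows "dder f v u = cmean r (\<lambda>\<eta>. f (u + \<eta> *s v) / \<eta>)"
proof -
  have "(\<lambda>\<zeta>. f (u + \<zeta> *s v)) holomorphic_on ball 0 e"
    by (rule holomorphic_on_subset[OF ghol_line[OF assms(1)]])
       (use assms line_in_ball[of v _ e u p e] in force)
  from cmean_deriv[OF this assms(6,7)] show ?thesis by (simp add: dder_def)
qed

text \<open>The bound on \<open>v\<close> keeps the Cauchy discs \<open>u + \<eta> *s v\<close>
  inside \<open>S\<close> uniformly in \<open>u\<close>; general directions follow by homogeneity in
  \<open>ghol_dder\<close>.\<close>

lemma ghol_dder_le1:
  assumes "ghol f S" "norm v \<le> 1"
  shows "ghol (dder f v) S"
proof (rule ghol_local)
  show "open S" using assms by (simp add: ghol_def)
  fix p assume "p \<in> S"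
  then obtain d where "d > 0" "ball p d \<subseteq> S" using \<open>open S\<close> openE by blast
  then obtain e where e: "e > 0" "ball p (2 * e) \<subseteq> S" by (metis field_sum_of_halves half_gt_zero mult_2)
  have *: "u + \<eta> *s v \<in> S" if "u \<in> ball p e" "norm \<eta> = e/2" for u \<eta>
    using line_in_ball[OF assms(2) _ that(1), of \<eta> "e/2"] that e by (auto simp: subset_iff)
  have "ghol (\<lambda>u. cmean (e/2) (\<lambda>\<eta>. f (u + \<eta> *s v) / \<eta>)) (ball p e)"
  proof (rule ghol_cmean)
    have "continuous_on (ball p e \<times> sphere 0 (e/2)) (\<lambda>x. f (fst x + snd x *s v))"
      by (rule continuous_on_compose2[OF ghol_continuous[OF assms(1)]])
         (use * in \<open>auto intro!: continuous_intros\<close>)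
    then show "continuous_on (ball p e \<times> sphere 0 (e/2)) (\<lambda>(u, \<eta>). f (u + \<eta> *s v) / \<eta>)"
      using e by (auto simp: case_prod_unfold intro!: continuous_intros)
    show "ghol (\<lambda>u. f (u + \<eta> *s v) / \<eta>) (ball p e)" if "\<eta> \<in> sphere 0 (e/2)" for \<eta>
      using that e * by (auto intro!: ghol_divide ghol_translate[OF assms(1)] ghol_const)
  qed (use e in auto)
  moreover have "cmean (e/2) (\<lambda>\<eta>. f (u + \<eta> *s v) / \<eta>) = dder f v u" if "u \<in> ball p e" for u
    using dder_eq_cmean[OF assms(1) e(2,1) assms(2) that, of "e/2"] e by simp
  ultimately have "ghol (dder f v) (ball p e)" by (rule ghol_cong)
  then show "\<exists>O'. open O' \<and> p \<in> O' \<and> ghol (dder f v) O'" using e by (intro exI[of _ "ball p e"]) auto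
qed

lemma smult_normalize:
  fixes v :: "complex ^ 'n"
  obtains v' c where "v = c *s v'" "norm v' \<le> 1" "norm c = norm v"
proof (cases "v = 0")
  case True
  then show ?thesis by (intro that[of 0 v]) auto
next
  case False
  then show ?thesis
    by (intro that[of "of_real (norm v)" "of_real (inverse (norm v)) *s v"])
       (auto simp: norm_smult_vec norm_inverse)
qed

lemma ghol_dder:
  assumes "ghol f S"
  shows "ghol (dder f v) S"
proof -
  obtain v' c where v: "v = c *s v'" "norm v' \<le> 1" by (rule smult_normalize)
  have "ghol (\<lambda>p. c * dder f v' p) S"
    using assms v by (intro ghol_mult ghol_dder_le1 ghol_const) (auto intro: ghol_open)
  then show ?thesis by (rule ghol_cong) (simp add: v dder_scale[OF assms])
qed

text \<open>Cauchy estimate for the second-order Taylor remainder along \<open>v\<close>. Uniformity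
  in the base point \<open>u\<close> serves additivity of the derivative, uniformity in
  \<open>v\<close> serves Frechet differentiability.\<close>

lemma ghol_remainder:
  fixes f :: "complex ^ 'n \<Rightarrow> complex"
  assumes "ghol f S" "p \<in> S"
  obtains C e where "0 < e" "0 \<le> C" "ball p e \<subseteq> S"
    "\<And>u v s. u \<in> ball p e \<Longrightarrow> norm v \<le> 1 \<Longrightarrow> norm s < e \<Longrightarrow>
       norm (f (u + s *s v) - f u - s * dder f v u) \<le> C * norm s ^ 2"
proof -
  obtain d where d: "d > 0" "cball p d \<subseteq> S"
    using assms by (meson ghol_open open_contains_cball_eq)
  have "continuous_on (cball p d) f" using ghol_continuous[OF assms(1)] d by (rule_tac continuous_on_subset)
  then have "compact (f ` cball p d)" by (intro compact_continuous_image) auto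
  then obtain M where M: "\<And>z. z \<in> cball p d \<Longrightarrow> norm (f z) \<le> M" "0 < M"
    using bounded_pos[of "f ` cball p d"] compact_imp_bounded by blast
  \<comment> \<open>For \<open>u\<close> within \<open>e = d / 6\<close> of \<open>p\<close>, discs
    of radius \<open>d / 2\<close> along \<open>v\<close> stay in the ball of radius
    \<open>d\<close>. Since \<open>e = r / 2\<close>, the point \<open>s\<close> keeps distance at
    least \<open>r / 2\<close> from the circle of radius \<open>r\<close>.\<close>
  define r where "r = d / 3"
  have r: "r > 0" using d by (simp add: r_def)
  define e where "e = d / 6"
  have e: "e > 0" "e \<le> r / 2" using d by (simp_all add: e_def r_def)
  show ?thesis
  proof (rule that[of e "2 * M / r ^ 2"])
    fix u v :: "complex ^ 'n" and s :: complex
    assume u: "u \<in> ball p e" and v: "norm v \<le> 1" and s: "norm s < e"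
    have inb: "u + \<eta> *s v \<in> ball p d" if "norm \<eta> \<le> d/2" for \<eta>
      using line_in_ball[OF v that u] d by (auto simp: e_def)
    define \<phi> where "\<phi> = (\<lambda>\<eta>. f (u + \<eta> *s v))"
    have hol: "\<phi> holomorphic_on ball 0 (d/2)"
      unfolding \<phi>_def by (rule holomorphic_on_subset[OF ghol_line[OF assms(1)]])
        (use inb d in \<open>force simp: less_imp_le\<close>)
    have rd: "r < d/2" using d by (simp add: r_def)
    have sr: "norm s < r" "norm s \<le> r/2" using s e by auto
    have cont: "continuous_on (sphere 0 r) \<phi>"
      by (rule continuous_on_subset[OF holomorphic_on_imp_continuous_on[OF hol]]) (use rd in auto)
    have ne: "\<eta> - s \<noteq> 0" "\<eta> \<noteq> 0" if "norm \<eta> = r" for \<eta> using that sr r by auto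
    have 1: "\<phi> s = cmean r (\<lambda>\<eta>. \<phi> \<eta> * \<eta> / (\<eta> - s))" using cmean_Cauchy[OF hol r rd sr(1)] by simp
    have 2: "\<phi> 0 = cmean r (\<lambda>\<eta>. \<phi> \<eta>)"
    proof -
      have "\<phi> 0 = cmean r (\<lambda>\<eta>. \<phi> \<eta> * \<eta> / (\<eta> - 0))" using cmean_Cauchy[OF hol r rd, of 0] r by simp
      also have "\<dots> = cmean r (\<lambda>\<eta>. \<phi> \<eta>)" by (rule cmean_cong) (use r in auto)
      finally show ?thesis .
    qed
    have 3: "dder f v u = cmean r (\<lambda>\<eta>. \<phi> \<eta> / \<eta>)" using cmean_deriv[OF hol r rd] by (simp add: dder_def \<phi>_def)
    have 4: "s * cmean r (\<lambda>\<eta>. \<phi> \<eta> / \<eta>) = cmean r (\<lambda>\<eta>. s * (\<phi> \<eta> / \<eta>))"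
      by (simp only: cmean_def integral_mult_right)
    \<comment> \<open>The error term of the expansion \<eta> / (\<eta> - s) = 1 + s / \<eta> + s^2 /
      (\<eta> (\<eta> - s)).\<close>
    define \<kappa> where "\<kappa> = (\<lambda>\<eta>. \<phi> \<eta> * s^2 / (\<eta> * (\<eta> - s)))"
    have c\<kappa>: "continuous_on (sphere 0 r) \<kappa>" unfolding \<kappa>_def
      using ne by (intro continuous_intros cont) (simp add: dist_norm)
    have c4: "continuous_on (sphere 0 r) (\<lambda>\<eta>. s * (\<phi> \<eta> / \<eta>))"
      using ne r by (intro continuous_intros cont) auto
    have "\<phi> s = cmean r (\<lambda>\<eta>. \<kappa> \<eta> + (\<phi> \<eta> + s * (\<phi> \<eta> / \<eta>)))"
      unfolding 1 by (rule cmean_cong) (use ne r in \<open>auto simp: \<kappa>_def divide_simps power2_eq_square, simp add: algebra_simps\<close>)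
    also have "\<dots> = cmean r \<kappa> + (cmean r \<phi> + cmean r (\<lambda>\<eta>. s * (\<phi> \<eta> / \<eta>)))"
      using r by (subst cmean_add, intro c\<kappa>, intro continuous_on_add cont c4, simp, subst cmean_add, intro cont, intro c4) auto
    finally have "f (u + s *s v) - f u - s * dder f v u = cmean r \<kappa>"
      using 2 3 4 by (simp add: \<phi>_def)
    moreover have "norm (cmean r \<kappa>) \<le> 2 * M / r^2 * norm s ^ 2"
    proof (rule norm_cmean_le[OF c\<kappa>])
      fix \<eta> :: complex assume \<eta>: "norm \<eta> = r"
      have "norm (\<phi> \<eta>) \<le> M" using M(1)[of "u + \<eta> *s v"] inb[of \<eta>] \<eta> rd by (simp add: \<phi>_def)
      moreover have "r / 2 \<le> norm (\<eta> - s)" using norm_triangle_ineq2[of \<eta> s] \<eta> sr by simp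
      ultimately have "norm (\<phi> \<eta>) * norm s ^ 2 / (r * norm (\<eta> - s)) \<le> M * norm s ^ 2 / (r * (r / 2))"
        using r M(2) by (intro frac_le mult_mono) auto
      also have "\<dots> = 2 * M / r^2 * norm s ^ 2" by (simp add: power2_eq_square)
      finally show "norm (\<kappa> \<eta>) \<le> 2 * M / r^2 * norm s ^ 2"
        using \<eta> by (simp add: \<kappa>_def norm_mult norm_divide norm_power)
    qed (use r in simp)
    ultimately show "norm (f (u + s *s v) - f u - s * dder f v u) \<le> 2 * M / r^2 * norm s ^ 2" by simp
  next
    have "e \<le> d" using d by (simp add: e_def)
    then show "ball p e \<subseteq> S" using order_trans[OF order_trans[OF ball_subset_cball subset_cball] d(2)] by blast
  qed (use e(1) M(2) r in auto)
qed

text \<open>The step \<open>s *s (v + w)\<close> is made at once, or as \<open>s *s v\<close>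
  followed by \<open>s *s w\<close> from the moved base point. The remainders are O(s^2), so after
  division by \<open>s\<close> continuity of \<open>dder f w\<close> at \<open>p\<close> gives the
  claim for short vectors; homogeneity extends it.\<close>

lemma dder_add:
  fixes f :: "complex ^ 'n \<Rightarrow> complex"
  assumes f: "ghol f S" and p: "p \<in> S"
  shows "dder f (v + w) p = dder f v p + dder f w p"
proof -
  obtain C e where e: "0 < e" "0 \<le> C" "ball p e \<subseteq> S"
    and R: "\<And>u v s. u \<in> ball p e \<Longrightarrow> norm v \<le> 1 \<Longrightarrow> norm s < e \<Longrightarrow>
       norm (f (u + s *s v) - f u - s * dder f v u) \<le> C * norm s ^ 2"
    by (rule ghol_remainder[OF assms]) (rule that)
  have main: "dder f (v + w) p = dder f v p + dder f w p" if n: "norm v \<le> 1/2" "norm w \<le> 1/2" for v w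
  proof -
    have nvw: "norm (v + w) \<le> 1" using norm_triangle_ineq[of v w] n by simp
    have est: "norm (dder f (v + w) p - dder f v p - dder f w (p + of_real s *s v)) \<le> 3 * C * s"
      if s: "0 < s" "s < e" for s :: real
    proof -
      let ?s = "complex_of_real s"
      have u: "p + ?s *s v \<in> ball p e"
        using n s by (auto simp: dist_norm norm_smult_vec intro: le_less_trans[of _ "s * 1"])
      have a: "norm (f (p + ?s *s (v + w)) - f p - ?s * dder f (v + w) p) \<le> C * s^2"
        using R[of p "v + w" ?s] e nvw s by simp
      have b: "norm (f (p + ?s *s v) - f p - ?s * dder f v p) \<le> C * s^2"
        using R[of p v ?s] e n s by simp
      have c: "norm (f (p + ?s *s (v + w)) - f (p + ?s *s v) - ?s * dder f w (p + ?s *s v)) \<le> C * s^2"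
        using R[OF u, of w ?s] e n s by (simp add: vec.scale_right_distrib add.assoc)
      let ?X = "dder f (v + w) p - dder f v p - dder f w (p + ?s *s v)"
      have "?s * ?X
        = - (f (p + ?s *s (v + w)) - f p - ?s * dder f (v + w) p) + (f (p + ?s *s v) - f p - ?s * dder f v p)
         + (f (p + ?s *s (v + w)) - f (p + ?s *s v) - ?s * dder f w (p + ?s *s v))"
        by (simp add: algebra_simps)
      also have "norm \<dots> \<le> C * s^2 + C * s^2 + C * s^2"
        using a b c by (intro norm_triangle_le add_mono order_refl) (simp_all only: norm_minus_cancel)
      finally have "norm ?s * norm ?X \<le> s * (3 * C * s)"
        by (simp only: norm_mult[symmetric]) (simp add: power2_eq_square algebra_simps)
      then show ?thesis using s by simp
    qed
    have "((\<lambda>s. norm (dder f (v + w) p - dder f v p - dder f w (p + complex_of_real s *s v)))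
        \<longlongrightarrow> norm (dder f (v + w) p - dder f v p - dder f w (p + complex_of_real 0 *s v))) (at_right 0)"
    proof (intro tendsto_intros)
      have "isCont (dder f w) (p + complex_of_real 0 *s v)"
        using ghol_dder[OF f, of w] p by (auto simp: ghol_def continuous_on_eq_continuous_at)
      moreover have "((\<lambda>s. p + complex_of_real s *s v) \<longlongrightarrow> p + complex_of_real 0 *s v) (at_right 0)"
        by (intro tendsto_intros)
      ultimately show "((\<lambda>s. dder f w (p + complex_of_real s *s v)) \<longlongrightarrow> dder f w (p + complex_of_real 0 *s v)) (at_right 0)"
        by (rule isCont_tendsto_compose)
    qed
    moreover have "((\<lambda>s. 3 * C * s) \<longlongrightarrow> 3 * C * 0) (at_right 0)" by (intro tendsto_intros)
    moreover have "\<forall>\<^sub>F s in at_right 0. norm (dder f (v + w) p - dder f v p - dder f w (p + complex_of_real s *s v)) \<le> 3 * C * s"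
      using est e by (auto simp: eventually_at_right_field)
    ultimately have "norm (dder f (v + w) p - dder f v p - dder f w (p + complex_of_real 0 *s v)) \<le> 3 * C * 0"
      by (intro tendsto_le[of "at_right (0::real)"]) auto
    then show ?thesis by (simp add: algebra_simps)
  qed
  \<comment> \<open>Brings both vectors to norm at most 1/2; the summand 1 keeps \<open>k\<close>
    nonzero when both vanish.\<close>
  define k where "k = complex_of_real (2 * (norm v + norm w + 1))"
  have pos: "0 < 2 * (norm v + norm w + 1)" by (intro mult_pos_pos add_nonneg_pos add_nonneg_nonneg norm_ge_zero) simp_all
  then have k: "k \<noteq> 0" "norm k = 2 * (norm v + norm w + 1)"
    unfolding k_def of_real_eq_0_iff norm_of_real by simp_all
  have "inverse (2 * (a + b + 1)) * a \<le> 1/2" "inverse (2 * (b + a + 1)) * a \<le> 1/2" if "a \<ge> 0" "b \<ge> 0" for a b :: real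
    using that by (simp_all add: divide_simps)
  then have "norm (inverse k *s v) \<le> 1/2" "norm (inverse k *s w) \<le> 1/2"
    unfolding norm_smult_vec norm_inverse k by simp_all
  from main[OF this] have "dder f (inverse k *s (v + w)) p = dder f (inverse k *s v) p + dder f (inverse k *s w) p"
    by (simp add: vec.scale_right_distrib)
  then have "inverse k * dder f (v + w) p = inverse k * (dder f v p + dder f w p)"
    unfolding dder_scale[OF f p] by (simp only: distrib_left)
  then show ?thesis using k(1) by simp
qed

lemma dder_linear:
  assumes "ghol f S" "p \<in> S"
  shows "Vector_Spaces.linear (*s) (*) (\<lambda>v. dder f v p)"
  by unfold_locales (simp_all add: dder_add[OF assms] dder_scale[OF assms] algebra_simps)

text \<open>Total differentiability is what permits composition with maps that bend complex lines,
  as in \<open>ghol_compose\<close>.\<close>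

lemma ghol_has_derivative:
  fixes f :: "complex ^ 'n \<Rightarrow> complex"
  assumes f: "ghol f S" and p: "p \<in> S"
  shows "(f has_derivative (\<lambda>v. dder f v p)) (at p)"
proof -
  obtain C e where e: "0 < e" "0 \<le> C" "ball p e \<subseteq> S"
    and R: "\<And>u v s. u \<in> ball p e \<Longrightarrow> norm v \<le> 1 \<Longrightarrow> norm s < e \<Longrightarrow>
       norm (f (u + s *s v) - f u - s * dder f v u) \<le> C * norm s ^ 2"
    by (rule ghol_remainder[OF assms]) (rule that)
  have est: "norm (f (p + h) - f p - dder f h p) \<le> C * norm h ^ 2" if "norm h < e" for h
  proof -
    obtain v c where h: "h = c *s v" "norm v \<le> 1" "norm c = norm h" by (rule smult_normalize)
    then show ?thesis using R[of p v c] e that by (simp add: dder_scale[OF f p])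
  qed
  show ?thesis
    unfolding has_derivative_at
  proof
    show "bounded_linear (\<lambda>v. dder f v p)" by (rule clinear_functional_bounded[OF dder_linear[OF assms]])
    show "(\<lambda>h. norm (f (p + h) - f p - dder f h p) / norm h) \<midarrow>0\<rightarrow> 0"
    proof (rule tendsto_sandwich[where f = "\<lambda>_. 0" and h = "\<lambda>h. C * norm h"])
      show "\<forall>\<^sub>F h in at 0. norm (f (p + h) - f p - dder f h p) / norm h \<le> C * norm h"
        unfolding eventually_at using est e
        by (intro exI[of _ e]) (auto simp: divide_simps power2_eq_square mult.assoc)
      show "((\<lambda>h::complex ^ 'n. C * norm h) \<longlongrightarrow> 0) (at 0)"
        by (intro tendsto_mult_right_zero tendsto_norm_zero tendsto_ident_at)
    qed auto
  qed
qed

section \<open>Symmetric functions of roots\<close>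

text \<open>The coefficient of X^k is (-1)^k times the k-th elementary symmetric function of
  \<open>N\<close>. Writing the polynomial as a power series gives access to its logarithmic
  derivative.\<close>

definition root_fps :: "complex multiset \<Rightarrow> complex fps" where
  "root_fps N = (\<Prod>x\<in>#N. 1 - fps_const x * fps_X)"

lemma root_fps_add_mset: "root_fps (add_mset x N) = (1 - fps_const x * fps_X) * root_fps N"
  by (simp add: root_fps_def)

lemma root_fps_add_mset_nth:
  "root_fps (add_mset x N) $ k = root_fps N $ k - (if k = 0 then 0 else x * root_fps N $ (k - 1))"
  unfolding root_fps_add_mset by (simp add: left_diff_distrib mult.assoc)

lemma root_fps_nth_0: "root_fps N $ 0 = 1"
  by (induction N) (auto simp: root_fps_add_mset_nth, simp add: root_fps_def)

text \<open>The logarithmic derivative of 1 - x X is -x / (1 - x X), the negative of the series with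
  coefficients \<open>x ^ (k + 1)\<close>; summing over the roots gives power sums.\<close>

lemma root_fps_deriv:
  "fps_deriv (root_fps N) = - (root_fps N * Abs_fps (\<lambda>k. \<Sum>x\<in>#N. x ^ (k + 1)))"
proof (induction N)
  case empty
  have "Abs_fps (\<lambda>k. 0 :: complex) = 0" by (simp add: fps_eq_iff)
  then show ?case by (simp add: root_fps_def)
next
  case (add x N)
  let ?P = "Abs_fps (\<lambda>k. \<Sum>x\<in>#N. x ^ (k + 1))" and ?G = "Abs_fps (\<lambda>k. x ^ (k + 1))"
  have 1: "Abs_fps (\<lambda>k. \<Sum>x\<in>#add_mset x N. x ^ (k + 1)) = ?G + ?P"
    by (simp add: fps_eq_iff)
  have 2: "(1 - fps_const x * fps_X) * ?G = fps_const x"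
  proof (rule fps_ext)
    fix n show "((1 - fps_const x * fps_X) * ?G) $ n = fps_const x $ n"
      by (cases n) (simp_all add: algebra_simps)
  qed
  have "fps_deriv (root_fps (add_mset x N))
      = - fps_const x * root_fps N - (1 - fps_const x * fps_X) * (root_fps N * ?P)"
  proof -
    have d: "fps_deriv (1 - fps_const x * fps_X) = - fps_const x" by simp
    have e: "a * - b + - c * R = - c * R - a * b" for a b c R :: "complex fps" by simp
    show ?thesis unfolding root_fps_add_mset fps_deriv_mult add.IH d e ..
  qed
  also have "\<dots> = - ((1 - fps_const x * fps_X) * root_fps N * (?G + ?P))"
  proof -
    have "- c * R - a * (R * P) = - (a * R * (G + P))" if "a * G = c" for a c R G P :: "complex fps"
      unfolding that[symmetric] by (simp add: distrib_left mult_ac)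
    then show ?thesis using 2 .
  qed
  finally show ?case unfolding 1 root_fps_add_mset .
qed

lemma root_fps_nth_eq_0: "size N < k \<Longrightarrow> root_fps N $ k = 0"
proof (induction N arbitrary: k)
  case (add x N)
  then show ?case by (cases k) (auto simp: root_fps_add_mset_nth)
qed (auto simp: root_fps_def)

lemma root_fps_nth_size: "root_fps N $ size N = (\<Prod>x\<in>#N. - x)"
  by (induction N) (auto simp: root_fps_add_mset_nth root_fps_nth_eq_0, simp add: root_fps_def)

text \<open>Newton's identities, read off from the logarithmic derivative of \<open>root_fps\<close>,
  express elementary symmetric functions through power sums.\<close>

lemma ghol_prod_mset_of_power_sums:
  assumes "open S" "\<And>m. ghol (\<lambda>u. \<Sum>x\<in>#N u. x ^ m) S" "\<And>u. u \<in> S \<Longrightarrow> size (N u) = d"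
  shows "ghol (\<lambda>u. \<Prod>x\<in>#N u. x) S"
proof -
  have E: "ghol (\<lambda>u. root_fps (N u) $ k) S" for k
  proof (induction k rule: less_induct)
    case (less k)
    show ?case
    proof (cases k)
      case 0
      then show ?thesis using assms(1) by (auto simp: root_fps_nth_0)
    next
      case (Suc l)
      \<comment> \<open>Coefficient \<open>l\<close> of \<open>root_fps_deriv\<close>. On the right
        only coefficients of index at most \<open>l = k - 1\<close> occur, so the induction
        hypothesis covers them.\<close>
      have "root_fps (N u) $ k = - (\<Sum>i=0..l. root_fps (N u) $ i * (\<Sum>x\<in>#N u. x ^ (l - i + 1))) * (1 / of_nat (Suc l))" for u
      proof -
        have "of_nat (Suc l) * root_fps (N u) $ k = fps_deriv (root_fps (N u)) $ l" using Suc by simp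
        also have "\<dots> = - (\<Sum>i=0..l. root_fps (N u) $ i * (\<Sum>x\<in>#N u. x ^ (l - i + 1)))"
          unfolding root_fps_deriv by (simp add: fps_mult_nth)
        finally show ?thesis by (simp add: field_simps del: of_nat_Suc)
      qed
      moreover have "ghol (\<lambda>u. (0 - (\<Sum>i=0..l. root_fps (N u) $ i * (\<Sum>x\<in>#N u. x ^ (l - i + 1)))) * (1 / of_nat (Suc l))) S"
        by (intro ghol_mult ghol_diff ghol_const ghol_sum assms less) (use Suc in auto)
      ultimately show ?thesis by simp
    qed
  qed
  have "ghol (\<lambda>u. (- 1) ^ d * root_fps (N u) $ d) S"
    by (intro ghol_mult ghol_const E assms)
  then show ?thesis
  proof (rule ghol_cong)
    fix u assume "u \<in> S"
    then have "root_fps (N u) $ d = (\<Prod>x\<in>#N u. - x)" using root_fps_nth_size[of "N u"] assms(3) by simp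
    also have "\<dots> = (\<Prod>x\<in>#N u. (- 1) * x)" by simp
    also have "\<dots> = (- 1) ^ d * (\<Prod>x\<in>#N u. x)"
      using assms(3)[OF \<open>u \<in> S\<close>] by (simp only: prod_mset.distrib) simp
    finally show "(- 1) ^ d * root_fps (N u) $ d = (\<Prod>x\<in>#N u. x)"
      by (simp flip: power_mult_distrib mult.assoc)
  qed
qed

text \<open>Holomorphy of the pair (u, \<zeta>) is encoded as joint continuity with holomorphy in
  each argument; this form is checked easily and suffices for circle means in \<zeta>.\<close>

definition hol2 :: "(complex ^ 'n \<Rightarrow> complex \<Rightarrow> complex) \<Rightarrow> real \<Rightarrow> real \<Rightarrow> bool" where
  "hol2 F \<delta> r \<longleftrightarrow> continuous_on (ball 0 \<delta> \<times> ball 0 r) (\<lambda>(u, \<zeta>). F u \<zeta>) \<and>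
     (\<forall>\<zeta>\<in>ball 0 r. ghol (\<lambda>u. F u \<zeta>) (ball 0 \<delta>)) \<and> (\<forall>u\<in>ball 0 \<delta>. F u holomorphic_on ball 0 r)"

lemma hol2_subset:
  assumes "hol2 F \<delta> r" "\<delta>' \<le> \<delta>" "r' \<le> r"
  shows "hol2 F \<delta>' r'"
proof -
  have 1: "ball (0 :: complex ^ 'n) \<delta>' \<subseteq> ball 0 \<delta>" "ball (0 :: complex) r' \<subseteq> ball 0 r" using assms by auto
  have 2: "ball (0 :: complex ^ 'n) \<delta>' \<times> ball (0 :: complex) r' \<subseteq> ball 0 \<delta> \<times> ball 0 r" using 1 by auto
  show ?thesis unfolding hol2_def
  proof (intro conjI ballI)
    show "continuous_on (ball 0 \<delta>' \<times> ball 0 r') (\<lambda>(u, \<zeta>). F u \<zeta>)"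
      using assms(1) by (intro continuous_on_subset[OF _ 2]) (simp add: hol2_def)
    show "ghol (\<lambda>u. F u \<zeta>) (ball 0 \<delta>')" if "\<zeta> \<in> ball 0 r'" for \<zeta>
      using assms(1) that 1 by (intro ghol_subset[OF _ 1(1)]) (auto simp: hol2_def)
    show "F u holomorphic_on ball 0 r'" if "u \<in> ball 0 \<delta>'" for u
      using assms(1) that 1 by (intro holomorphic_on_subset[OF _ 1(2)]) (auto simp: hol2_def)
  qed
qed

lemma hol2_const: "hol2 (\<lambda>_ _. c) \<delta> r"
  by (auto simp: hol2_def intro!: ghol_const continuous_intros simp: case_prod_unfold)

lemma hol2_add: "hol2 F \<delta> r \<Longrightarrow> hol2 G \<delta> r \<Longrightarrow> hol2 (\<lambda>u \<zeta>. F u \<zeta> + G u \<zeta>) \<delta> r"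
  by (auto simp: hol2_def case_prod_unfold intro!: ghol_add continuous_intros holomorphic_intros)

lemma hol2_mult: "hol2 F \<delta> r \<Longrightarrow> hol2 G \<delta> r \<Longrightarrow> hol2 (\<lambda>u \<zeta>. F u \<zeta> * G u \<zeta>) \<delta> r"
  by (auto simp: hol2_def case_prod_unfold intro!: ghol_mult continuous_intros holomorphic_intros)

lemma hol2_power: "hol2 F \<delta> r \<Longrightarrow> hol2 (\<lambda>u \<zeta>. F u \<zeta> ^ k) \<delta> r"
  by (induction k) (auto intro: hol2_const hol2_mult)

lemma sum_mset_sum_replicate:
  "finite A \<Longrightarrow> (\<Sum>x\<in>#(\<Sum>p\<in>A. replicate_mset (n p) p). f x) = (\<Sum>p\<in>A. of_nat (n p) * (f p :: complex))"
  by (induction A rule: finite_induct) auto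

lemma set_mset_sum_replicate:
  assumes "finite A" shows "set_mset (\<Sum>p\<in>A. replicate_mset (n p) p) = {p\<in>A. n p > 0}"
  using assms
proof (induction A rule: finite_induct)
  case (insert x A)
  have "set_mset (\<Sum>p\<in>insert x A. replicate_mset (n p) p)
     = (if n x = 0 then {} else {x}) \<union> set_mset (\<Sum>p\<in>A. replicate_mset (n p) p)"
    using insert.hyps by simp
  then show ?case unfolding insert.IH by auto
qed simp

text \<open>The argument principle with weight \<phi>. One multiset, the zeros with multiplicity,
  serves all weights, and hence all power sums at once.\<close>

lemma zeros_power_sum:
  assumes F: "F holomorphic_on ball 0 r0" and r: "0 < r" "r < r0"
    and nz: "\<And>\<zeta>. norm \<zeta> = r \<Longrightarrow> F \<zeta> \<noteq> 0"
  shows "\<exists>M. set_mset M = {\<zeta>\<in>ball 0 r. F \<zeta> = 0} \<and> (\<forall>\<phi>. \<phi> holomorphic_on ball 0 r0 \<longrightarrow>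
    (\<Sum>\<zeta>\<in>#M. \<phi> \<zeta>) = cmean r (\<lambda>\<eta>. deriv F \<eta> * \<phi> \<eta> / F \<eta> * \<eta>))"
proof -
  \<comment> \<open>The closed disc of radius \<open>r1\<close> is compact in the domain, so it has
    finitely many zeros, and its interior still contains the contour.\<close>
  define r1 where "r1 = (r + r0) / 2"
  have r1: "r < r1" "r1 < r0" using r by (auto simp: r1_def)
  have sub: "ball (0 :: complex) r1 \<subseteq> ball 0 r0" "cball (0 :: complex) r1 \<subseteq> ball 0 r0" using r1 by auto
  have ne: "F (of_real r) \<noteq> 0" using nz r by simp
  have rin: "of_real r \<in> ball (0 :: complex) r0" "of_real r \<in> ball (0 :: complex) r1" using r r1 by auto
  have fin: "finite {z\<in>cball 0 r1. F z = 0}"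
  proof (cases "F constant_on ball 0 r0")
    case True
    then obtain c where "\<forall>z\<in>ball 0 r0. F z = c" by (auto simp: constant_on_def)
    then have "{z\<in>cball 0 r1. F z = 0} = {}" using ne rin sub by auto
    then show ?thesis by (simp only: finite.emptyI)
  next
    case False
    then show ?thesis by (intro holomorphic_compact_finite_zeros[OF F]) (use sub in auto)
  qed
  define Z where "Z = {\<zeta>\<in>ball 0 r. F \<zeta> = 0}"
  have Zsub: "Z \<subseteq> {z\<in>cball 0 r1. F z = 0}" unfolding Z_def using r1 by auto
  then have finZ: "finite Z" using fin by (rule finite_subset)
  define M where "M = (\<Sum>p\<in>Z. replicate_mset (nat (zorder F p)) p)"
  have pos: "zorder F p > 0" if "p \<in> Z" for p
  proof -
    have "p \<in> ball 0 r0" "F p = 0" using that r by (auto simp: Z_def)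
    moreover have "\<exists>w\<in>ball 0 r0. F w \<noteq> 0" using ne rin by blast
    ultimately show ?thesis using zorder_exist_zero[OF F open_ball connected_ball] by auto
  qed
  show ?thesis
  proof (intro exI conjI allI impI)
    show "set_mset M = {\<zeta>\<in>ball 0 r. F \<zeta> = 0}"
      unfolding M_def set_mset_sum_replicate[OF finZ] using pos by (auto simp: Z_def)
    fix \<phi> :: "complex \<Rightarrow> complex" assume \<phi>: "\<phi> holomorphic_on ball 0 r0"
    define pz where "pz = {w\<in>ball 0 r1. F w = 0 \<or> w \<in> {}}"
    have finpz: "finite pz" by (rule finite_subset[OF _ fin]) (auto simp: pz_def)
    have "contour_integral (circlepath 0 r) (\<lambda>x. deriv F x * \<phi> x / F x) = 2 * pi * \<i> *
          (\<Sum>p\<in>pz. winding_number (circlepath 0 r) p * \<phi> p * zorder F p)"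
      unfolding pz_def
    proof (rule argument_principle)
      show "F holomorphic_on ball 0 r1 - {}" "\<phi> holomorphic_on ball 0 r1"
        using holomorphic_on_subset[OF F sub(1)] holomorphic_on_subset[OF \<phi> sub(1)] by auto
      show "path_image (circlepath 0 r) \<subseteq> ball 0 r1 - {w \<in> ball 0 r1. F w = 0 \<or> w \<in> {}}"
        using r r1 nz by auto
      show "\<forall>z. z \<notin> ball 0 r1 \<longrightarrow> winding_number (circlepath 0 r) z = 0"
      proof (intro allI impI)
        fix z :: complex assume "z \<notin> ball 0 r1"
        then show "winding_number (circlepath 0 r) z = 0"
          by (intro winding_number_zero_outside[of _ "cball 0 r"]) (use r r1 in auto)
      qed
      show "finite {w \<in> ball 0 r1. F w = 0 \<or> w \<in> {}}" using finpz by (simp add: pz_def)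
    qed auto
    also have "(\<Sum>p\<in>pz. winding_number (circlepath 0 r) p * \<phi> p * zorder F p) = (\<Sum>p\<in>Z. of_nat (nat (zorder F p)) * \<phi> p)"
    proof (rule sum.mono_neutral_cong_right[OF finpz])
      show "Z \<subseteq> pz" using r1 by (auto simp: Z_def pz_def)
      show "\<forall>p\<in>pz - Z. winding_number (circlepath 0 r) p * \<phi> p * zorder F p = 0"
      proof
        fix p assume p: "p \<in> pz - Z"
        then have "norm p \<noteq> r" "\<not> norm p < r" using nz by (auto simp: pz_def Z_def)
        then have "winding_number (circlepath 0 r) p = 0"
          by (intro winding_number_zero_outside[of _ "cball 0 r"]) (use r in auto)
        then show "winding_number (circlepath 0 r) p * \<phi> p * zorder F p = 0" by simp
      qed
      show "winding_number (circlepath 0 r) p * \<phi> p * zorder F p = of_nat (nat (zorder F p)) * \<phi> p" if "p \<in> Z" for p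
      proof -
        have "winding_number (circlepath 0 r) p = 1" using that by (intro winding_number_circlepath) (auto simp: Z_def)
        moreover have "of_int (zorder F p) = (of_nat (nat (zorder F p)) :: complex)" using pos[OF that] by simp
        ultimately show ?thesis by (simp add: mult.commute)
      qed
    qed
    also have "\<dots> = (\<Sum>\<zeta>\<in>#M. \<phi> \<zeta>)" unfolding M_def sum_mset_sum_replicate[OF finZ] ..
    finally show "(\<Sum>\<zeta>\<in>#M. \<phi> \<zeta>) = cmean r (\<lambda>\<eta>. deriv F \<eta> * \<phi> \<eta> / F \<eta> * \<eta>)"
      unfolding contour_integral_circlepath_eq_cmean by simp
  qed
qed

text \<open>The derivative is a Cauchy mean over a circle of radius \<rho> about \<eta>; half the
  gap between \<open>r\<close> and \<open>r0\<close> keeps these circles in the domain.\<close>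

lemma hol2_deriv:
  assumes F: "hol2 F \<delta> r0" and r: "0 < r" "r < r0"
  shows "continuous_on (ball 0 \<delta> \<times> sphere 0 r) (\<lambda>(u, \<eta>). deriv (F u) \<eta>)"
    and "\<And>\<eta>. norm \<eta> = r \<Longrightarrow> ghol (\<lambda>u. deriv (F u) \<eta>) (ball 0 \<delta>)"
proof -
  define \<rho> where "\<rho> = (r0 - r) / 2"
  have \<rho>: "0 < \<rho>" "r + \<rho> < r0" using r by (auto simp: \<rho>_def field_simps)
  have inb: "\<eta> + \<xi> \<in> ball 0 r0" if "norm \<eta> = r" "norm \<xi> \<le> \<rho>" for \<eta> \<xi> :: complex
    using norm_triangle_ineq[of \<eta> \<xi>] that \<rho> by simp
  have eq: "deriv (F u) \<eta> = cmean \<rho> (\<lambda>\<xi>. F u (\<eta> + \<xi>) / \<xi>)" if "u \<in> ball 0 \<delta>" "norm \<eta> = r" for u \<eta>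
  proof -
    have "(F u \<circ> (\<lambda>\<xi>. \<eta> + \<xi>)) holomorphic_on ball 0 (r0 - r)"
    proof (rule holomorphic_on_compose)
      have "(+) \<eta> ` ball 0 (r0 - r) \<subseteq> ball 0 r0"
      proof clarify
        fix \<xi> :: complex assume "\<xi> \<in> ball 0 (r0 - r)"
        then show "\<eta> + \<xi> \<in> ball 0 r0" using norm_triangle_ineq[of \<eta> \<xi>] that by simp
      qed
      then show "F u holomorphic_on (+) \<eta> ` ball 0 (r0 - r)"
        using F that by (auto simp: hol2_def intro: holomorphic_on_subset)
    qed (auto intro!: holomorphic_intros)
    then have "(\<lambda>\<xi>. F u (\<eta> + \<xi>)) holomorphic_on ball 0 (r0 - r)" by (simp add: o_def)
    then have "cmean \<rho> (\<lambda>\<xi>. F u (\<eta> + \<xi>) / \<xi>) = deriv (\<lambda>\<xi>. F u (\<eta> + \<xi>)) 0"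
      by (rule cmean_deriv) (use \<rho> in auto)
    then show ?thesis by (simp add: deriv_shift_0[of _ \<eta>] o_def)
  qed
  have c1: "continuous_on ((ball 0 \<delta> \<times> sphere 0 r) \<times> sphere 0 \<rho>) (\<lambda>x. F (fst (fst x)) (snd (fst x) + snd x))"
  proof -
    have "continuous_on (ball 0 \<delta> \<times> ball 0 r0) (\<lambda>(u, \<zeta>). F u \<zeta>)" using F by (simp add: hol2_def)
    from continuous_on_compose2[OF this, of "(ball 0 \<delta> \<times> sphere 0 r) \<times> sphere 0 \<rho>" "\<lambda>x. (fst (fst x), snd (fst x) + snd x)"]
    show ?thesis using inb by (force intro!: continuous_intros)
  qed
  have "continuous_on (ball 0 \<delta> \<times> sphere 0 r) (\<lambda>x. cmean \<rho> (\<lambda>\<xi>. F (fst x) (snd x + \<xi>) / \<xi>))"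
  proof (rule continuous_on_cmean)
    show "continuous_on ((ball 0 \<delta> \<times> sphere 0 r) \<times> sphere 0 \<rho>) (\<lambda>(x, \<xi>). F (fst x) (snd x + \<xi>) / \<xi>)"
      unfolding case_prod_unfold using \<rho> by (intro continuous_intros c1) auto
  qed (use \<rho> in auto)
  then show "continuous_on (ball 0 \<delta> \<times> sphere 0 r) (\<lambda>(u, \<eta>). deriv (F u) \<eta>)"
    by (rule continuous_on_eq) (use eq in auto)
  show "ghol (\<lambda>u. deriv (F u) \<eta>) (ball 0 \<delta>)" if \<eta>: "norm \<eta> = r" for \<eta>
  proof -
    have "ghol (\<lambda>u. cmean \<rho> (\<lambda>\<xi>. F u (\<eta> + \<xi>) / \<xi>)) (ball 0 \<delta>)"
    proof (rule ghol_cmean)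
      have "continuous_on (ball 0 \<delta> \<times> sphere 0 \<rho>) (\<lambda>x. F (fst x) (\<eta> + snd x))"
        using continuous_on_compose2[OF c1, of "ball 0 \<delta> \<times> sphere 0 \<rho>" "\<lambda>x. ((fst x, \<eta>), snd x)"] \<eta>
        by (force intro!: continuous_intros)
      then show "continuous_on (ball 0 \<delta> \<times> sphere 0 \<rho>) (\<lambda>(u, \<xi>). F u (\<eta> + \<xi>) / \<xi>)"
        unfolding case_prod_unfold using \<rho> by (intro continuous_intros) auto
      show "ghol (\<lambda>u. F u (\<eta> + \<xi>) / \<xi>) (ball 0 \<delta>)" if "\<xi> \<in> sphere 0 \<rho>" for \<xi>
        using F inb[OF \<eta>, of \<xi>] that \<rho> by (intro ghol_divide ghol_const) (auto simp: hol2_def)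
    qed (use \<rho> in auto)
    then show ?thesis by (rule ghol_cong) (simp add: eq \<eta>)
  qed
qed

text \<open>The argument principle expresses power sums over the roots as integrals depending holomorphically on \<open>u\<close>.\<close>

lemma holomorphic_roots:
  fixes F :: "complex ^ 'n \<Rightarrow> complex \<Rightarrow> complex"
  assumes F: "hol2 F \<delta>0 r0" and nz: "\<zeta>0 \<in> ball 0 r0" "F 0 \<zeta>0 \<noteq> 0" and pos: "0 < \<delta>0" "0 < \<epsilon>"
  obtains \<delta> r d M where "0 < \<delta>" "\<delta> < \<delta>0" "\<delta> < \<epsilon>" "0 < r" "r < r0" "r < \<epsilon>"
    "\<And>u. u \<in> ball 0 \<delta> \<Longrightarrow> size (M u) = d \<and> set_mset (M u) = {\<zeta>\<in>ball 0 r. F u \<zeta> = 0}"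
    "\<And>u \<zeta>. u \<in> ball 0 \<delta> \<Longrightarrow> norm \<zeta> = r \<Longrightarrow> F u \<zeta> \<noteq> 0"
    "\<And>u v. F u = F v \<Longrightarrow> M u = M v"
    "\<And>\<zeta>. \<zeta> \<in># M 0 \<Longrightarrow> \<zeta> = 0"
    "\<And>\<phi>. hol2 \<phi> \<delta> r0 \<Longrightarrow> ghol (\<lambda>u. \<Prod>\<zeta>\<in>#M u. \<phi> u \<zeta>) (ball 0 \<delta>)"
proof -
  have r0: "0 < r0" using nz(1) norm_ge_zero[of \<zeta>0] unfolding mem_ball_0 by linarith
  have F0: "F 0 holomorphic_on ball 0 r0" using F pos by (auto simp: hol2_def)
  obtain q \<psi> where \<psi>: "\<psi> holomorphic_on ball 0 r0" "\<And>\<eta>. \<eta> \<in> ball 0 r0 \<Longrightarrow> F 0 \<eta> = \<eta> ^ q * \<psi> \<eta>" "\<psi> 0 \<noteq> 0"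
    using holomorphic_factor_at_0[OF F0 nz] by blast
  have "isCont \<psi> 0"
    using holomorphic_on_imp_continuous_on[OF \<psi>(1)] r0 by (simp add: continuous_on_eq_continuous_at)
  from continuous_at_avoid[OF this \<psi>(3)] obtain e where e: "e > 0" "\<And>y. dist 0 y < e \<Longrightarrow> \<psi> y \<noteq> 0"
    by (auto simp: dist_commute)
  \<comment> \<open>Below \<open>e\<close> the cofactor \<psi> has no zeros, so in the closed disc
    of radius \<open>r\<close> the function \<open>F 0\<close> can vanish at 0 only.\<close>
  define r where "r = min (min e r0) \<epsilon> / 2"
  have r: "0 < r" "r < e" "r < r0" "r < \<epsilon>" using e r0 pos by (auto simp: r_def min_def)
  have F0nz: "F 0 \<eta> \<noteq> 0" if "\<eta> \<noteq> 0" "norm \<eta> \<le> r" for \<eta>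
    using \<psi>(2)[of \<eta>] e(2)[of \<eta>] that r by auto
  have contF: "continuous_on (ball 0 \<delta>0 \<times> sphere 0 r) (\<lambda>(u, \<zeta>). F u \<zeta>)"
    by (rule continuous_on_subset[where s = "ball 0 \<delta>0 \<times> ball 0 r0"]) (use F r in \<open>auto simp: hol2_def\<close>)
  \<comment> \<open>\<open>F\<close> is nonzero on the circle over \<open>u = 0\<close>; compactness
    of the circle and the tube lemma extend this to all \<open>u\<close> near 0.\<close>
  define W where "W = {x \<in> sphere (0 :: complex) r \<times> ball (0 :: complex ^ 'n) \<delta>0. F (snd x) (fst x) \<in> - {0}}"
  have "openin (top_of_set (sphere 0 r \<times> ball 0 \<delta>0)) W"
  proof -
    have "continuous_on (sphere 0 r \<times> ball 0 \<delta>0) (\<lambda>x. F (snd x) (fst x))"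
      using continuous_on_compose2[OF contF, of "sphere 0 r \<times> ball 0 \<delta>0" "\<lambda>x. (snd x, fst x)"]
      by (force intro!: continuous_intros)
    from continuous_openin_preimage_gen[OF this, of "- {0}"]
    show ?thesis unfolding W_def vimage_def Int_def by (simp add: open_Compl)
  qed
  moreover have "sphere (0 :: complex) r \<noteq> {}" using r by simp
  moreover have "(\<lambda>x. (x, 0)) ` sphere 0 r \<subseteq> W" using F0nz pos r by (force simp: W_def)
  ultimately obtain V where V: "openin (top_of_set (ball 0 \<delta>0)) V" "0 \<in> V" "sphere 0 r \<times> V \<subseteq> W"
    using tube_lemma[OF compact_sphere] by metis
  have "open V" using V(1) by (simp add: openin_open_eq)
  then obtain e1 where e1: "e1 > 0" "ball 0 e1 \<subseteq> V" using V(2) openE by blast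
  define \<delta> where "\<delta> = min (min e1 \<delta>0) \<epsilon> / 2"
  have \<delta>: "0 < \<delta>" "\<delta> < e1" "\<delta> < \<delta>0" "\<delta> < \<epsilon>" using e1 pos by (auto simp: \<delta>_def min_def)
  have Fnz: "F u \<zeta> \<noteq> 0" if "u \<in> ball 0 \<delta>" "norm \<zeta> = r" for u \<zeta>
  proof -
    have "(\<zeta>, u) \<in> sphere 0 r \<times> V" using that e1(2) \<delta> by auto
    then have "(\<zeta>, u) \<in> W" using V(3) by blast
    then show ?thesis by (simp add: W_def)
  qed
  have F': "hol2 F \<delta> r0" using hol2_subset[OF F] \<delta> by simp
  \<comment> \<open>\<open>Q\<close> involves the parameter only through the function
    \<open>F u\<close>, so choosing \<open>M u\<close> from it gives equal root multisets for
    parameters with equal functions.\<close>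
  define Q where "Q = (\<lambda>f M. set_mset M = {\<zeta>\<in>ball 0 r. f \<zeta> = 0} \<and> (\<forall>\<phi>. \<phi> holomorphic_on ball 0 r0 \<longrightarrow>
    (\<Sum>\<zeta>\<in>#M. \<phi> \<zeta>) = cmean r (\<lambda>\<eta>. deriv f \<eta> * \<phi> \<eta> / f \<eta> * \<eta>)))"
  define M where "M = (\<lambda>u. SOME M. Q (F u) M)"
  have M0: "Q (F u) (M u)" if u: "u \<in> ball 0 \<delta>" for u
  proof -
    have "F u holomorphic_on ball 0 r0" using F' u by (auto simp: hol2_def)
    from zeros_power_sum[OF this r(1,3) Fnz[OF u]] have "\<exists>M. Q (F u) M" unfolding Q_def .
    then show ?thesis unfolding M_def by (rule someI_ex)
  qed
  then have M: "\<And>u. u \<in> ball 0 \<delta> \<Longrightarrow> set_mset (M u) = {\<zeta>\<in>ball 0 r. F u \<zeta> = 0}"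
    "\<And>u \<phi>. u \<in> ball 0 \<delta> \<Longrightarrow> \<phi> holomorphic_on ball 0 r0 \<Longrightarrow>
      (\<Sum>\<zeta>\<in>#M u. \<phi> \<zeta>) = cmean r (\<lambda>\<eta>. deriv (F u) \<eta> * \<phi> \<eta> / F u \<eta> * \<eta>)"
    by (simp_all add: Q_def)
  have sums: "ghol (\<lambda>u. \<Sum>\<zeta>\<in>#M u. \<phi> u \<zeta>) (ball 0 \<delta>)" if \<phi>: "hol2 \<phi> \<delta> r0" for \<phi>
  proof -
    have sub: "ball (0 :: complex ^ 'n) \<delta> \<times> sphere (0 :: complex) r \<subseteq> ball 0 \<delta> \<times> ball 0 r0" using r by auto
    have "continuous_on (ball 0 \<delta> \<times> sphere 0 r) (\<lambda>(u, \<zeta>). F u \<zeta>)" "continuous_on (ball 0 \<delta> \<times> sphere 0 r) (\<lambda>(u, \<zeta>). \<phi> u \<zeta>)"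
      using F' \<phi> continuous_on_subset[OF _ sub] by (auto simp: hol2_def)
    note c = this[unfolded case_prod_unfold] hol2_deriv(1)[OF F' r(1,3), unfolded case_prod_unfold]
    have "ghol (\<lambda>u. cmean r (\<lambda>\<eta>. deriv (F u) \<eta> * \<phi> u \<eta> / F u \<eta> * \<eta>)) (ball 0 \<delta>)"
    proof (rule ghol_cmean)
      show "continuous_on (ball 0 \<delta> \<times> sphere 0 r) (\<lambda>(u, \<eta>). deriv (F u) \<eta> * \<phi> u \<eta> / F u \<eta> * \<eta>)"
        unfolding case_prod_unfold by (intro continuous_intros c) (use Fnz in auto)
      show "ghol (\<lambda>u. deriv (F u) \<eta> * \<phi> u \<eta> / F u \<eta> * \<eta>) (ball 0 \<delta>)" if "\<eta> \<in> sphere 0 r" for \<eta>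
        using that F' \<phi> r Fnz
        by (intro ghol_mult ghol_divide ghol_const hol2_deriv(2)[OF F' r(1,3)]) (auto simp: hol2_def)
    qed (use r in auto)
    then show ?thesis
      by (rule ghol_cong) (rule M(2)[symmetric], use \<phi> in \<open>auto simp: hol2_def\<close>)
  qed
  \<comment> \<open>The number of roots is the weighted sum for the weight 1, hence continuous, and
    integer-valued on a connected ball.\<close>
  have "(\<lambda>u. of_nat (size (M u)) :: complex) constant_on ball 0 \<delta>"
  proof (rule continuous_discrete_range_constant)
    have "ghol (\<lambda>u. \<Sum>\<zeta>\<in>#M u. 1) (ball 0 \<delta>)" by (rule sums[OF hol2_const])
    then show "continuous_on (ball 0 \<delta>) (\<lambda>u. of_nat (size (M u)) :: complex)" by (simp add: ghol_def)
    show "\<exists>e>0. \<forall>y. y \<in> ball 0 \<delta> \<and> complex_of_nat (size (M y)) \<noteq> of_nat (size (M x)) \<longrightarrow>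
        e \<le> norm (complex_of_nat (size (M y)) - of_nat (size (M x)))" for x
    proof (intro exI[of _ 1] conjI allI impI)
      fix y assume "y \<in> ball 0 \<delta> \<and> complex_of_nat (size (M y)) \<noteq> of_nat (size (M x))"
      then have "int (size (M y)) - int (size (M x)) \<noteq> 0" by auto
      moreover have "1 \<le> norm (complex_of_int k)" if "k \<noteq> 0" for k
        using that unfolding norm_of_int by linarith
      ultimately have "1 \<le> norm (complex_of_int (int (size (M y)) - int (size (M x))))" by blast
      then show "1 \<le> norm (complex_of_nat (size (M y)) - of_nat (size (M x)))" by simp
    qed simp
  qed simp
  then obtain c where "\<And>u. u \<in> ball 0 \<delta> \<Longrightarrow> complex_of_nat (size (M u)) = c" by (auto simp: constant_on_def)
  then have size: "size (M u) = size (M 0)" if "u \<in> ball 0 \<delta>" for u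
    using that \<delta> by (metis centre_in_ball of_nat_eq_iff)
  show ?thesis
  proof (rule that[of \<delta> r M "size (M 0)"])
    show "\<zeta> = 0" if "\<zeta> \<in># M 0" for \<zeta>
    proof -
      have "\<zeta> \<in> {\<zeta>\<in>ball 0 r. F 0 \<zeta> = 0}" using M(1)[of 0] that \<delta>(1) by simp
      then show ?thesis using F0nz[of \<zeta>] by auto
    qed
    show "ghol (\<lambda>u. \<Prod>\<zeta>\<in>#M u. \<phi> u \<zeta>) (ball 0 \<delta>)" if "hol2 \<phi> \<delta> r0" for \<phi>
    proof -
      have "ghol (\<lambda>u. \<Prod>x\<in>#image_mset (\<phi> u) (M u). x) (ball 0 \<delta>)"
      proof (rule ghol_prod_mset_of_power_sums)
        show "ghol (\<lambda>u. \<Sum>x\<in>#image_mset (\<phi> u) (M u). x ^ m) (ball 0 \<delta>)" for m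
          using sums[OF hol2_power[OF that, of m]] by (simp add: image_mset.compositionality o_def)
        show "size (image_mset (\<phi> u) (M u)) = size (M 0)" if "u \<in> ball 0 \<delta>" for u
          using size[OF that] by simp
      qed simp
      then show ?thesis by simp
    qed
    show "size (M u) = size (M 0) \<and> set_mset (M u) = {\<zeta>\<in>ball 0 r. F u \<zeta> = 0}" if "u \<in> ball 0 \<delta>" for u
      using size[OF that] M(1)[OF that] by (rule conjI)
    show "M u = M v" if "F u = F v" for u v using that by (simp add: M_def)
  qed (fact \<delta> r Fnz)+
qed

section \<open>Projection of analytic sets\<close>

text \<open>Discrete Fourier inversion at the (d+1)-st roots of unity. Nodes and weights do not
  depend on the polynomial, so coefficients inherit holomorphic dependence on parameters from
  values.\<close>

lemma coeff_via_roots_of_unity: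
  obtains a s where "\<And>p. degree p \<le> d \<Longrightarrow> coeff p k = (\<Sum>j\<le>d. a j * poly p (s j :: complex))"
proof (cases "k \<le> d")
  case False
  show ?thesis
    by (rule that[of "\<lambda>_. 0" "\<lambda>_. 0"]) (use False in \<open>auto simp: coeff_eq_0\<close>)
next
  case True
  define N where "N = Suc d"
  have N0: "complex_of_nat N \<noteq> 0" by (simp add: N_def del: of_nat_Suc)
  define \<omega> where "\<omega> = (\<lambda>j. exp (2 * of_real pi * \<i> * of_nat j / of_nat N))"
  have inj: "inj_on \<omega> {..<N}"
    using bij_betw_roots_unity[of N] by (simp add: N_def \<omega>_def bij_betw_def)
  have pw: "\<omega> j ^ N = 1" for j
  proof -
    have "\<omega> j ^ N = exp (of_nat j * (2 * of_real pi * \<i>))"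
      unfolding \<omega>_def exp_of_nat_mult[symmetric] using N0 by (simp add: mult_ac)
    also have "\<dots> = exp (2 * of_real pi * \<i>) ^ j" by (rule exp_of_nat_mult)
    finally show ?thesis by simp
  qed
  have \<omega>: "\<omega> j = \<omega> 1 ^ j" for j
    unfolding \<omega>_def exp_of_nat_mult[symmetric] by (simp add: mult_ac)
  have nz: "\<omega> j \<noteq> 0" for j by (simp add: \<omega>_def)
  have ortho: "(\<Sum>j<N. (\<omega> l / \<omega> k) ^ j) = (if l = k then of_nat N else 0)" if "l < N" for l
  proof (cases "l = k")
    case False
    have ne: "\<omega> l / \<omega> k \<noteq> 1" using inj that True False nz[of k] by (auto simp: inj_on_def N_def divide_eq_1_iff)
    have "(\<omega> l / \<omega> k) ^ N = 1" using pw[of l] pw[of k] by (simp add: power_divide)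
    then show ?thesis using False ne by (simp add: geometric_sum)
  qed (use nz in auto)
  show ?thesis
  proof (rule that[of "\<lambda>j. 1 / (of_nat N * \<omega> k ^ j)" "\<lambda>j. \<omega> j"])
    fix p :: "complex poly" assume "degree p \<le> d"
    then have p: "poly p x = (\<Sum>l<N. coeff p l * x ^ l)" for x
      unfolding N_def lessThan_Suc_atMost poly_altdef
      by (intro sum.mono_neutral_left) (auto simp: coeff_eq_0)
    have "(\<Sum>j\<le>d. 1 / (of_nat N * \<omega> k ^ j) * poly p (\<omega> j))
        = (\<Sum>j<N. \<Sum>l<N. coeff p l / of_nat N * (\<omega> l / \<omega> k) ^ j)"
    proof (intro sum.cong)
      fix j
      have "\<omega> j ^ l = \<omega> l ^ j" for l using \<omega>[of j] \<omega>[of l] by (simp add: mult.commute flip: power_mult)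
      then show "1 / (of_nat N * \<omega> k ^ j) * poly p (\<omega> j) = (\<Sum>l<N. coeff p l / of_nat N * (\<omega> l / \<omega> k) ^ j)"
        unfolding p sum_distrib_left by (intro sum.cong) (simp_all add: power_divide)
    qed (auto simp: N_def)
    also have "\<dots> = (\<Sum>l<N. coeff p l / of_nat N * (\<Sum>j<N. (\<omega> l / \<omega> k) ^ j))"
      by (subst sum.swap) (simp add: sum_distrib_left)
    also have "\<dots> = (\<Sum>l<N. if l = k then coeff p l else 0)"
      by (rule sum.cong) (use N0 in \<open>auto simp: ortho\<close>)
    also have "\<dots> = coeff p k" using True by (simp add: N_def)
    finally show "coeff p k = (\<Sum>j\<le>d. 1 / (of_nat N * \<omega> k ^ j) * poly p (\<omega> j))" ..
  qed
qed

lemma degree_prod_linear_le: "degree (\<Prod>\<zeta>\<in>#M. [:a \<zeta>, g \<zeta> :: complex:]) \<le> size M"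
proof (induction M)
  case (add x M)
  have "degree ([:a x, g x:] * (\<Prod>\<zeta>\<in>#M. [:a \<zeta>, g \<zeta>:])) \<le> degree [:a x, g x:] + size M"
    using degree_mult_le[of "[:a x, g x:]" "\<Prod>\<zeta>\<in>#M. [:a \<zeta>, g \<zeta>:]"] add.IH by linarith
  also have "\<dots> \<le> size (add_mset x M)" by simp
  finally show ?case by simp
qed simp

text \<open>Factors with \<open>g \<zeta> = 0\<close> are constant, so the degree is at most the
  number \<open>n\<close> of the others. The coefficient of X^n thus isolates the roots where
  \<open>g\<close> vanishes by a formula that stays holomorphic in parameters.\<close>

lemma coeff_prod_linear:
  fixes M :: "'a multiset" and a g :: "'a \<Rightarrow> complex"
  defines "Q \<equiv> (\<Prod>\<zeta>\<in>#M. [:a \<zeta>, g \<zeta>:])"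
  defines "n \<equiv> size (filter_mset (\<lambda>\<zeta>. g \<zeta> \<noteq> 0) M)"
  shows "coeff Q n = (\<Prod>\<zeta>\<in>#filter_mset (\<lambda>\<zeta>. g \<zeta> \<noteq> 0) M. g \<zeta>) * (\<Prod>\<zeta>\<in>#filter_mset (\<lambda>\<zeta>. g \<zeta> = 0) M. a \<zeta>)"
    and "n < k \<Longrightarrow> coeff Q k = 0"
proof -
  have "degree Q \<le> n \<and> coeff Q n = (\<Prod>\<zeta>\<in>#filter_mset (\<lambda>\<zeta>. g \<zeta> \<noteq> 0) M. g \<zeta>) * (\<Prod>\<zeta>\<in>#filter_mset (\<lambda>\<zeta>. g \<zeta> = 0) M. a \<zeta>)"
    unfolding Q_def n_def
  proof (induction M)
    case (add x M)
    let ?Q = "\<Prod>\<zeta>\<in>#M. [:a \<zeta>, g \<zeta>:]" and ?n = "size (filter_mset (\<lambda>\<zeta>. g \<zeta> \<noteq> 0) M)"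
    have deg: "degree ([:a x, g x:] * ?Q) \<le> degree [:a x, g x:] + ?n"
      using degree_mult_le[of "[:a x, g x:]" ?Q] add.IH by linarith
    have "coeff ?Q (Suc ?n) = 0" using add.IH by (intro coeff_eq_0) simp
    then show ?case using add.IH deg by (cases "g x = 0") (auto simp: algebra_simps)
  qed auto
  then show "coeff Q n = (\<Prod>\<zeta>\<in>#filter_mset (\<lambda>\<zeta>. g \<zeta> \<noteq> 0) M. g \<zeta>) * (\<Prod>\<zeta>\<in>#filter_mset (\<lambda>\<zeta>. g \<zeta> = 0) M. a \<zeta>)"
    "n < k \<Longrightarrow> coeff Q k = 0" by (auto intro: coeff_eq_0)
qed

text \<open>At a fixed node the product polynomial takes as value a product over the roots,
  holomorphic by \<open>prod\<close>; interpolation passes this on to the coefficients.\<close>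

lemma ghol_coeff_prod:
  fixes M :: "complex ^ 'n \<Rightarrow> complex multiset"
  assumes prod: "\<And>\<phi>. hol2 \<phi> \<delta> r0 \<Longrightarrow> ghol (\<lambda>u. \<Prod>\<zeta>\<in>#M u. \<phi> u \<zeta>) (ball 0 \<delta>)"
    and size: "\<And>u. u \<in> ball 0 \<delta> \<Longrightarrow> size (M u) = d"
    and a: "hol2 a \<delta> r0" and g: "hol2 g \<delta> r0"
  shows "ghol (\<lambda>u. coeff (\<Prod>\<zeta>\<in>#M u. [:a u \<zeta>, g u \<zeta>:]) k) (ball 0 \<delta>)"
proof -
  obtain c s where cs: "\<And>p. degree p \<le> d \<Longrightarrow> coeff p k = (\<Sum>j\<le>d. c j * poly p (s j :: complex))"
    by (rule coeff_via_roots_of_unity[of d k]) (rule that)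
  have "ghol (\<lambda>u. \<Sum>j\<le>d. c j * (\<Prod>\<zeta>\<in>#M u. a u \<zeta> + s j * g u \<zeta>)) (ball 0 \<delta>)"
    by (intro ghol_sum ghol_mult ghol_const prod hol2_add hol2_mult hol2_const a g) auto
  then show ?thesis
  proof (rule ghol_cong)
    fix u :: "complex ^ 'n" assume "u \<in> ball 0 \<delta>"
    then have "degree (\<Prod>\<zeta>\<in>#M u. [:a u \<zeta>, g u \<zeta>:]) \<le> d" using degree_prod_linear_le size by metis
    moreover have "poly (\<Prod>\<zeta>\<in>#M u. [:a u \<zeta>, g u \<zeta>:]) x = (\<Prod>\<zeta>\<in>#M u. a u \<zeta> + x * g u \<zeta>)" for x
      by (simp add: poly_prod_mset image_mset.compositionality o_def)
    ultimately show "(\<Sum>j\<le>d. c j * (\<Prod>\<zeta>\<in>#M u. a u \<zeta> + s j * g u \<zeta>)) = coeff (\<Prod>\<zeta>\<in>#M u. [:a u \<zeta>, g u \<zeta>:]) k"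
      using cs by simp
  qed
qed

lemma hol2_line:
  fixes L :: "complex ^ 'n \<Rightarrow> complex ^ 'm"
  assumes g: "ghol g S" and L: "Vector_Spaces.linear (*s) (*s) L"
    and S: "\<And>z \<zeta>. z \<in> ball 0 \<delta> \<Longrightarrow> \<zeta> \<in> ball 0 r \<Longrightarrow> L z + \<zeta> *s w \<in> S"
  shows "hol2 (\<lambda>z \<zeta>. g (L z + \<zeta> *s w)) \<delta> r"
  unfolding hol2_def
proof (intro conjI ballI)
  interpret l: Vector_Spaces.linear "(*s)" "(*s)" L by fact
  have cL: "continuous_on X (\<lambda>x. L (f x))" if "continuous_on X f" for X and f :: "'z::topological_space \<Rightarrow> _"
    using that bounded_linear.continuous_on[OF clinear_scaleR[OF L]] by blast
  show "continuous_on (ball 0 \<delta> \<times> ball 0 r) (\<lambda>(z, \<zeta>). g (L z + \<zeta> *s w))"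
    unfolding case_prod_unfold
    by (rule continuous_on_compose2[OF ghol_continuous[OF g]])
       (use S in \<open>auto intro!: continuous_intros cL\<close>)
  fix \<zeta> :: complex assume \<zeta>: "\<zeta> \<in> ball 0 r"
  show "ghol (\<lambda>z. g (L z + \<zeta> *s w)) (ball 0 \<delta>)"
  proof (rule ghol_comp_affine[OF g])
    show "\<exists>v'. \<forall>\<xi>. L (p + \<xi> *s v) + \<zeta> *s w = L p + \<zeta> *s w + \<xi> *s v'" for p v
      by (rule exI[of _ "L v"]) (simp add: l.add l.scale)
  qed (use S \<zeta> in \<open>auto intro!: continuous_intros cL\<close>)
next
  fix z :: "complex ^ 'n" assume z: "z \<in> ball 0 \<delta>"
  show "(\<lambda>\<zeta>. g (L z + \<zeta> *s w)) holomorphic_on ball 0 r"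
    by (rule holomorphic_on_subset[OF ghol_line[OF g]]) (use S z in blast)
qed

lemma hol2_fst: "ghol \<tau> (ball 0 \<delta>) \<Longrightarrow> hol2 (\<lambda>z \<zeta>. \<tau> z) \<delta> r"
  unfolding hol2_def case_prod_unfold
  by (auto intro!: continuous_on_compose2[of _ \<tau> _ fst] continuous_intros dest: ghol_continuous)

lemma hol2_snd: "hol2 (\<lambda>z \<zeta>. \<zeta>) \<delta> r"
  unfolding hol2_def case_prod_unfold by (auto intro!: continuous_intros holomorphic_intros)

text \<open>The complex linear span of \<open>F\<close>, generated so that one coefficient can be
  adjusted at a time. \<open>F\<close> may be infinite, as are the systems of norms constructed
  below.\<close>

inductive_set lspan :: "('a \<Rightarrow> complex) set \<Rightarrow> ('a \<Rightarrow> complex) set" for F where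
  zero: "(\<lambda>_. 0) \<in> lspan F"
| step: "g \<in> lspan F \<Longrightarrow> f \<in> F \<Longrightarrow> (\<lambda>z. g z + \<mu> * f z) \<in> lspan F"

lemma lspan_zero: "g \<in> lspan F \<Longrightarrow> (\<And>f. f \<in> F \<Longrightarrow> f z = 0) \<Longrightarrow> g z = 0"
  by (induction rule: lspan.induct) auto

lemma lspan_ghol: "g \<in> lspan F \<Longrightarrow> open S \<Longrightarrow> (\<And>f. f \<in> F \<Longrightarrow> ghol f S) \<Longrightarrow> ghol g S"
  by (induction rule: lspan.induct) (auto intro!: ghol_add ghol_mult ghol_const)

text \<open>Each point of \<open>Z\<close> with \<open>f p \<noteq> 0\<close> excludes a single
  \<mu>, namely \<open>- g p / f p\<close>, and infinitely many values remain.\<close>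

lemma lspan_improve:
  assumes "g \<in> lspan F" "f \<in> F" "finite Z"
  shows "\<exists>g'\<in>lspan F. \<forall>p\<in>Z. g p \<noteq> 0 \<or> f p \<noteq> 0 \<longrightarrow> g' p \<noteq> 0"
proof -
  have "finite (insert 0 ((\<lambda>p. - g p / f p) ` Z))" using assms(3) by simp
  then obtain \<mu> where \<mu>: "\<mu> \<notin> insert 0 ((\<lambda>p. - g p / f p) ` Z)"
    using ex_new_if_finite[OF infinite_UNIV_char_0] by blast
  have "g p + \<mu> * f p \<noteq> 0" if "p \<in> Z" "g p \<noteq> 0 \<or> f p \<noteq> 0" for p
  proof
    assume eq: "g p + \<mu> * f p = 0"
    show False
    proof (cases "f p = 0")
      case False
      then have "\<mu> = (\<mu> * f p) / f p" by simp
      also have "\<mu> * f p = - g p" using eq by (simp add: add_eq_0_iff)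
      finally have "\<mu> = - g p / f p" .
      then have "\<mu> \<in> (\<lambda>p. - g p / f p) ` Z" using that(1) by (rule image_eqI)
      then show False using \<mu> by simp
    qed (use that eq in simp)
  qed
  then show ?thesis by (intro bexI[OF _ lspan.step[OF assms(1,2)]]) auto
qed

lemma lspan_nonvanishing:
  assumes "finite Z" "\<And>p. p \<in> Z \<Longrightarrow> \<exists>f\<in>F. f p \<noteq> 0"
  shows "\<exists>g\<in>lspan F. \<forall>p\<in>Z. g p \<noteq> 0"
  using assms
proof (induction Z rule: finite_induct)
  case empty
  then show ?case using lspan.zero by blast
next
  case (insert p Z)
  have "\<exists>g\<in>lspan F. \<forall>p\<in>Z. g p \<noteq> 0" by (rule insert.IH) (simp add: insert.prems)
  then obtain g where g: "g \<in> lspan F" "\<forall>p\<in>Z. g p \<noteq> 0" ..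
  obtain f where f: "f \<in> F" "f p \<noteq> 0" using insert.prems[of p] by auto
  obtain g' where "g' \<in> lspan F" "\<forall>p\<in>insert p Z. g p \<noteq> 0 \<or> f p \<noteq> 0 \<longrightarrow> g' p \<noteq> 0"
    using lspan_improve[OF g(1) f(1), of "insert p Z"] insert.hyps by auto
  then show ?case using f(2) g(2) by (intro bexI[of _ g']) auto
qed

lemma ghol_line_nonzero:
  fixes w :: "complex ^ 'n"
  assumes f: "ghol f (ball 0 R)" and \<zeta>: "\<zeta> *s w \<in> ball 0 R" "f (\<zeta> *s w) \<noteq> 0" and "0 < e"
  shows "\<exists>\<eta>. norm \<eta> < e \<and> \<eta> *s w \<in> ball 0 R \<and> f (\<eta> *s w) \<noteq> 0"
proof (cases "w = 0")
  case True
  then show ?thesis using assms by (intro exI[of _ 0]) auto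
next
  case False
  let ?T = "range (\<lambda>c. c *s w)"
  have T: "vec.subspace ?T"
    unfolding vec.span_singleton[symmetric] by (rule vec.subspace_span)
  have "0 \<in> ball (0 :: complex ^ 'n) R" using \<zeta>(1) norm_ge_zero[of "\<zeta> *s w"] by (simp add: order.strict_trans1[OF norm_ge_zero])
  moreover have "0 \<in> ?T" using T by (rule vec.subspace_0)
  moreover have "0 < e * norm w" using \<open>0 < e\<close> False by simp
  ultimately obtain z where "z \<in> ?T" "z \<in> ball 0 R" "dist 0 z < e * norm w" "f z \<noteq> 0"
    using ghol_nonzero_near[OF f T, of 0 "\<zeta> *s w"] \<zeta> by blast
  then show ?thesis using False by (auto simp: norm_smult_vec)
qed

text \<open>The functions in \<open>G\<close> are norms, i.e. products over the roots \<open>\<zeta>\<close> of \<open>f0 (u + \<zeta> *s w)\<close>, of linear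
  combinations of functions in \<open>F\<close>.\<close>

lemma analytic_projection:
  fixes w :: "complex ^ 'n"
  assumes f0: "ghol f0 (ball 0 R)" and F: "\<And>f. f \<in> F \<Longrightarrow> ghol f (ball 0 R)"
    and \<zeta>: "\<zeta> *s w \<in> ball 0 R" "f0 (\<zeta> *s w) \<noteq> 0" and "0 < \<epsilon>"
  obtains \<delta> r G where "0 < \<delta>" "\<delta> < \<epsilon>" "0 < r" "r < \<epsilon>"
    "\<And>u \<zeta>. u \<in> ball 0 \<delta> \<Longrightarrow> \<zeta> \<in> ball 0 r \<Longrightarrow> u + \<zeta> *s w \<in> ball 0 R"
    "\<And>N. N \<in> G \<Longrightarrow> ghol N (ball 0 \<delta>)"
    "\<And>u. u \<in> ball 0 \<delta> \<Longrightarrow> (\<forall>N\<in>G. N u = 0) \<longleftrightarrow>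
       (\<exists>\<zeta>\<in>ball 0 r. f0 (u + \<zeta> *s w) = 0 \<and> (\<forall>f\<in>F. f (u + \<zeta> *s w) = 0))"
proof -
  have R: "0 < R" using \<zeta>(1) norm_ge_zero[of "\<zeta> *s w"] unfolding mem_ball_0 by linarith
  \<comment> \<open>One half of \<open>R\<close> is reserved for \<open>u\<close> and one half for
    \<open>\<zeta> *s w\<close>; the summand 1 covers \<open>w = 0\<close>.\<close>
  define r0 where "r0 = R / (2 * (norm w + 1))"
  have nw: "0 < norm w + 1" using norm_ge_zero[of w] by linarith
  have "R / (2 * n) * n = R / 2" if "0 < n" for n :: real using that by simp
  from this[OF nw] have r0: "0 < r0" "r0 * (norm w + 1) = R / 2" using R nw by (simp_all add: r0_def)
  have inb: "u + \<zeta> *s w \<in> ball 0 R" if "u \<in> ball 0 (R/2)" "\<zeta> \<in> ball 0 r0" for u \<zeta>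
  proof -
    have "norm (\<zeta> *s w) \<le> r0 * (norm w + 1)"
      unfolding norm_smult_vec by (rule mult_mono) (use that r0 in auto)
    then show ?thesis using norm_triangle_ineq[of u "\<zeta> *s w"] that r0 by simp
  qed
  have lin: "Vector_Spaces.linear (*s) (*s) (\<lambda>z :: complex ^ 'n. z)" by unfold_locales auto
  have hol: "hol2 (\<lambda>z \<zeta>. f (z + \<zeta> *s w)) (R/2) r0" if "ghol f (ball 0 R)" for f
    by (rule hol2_line[OF that lin]) (rule inb)
  obtain \<eta> where \<eta>: "norm \<eta> < r0" "f0 (\<eta> *s w) \<noteq> 0" using ghol_line_nonzero[OF f0 \<zeta> r0(1)] by blast
  have pre: "\<eta> \<in> ball 0 r0" "f0 (0 + \<eta> *s w) \<noteq> 0" "0 < R/2" using \<eta> R by auto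
  obtain \<delta> r d M where *: "0 < \<delta>" "\<delta> < R/2" "\<delta> < \<epsilon>" "0 < r" "r < r0" "r < \<epsilon>"
    and M: "\<And>u. u \<in> ball 0 \<delta> \<Longrightarrow> size (M u) = d \<and> set_mset (M u) = {\<zeta>\<in>ball 0 r. f0 (u + \<zeta> *s w) = 0}"
    and "\<And>u \<zeta>. u \<in> ball 0 \<delta> \<Longrightarrow> norm \<zeta> = r \<Longrightarrow> f0 (u + \<zeta> *s w) \<noteq> 0"
    and "\<And>u v. (\<lambda>\<zeta>. f0 (u + \<zeta> *s w)) = (\<lambda>\<zeta>. f0 (v + \<zeta> *s w)) \<Longrightarrow> M u = M v"
    and "\<And>\<zeta>. \<zeta> \<in># M 0 \<Longrightarrow> \<zeta> = 0"
    and prod: "\<And>\<phi>. hol2 \<phi> \<delta> r0 \<Longrightarrow> ghol (\<lambda>u. \<Prod>\<zeta>\<in>#M u. \<phi> u \<zeta>) (ball 0 \<delta>)"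
    by (rule holomorphic_roots[OF hol[OF f0] pre \<open>0 < \<epsilon>\<close>]) (rule that)
  define G where "G = {\<lambda>u. \<Prod>\<zeta>\<in>#M u. g (u + \<zeta> *s w) |g. g \<in> lspan F}"
  show ?thesis
  proof (rule that[of \<delta> r G])
    show "u + \<zeta> *s w \<in> ball 0 R" if "u \<in> ball 0 \<delta>" "\<zeta> \<in> ball 0 r" for u \<zeta>
      by (rule inb) (use that * in auto)
    show "ghol N (ball 0 \<delta>)" if N: "N \<in> G" for N
    proof -
      obtain g where g: "g \<in> lspan F" "N = (\<lambda>u. \<Prod>\<zeta>\<in>#M u. g (u + \<zeta> *s w))" using N by (auto simp: G_def)
      have "ghol g (ball 0 R)" by (rule lspan_ghol[OF g(1)]) (auto intro: F)
      then have "hol2 (\<lambda>z \<zeta>. g (z + \<zeta> *s w)) \<delta> r0" using hol2_subset[OF hol] * by simp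
      then show ?thesis unfolding g(2) by (rule prod)
    qed
    fix u :: "complex ^ 'n" assume u: "u \<in> ball 0 \<delta>"
    show "(\<forall>N\<in>G. N u = 0) \<longleftrightarrow> (\<exists>\<zeta>\<in>ball 0 r. f0 (u + \<zeta> *s w) = 0 \<and> (\<forall>f\<in>F. f (u + \<zeta> *s w) = 0))"
    proof
      assume 0: "\<forall>N\<in>G. N u = 0"
      show "\<exists>\<zeta>\<in>ball 0 r. f0 (u + \<zeta> *s w) = 0 \<and> (\<forall>f\<in>F. f (u + \<zeta> *s w) = 0)"
      proof (rule ccontr)
        assume contra: "\<not> ?thesis"
        \<comment> \<open>If no root is a common zero, some \<open>f\<close> is nonzero at each of
          the finitely many roots. One combination is then nonzero at all of them, and its norm is a
          member of \<open>G\<close> that is nonzero at \<open>u\<close>.\<close>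
        have "\<exists>g\<in>lspan F. \<forall>p\<in>(\<lambda>\<zeta>. u + \<zeta> *s w) ` set_mset (M u). g p \<noteq> 0"
        proof (rule lspan_nonvanishing)
          fix p assume "p \<in> (\<lambda>\<zeta>. u + \<zeta> *s w) ` set_mset (M u)"
          then obtain \<zeta> where "p = u + \<zeta> *s w" "\<zeta> \<in> ball 0 r" "f0 (u + \<zeta> *s w) = 0" using M[OF u] by auto
          then show "\<exists>f\<in>F. f p \<noteq> 0" using contra by blast
        qed simp
        then obtain g where g: "g \<in> lspan F" "\<And>\<zeta>. \<zeta> \<in># M u \<Longrightarrow> g (u + \<zeta> *s w) \<noteq> 0" by auto
        then have "(\<Prod>\<zeta>\<in>#M u. g (u + \<zeta> *s w)) \<noteq> 0" by (auto simp: prod_mset_zero_iff)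
        then show False using 0 g(1) by (auto simp: G_def)
      qed
    next
      assume "\<exists>\<zeta>\<in>ball 0 r. f0 (u + \<zeta> *s w) = 0 \<and> (\<forall>f\<in>F. f (u + \<zeta> *s w) = 0)"
      then obtain \<zeta> where z: "\<zeta> \<in># M u" "\<And>f. f \<in> F \<Longrightarrow> f (u + \<zeta> *s w) = 0" using M[OF u] by auto
      show "\<forall>N\<in>G. N u = 0"
      proof
        fix N assume "N \<in> G"
        then obtain g where g: "g \<in> lspan F" "N u = (\<Prod>\<zeta>\<in>#M u. g (u + \<zeta> *s w))" by (auto simp: G_def)
        have "g (u + \<zeta> *s w) = 0" by (rule lspan_zero[OF g(1) z(2)])
        then show "N u = 0" using z(1) g(2) by (auto simp: prod_mset_zero_iff image_iff)
      qed
    qed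
  qed (use * in auto)
qed

text \<open>Failure of the cone condition yields points \<open>a\<close> near 0 whose part outside
  the line of \<open>w\<close> is negligible. With \<open>t = \<tau> a\<close> as scale,
  \<open>a / t\<close> tends to \<open>w\<close> because \<open>\<tau> w = 1\<close>.\<close>

lemma cone_condition_or_sequence:
  fixes w :: "complex ^ 'n"
  assumes \<tau>: "Vector_Spaces.linear (*s) (*) \<tau>" "\<tau> w = 1"
    and neg: "\<not> (\<exists>K>0. \<exists>\<delta>>0. \<forall>a\<in>S. norm a < \<delta> \<longrightarrow> norm a \<le> K * norm (a - \<tau> a *s w))"
  obtains t b where "\<And>i. t i \<noteq> 0" "\<And>i. t i *s b i \<in> S" "t \<longlonglongrightarrow> 0" "b \<longlonglongrightarrow> w"
proof -
  interpret l: Vector_Spaces.linear "(*s)" "(*)" \<tau> by fact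
  have bl: "bounded_linear \<tau>" by (rule clinear_functional_bounded[OF \<tau>(1)])
  have w0: "w \<noteq> 0" using \<tau>(2) l.zero by auto
  \<comment> \<open>The factor is at least 2, which forces
    \<open>norm a \<le> 2 * norm (\<tau> a) * norm w\<close> and so
    \<open>\<tau> a \<noteq> 0\<close>; its growth yields convergence to \<open>w\<close>.\<close>
  have "\<exists>a\<in>S. norm a < 1 / Suc i \<and> Suc (Suc i) * norm (a - \<tau> a *s w) < norm a" for i
  proof -
    have "\<not> (\<forall>a\<in>S. norm a < 1 / Suc i \<longrightarrow> norm a \<le> Suc (Suc i) * norm (a - \<tau> a *s w))"
    proof
      assume "\<forall>a\<in>S. norm a < 1 / Suc i \<longrightarrow> norm a \<le> Suc (Suc i) * norm (a - \<tau> a *s w)"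
      then have "\<exists>K>0. \<exists>\<delta>>0. \<forall>a\<in>S. norm a < \<delta> \<longrightarrow> norm a \<le> K * norm (a - \<tau> a *s w)"
        by (intro exI[of _ "real (Suc (Suc i))"] exI[of _ "1 / real (Suc i)"] conjI) auto
      then show False using neg by simp
    qed
    then show ?thesis by (auto simp: not_le)
  qed
  then obtain a where a: "\<And>i. a i \<in> S" "\<And>i. norm (a i) < 1 / Suc i"
    "\<And>i. Suc (Suc i) * norm (a i - \<tau> (a i) *s w) < norm (a i)" by metis
  define t where "t = (\<lambda>i. \<tau> (a i))"
  have half: "norm (a i) \<le> 2 * norm (t i) * norm w" for i
  proof -
    have "2 * norm (a i - \<tau> (a i) *s w) \<le> Suc (Suc i) * norm (a i - \<tau> (a i) *s w)"
      by (intro mult_right_mono) auto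
    moreover have "norm (a i) \<le> norm (a i - \<tau> (a i) *s w) + norm (t i *s w)"
      unfolding t_def using norm_triangle_ineq[of "a i - \<tau> (a i) *s w" "\<tau> (a i) *s w"] by simp
    ultimately show ?thesis using a(3)[of i] by (simp add: norm_smult_vec)
  qed
  have t0: "t i \<noteq> 0" for i
  proof
    assume "t i = 0"
    then have "norm (a i) \<le> 0" using half[of i] by simp
    moreover have "0 < norm (a i)" by (rule le_less_trans[OF _ a(3)]) simp
    ultimately show False by simp
  qed
  have a0: "a \<longlonglongrightarrow> 0"
  proof (rule metric_LIMSEQ_I)
    fix e :: real assume "e > 0"
    then obtain n where n: "inverse (real (Suc n)) < e" using reals_Archimedean by blast
    have "dist (a i) 0 < e" if "i \<ge> n" for i
    proof -
      have "norm (a i) < inverse (real (Suc i))" using a(2)[of i] by (simp add: inverse_eq_divide)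
      also have "\<dots> \<le> inverse (real (Suc n))" using that by (intro le_imp_inverse_le) auto
      finally show ?thesis using n by simp
    qed
    then show "\<exists>n. \<forall>i\<ge>n. dist (a i) 0 < e" by blast
  qed
  show ?thesis
  proof (rule that[of t "\<lambda>i. inverse (t i) *s a i"])
    show "t i *s (inverse (t i) *s a i) \<in> S" for i using t0[of i] a(1)[of i] by simp
    show "t \<longlonglongrightarrow> 0" unfolding t_def using bounded_linear.tendsto[OF bl a0] l.zero by simp
    show "(\<lambda>i. inverse (t i) *s a i) \<longlonglongrightarrow> w"
    proof (rule LIM_zero_cancel, rule tendsto_norm_zero_cancel)
      show "(\<lambda>i. norm (inverse (t i) *s a i - w)) \<longlonglongrightarrow> 0"
      proof (rule tendsto_sandwich[where f = "\<lambda>_. 0" and h = "\<lambda>i. 2 * norm w * inverse (real (Suc i))"])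
        show "\<forall>\<^sub>F i in sequentially. norm (inverse (t i) *s a i - w) \<le> 2 * norm w * inverse (real (Suc i))"
        proof (intro always_eventually allI)
          fix i
          have "inverse (t i) *s a i - w = inverse (t i) *s (a i - t i *s w)"
            using t0[of i] by (simp add: vec.scale_right_diff_distrib)
          then have "norm (inverse (t i) *s a i - w) = inverse (norm (t i)) * norm (a i - t i *s w)"
            by (simp only: norm_smult_vec norm_inverse)
          then have "norm (t i) * norm (inverse (t i) *s a i - w) = norm (a i - t i *s w)"
            using t0[of i] by simp
          moreover have "Suc i * norm (a i - t i *s w) \<le> Suc (Suc i) * norm (a i - t i *s w)"
            by (intro mult_right_mono) auto
          ultimately have "Suc i * (norm (t i) * norm (inverse (t i) *s a i - w)) \<le> 2 * norm (t i) * norm w"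
            using a(3)[of i] half[of i] unfolding t_def[symmetric] by (simp add: t_def)
          then have "norm (t i) * (Suc i * norm (inverse (t i) *s a i - w)) \<le> norm (t i) * (2 * norm w)"
            by (simp add: mult_ac)
          then have "Suc i * norm (inverse (t i) *s a i - w) \<le> 2 * norm w"
            using t0[of i] by simp
          then show "norm (inverse (t i) *s a i - w) \<le> 2 * norm w * inverse (real (Suc i))"
            by (simp add: field_simps)
        qed
        show "(\<lambda>i. 2 * norm w * inverse (real (Suc i))) \<longlonglongrightarrow> 0"
          by (rule tendsto_mult_right_zero[OF LIMSEQ_inverse_real_of_nat])
      qed auto
    qed
  qed (use t0 in auto)
qed

text \<open>Cauchy integral for \<open>f (t *s z) / t ^ q\<close> that also makes sense at \<open>t = 0\<close>.\<close>

definition scaled :: "(complex ^ 'n \<Rightarrow> complex) \<Rightarrow> nat \<Rightarrow> real \<Rightarrow> complex \<Rightarrow> complex ^ 'n \<Rightarrow> complex" where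
  "scaled f q \<rho> t z = cmean \<rho> (\<lambda>\<eta>. f (\<eta> *s z) * \<eta> / (\<eta> ^ q * (\<eta> - t)))"

text \<open>The integrand is evaluated only on the circle of radius \<rho>, away from 0 and
  \<open>t\<close>, so continuity persists at \<open>t = 0\<close>, where the value is the
  degree-\<open>q\<close> coefficient of \<open>f\<close> along \<open>z\<close>. The bound on
  \<open>\<rho> * B\<close> keeps \<open>\<eta> *s z\<close> in the domain.\<close>

lemma scaled_props:
  fixes f :: "complex ^ 'n \<Rightarrow> complex"
  assumes f: "ghol f (ball 0 R)" and B: "0 < B" and \<rho>: "0 < \<rho>" "\<rho> * B \<le> R"
  shows "continuous_on (ball 0 \<rho> \<times> ball 0 B) (\<lambda>(t, z). scaled f q \<rho> t z)"
    and "norm t < \<rho> \<Longrightarrow> ghol (scaled f q \<rho> t) (ball 0 B)"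
    and "norm t < \<rho> \<Longrightarrow> \<rho> < R' \<Longrightarrow> \<psi> holomorphic_on ball 0 R' \<Longrightarrow>
      (\<And>\<eta>. \<eta> \<in> ball 0 R' \<Longrightarrow> f (\<eta> *s z) = \<eta> ^ q * \<psi> \<eta>) \<Longrightarrow> scaled f q \<rho> t z = \<psi> t"
proof -
  have inb: "\<eta> *s z \<in> ball 0 R" if "norm \<eta> = \<rho>" "z \<in> ball 0 B" for \<eta> and z :: "complex ^ 'n"
  proof -
    have "norm \<eta> * norm z < \<rho> * B" using that \<rho> by simp
    then show ?thesis using \<rho> by (simp add: norm_smult_vec)
  qed
  have ne: "\<eta> - t \<noteq> 0" "\<eta> \<noteq> 0" if "norm \<eta> = \<rho>" "norm t < \<rho>" for \<eta> t using that \<rho> by auto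
  have c: "continuous_on ((ball 0 \<rho> \<times> ball 0 B) \<times> sphere 0 \<rho>)
      (\<lambda>x :: (complex \<times> (complex ^ 'n)) \<times> complex. f (snd x *s snd (fst x)) * snd x / (snd x ^ q * (snd x - fst (fst x))))"
  proof (intro continuous_intros)
    show "continuous_on ((ball 0 \<rho> \<times> ball 0 B) \<times> sphere 0 \<rho>)
      (\<lambda>x :: (complex \<times> (complex ^ 'n)) \<times> complex. f (snd x *s snd (fst x)))"
      by (rule continuous_on_compose2[OF ghol_continuous[OF f]])
         (use inb in \<open>auto intro!: continuous_intros\<close>)
  qed (use ne in force)
  show "continuous_on (ball 0 \<rho> \<times> ball 0 B) (\<lambda>(t, z). scaled f q \<rho> t z)"
    unfolding scaled_def case_prod_unfold
    by (rule continuous_on_cmean) (use c \<rho> in \<open>simp_all add: case_prod_unfold\<close>)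
  show "ghol (scaled f q \<rho> t) (ball 0 B)" if t: "norm t < \<rho>"
    unfolding scaled_def
  proof (rule ghol_cmean)
    show "continuous_on (ball 0 B \<times> sphere 0 \<rho>) (\<lambda>(z, \<eta>). f (\<eta> *s z) * \<eta> / (\<eta> ^ q * (\<eta> - t)))"
      using continuous_on_compose2[OF c, of "ball 0 B \<times> sphere 0 \<rho>" "\<lambda>x. ((t, fst x), snd x)"] t
      by (force simp: case_prod_unfold intro!: continuous_intros)
    show "ghol (\<lambda>z. f (\<eta> *s z) * \<eta> / (\<eta> ^ q * (\<eta> - t))) (ball 0 B)" if "\<eta> \<in> sphere 0 \<rho>" for \<eta>
    proof (intro ghol_divide ghol_mult ghol_const)
      show "ghol (\<lambda>z. f (\<eta> *s z)) (ball 0 B)"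
      proof (rule ghol_comp_affine[OF f])
        show "\<exists>v'. \<forall>\<zeta>. \<eta> *s (p + \<zeta> *s v) = \<eta> *s p + \<zeta> *s v'" for p v :: "complex ^ 'n"
          by (rule exI[of _ "\<eta> *s v"]) (simp add: vec.scale_right_distrib mult.commute)
      qed (use that inb in \<open>auto intro!: continuous_intros\<close>)
    qed (use ne[of \<eta> t] that t in auto)
  qed (use \<rho> in auto)
  show "scaled f q \<rho> t z = \<psi> t" if "norm t < \<rho>" "\<rho> < R'" "\<psi> holomorphic_on ball 0 R'"
    "\<And>\<eta>. \<eta> \<in> ball 0 R' \<Longrightarrow> f (\<eta> *s z) = \<eta> ^ q * \<psi> \<eta>"
    unfolding scaled_def by (rule cmean_factor) (use that \<rho> in auto)
qed

section \<open>Separating the tangent cone from directions outside it\<close>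

text \<open>The zeros of \<kappa> are isolated and the quotient is bounded near them, so the
  singularities are removable; \<psi> takes the limit there.\<close>

lemma holomorphic_division:
  assumes \<phi>: "\<phi> holomorphic_on ball 0 r" and \<kappa>: "\<kappa> holomorphic_on ball 0 r"
    and nz: "\<eta>0 \<in> ball 0 r" "\<kappa> \<eta>0 \<noteq> 0"
    and bd: "\<And>\<eta>. \<eta> \<in> ball 0 r \<Longrightarrow> norm (\<phi> \<eta>) \<le> B * norm (\<kappa> \<eta>)"
  obtains \<psi> where "\<psi> holomorphic_on ball 0 r" "\<And>\<eta>. \<eta> \<in> ball 0 r \<Longrightarrow> \<phi> \<eta> = \<kappa> \<eta> * \<psi> \<eta>"
proof -
  define h where "h = (\<lambda>\<eta>. \<phi> \<eta> / \<kappa> \<eta>)"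
  define \<psi> where "\<psi> = (\<lambda>\<eta>. if \<kappa> \<eta> = 0 then Lim (at \<eta>) h else h \<eta>)"
  have hb: "norm (h \<eta>) \<le> B" if "\<eta> \<in> ball 0 r" "\<kappa> \<eta> \<noteq> 0" for \<eta>
    using bd[OF that(1)] that(2) by (simp add: h_def norm_divide divide_le_eq)
  have "\<exists>e>0. ball p e \<subseteq> ball 0 r \<and> \<psi> holomorphic_on ball p e" if p: "p \<in> ball 0 r" for p
  proof -
    have "\<exists>e>0. ball p e \<subseteq> ball 0 r \<and> (\<forall>z\<in>ball p e - {p}. \<kappa> z \<noteq> 0)"
    proof (cases "\<kappa> p = 0")
      case True
      show ?thesis
        by (rule isolated_zeros[OF \<kappa> open_ball connected_ball p True nz]) blast
    next
      case False
      have "isCont \<kappa> p" using holomorphic_on_imp_continuous_on[OF \<kappa>] p by (simp add: continuous_on_eq_continuous_at)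
      from continuous_at_avoid[OF this False] obtain e1 where e1: "e1 > 0" "\<forall>y. dist p y < e1 \<longrightarrow> \<kappa> y \<noteq> 0" by blast
      obtain e2 where e2: "e2 > 0" "ball p e2 \<subseteq> ball 0 r" using openE[OF open_ball p] by blast
      show ?thesis using e1 e2 by (intro exI[of _ "min e1 e2"]) auto
    qed
    then obtain e where e: "e > 0" "ball p e \<subseteq> ball 0 r" "\<And>z. z \<in> ball p e - {p} \<Longrightarrow> \<kappa> z \<noteq> 0" by blast
    have hol: "h holomorphic_on ball p e - {p}"
      unfolding h_def by (intro holomorphic_on_divide holomorphic_on_subset[OF \<phi>] holomorphic_on_subset[OF \<kappa>])
        (use e in auto)
    have "eventually (\<lambda>z. norm (h z) \<le> B) (at p)"
      unfolding eventually_at_topological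
      by (rule exI[of _ "ball p e"]) (use e hb in auto)
    then have "\<exists>g. g holomorphic_on ball p e \<and> (\<forall>z\<in>ball p e - {p}. g z = h z)"
      using holomorphic_on_extend_bounded[OF hol] e(1) by auto
    then obtain g where g: "g holomorphic_on ball p e" "\<And>z. z \<in> ball p e - {p} \<Longrightarrow> g z = h z" by blast
    have pin: "p \<in> ball p e" using e(1) by simp
    have "isCont g p" using holomorphic_on_imp_continuous_on[OF g(1)] pin by (simp add: continuous_on_eq_continuous_at)
    then have "g \<midarrow>p\<rightarrow> g p" by (simp add: isCont_def)
    then have lim: "h \<midarrow>p\<rightarrow> g p"
    proof (rule Lim_transform_within_open[OF _ open_ball pin])
      show "g x = h x" if "x \<in> ball p e" "x \<noteq> p" for x using g(2) that by simp
    qed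
    have "\<psi> z = g z" if z: "z \<in> ball p e" for z
    proof (cases "z = p")
      case True
      show ?thesis
      proof (cases "\<kappa> p = 0")
        case True
        then show ?thesis using \<open>z = p\<close> tendsto_Lim[OF _ lim] by (simp add: \<psi>_def)
      next
        case False
        have "isCont h p" unfolding h_def
          using holomorphic_on_imp_continuous_on[OF \<kappa>] holomorphic_on_imp_continuous_on[OF \<phi>] p False
          by (intro isCont_divide) (simp_all add: continuous_on_eq_continuous_at)
        then have "h \<midarrow>p\<rightarrow> h p" by (simp add: isCont_def)
        from LIM_unique[OF this lim] show ?thesis using False \<open>z = p\<close> by (simp add: \<psi>_def)
      qed
    next
      case False
      then show ?thesis using e(3)[of z] g(2)[of z] z by (simp add: \<psi>_def)
    qed
    then have "\<psi> holomorphic_on ball p e" using g(1) by (intro holomorphic_transform[OF g(1)]) simp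
    then show ?thesis using e by blast
  qed
  then have "\<psi> field_differentiable at p" if "p \<in> ball 0 r" for p
    using that by (metis centre_in_ball holomorphic_on_imp_differentiable_at open_ball)
  then have "\<psi> holomorphic_on ball 0 r"
    by (simp add: holomorphic_on_def field_differentiable_at_within)
  moreover have "\<phi> \<eta> = \<kappa> \<eta> * \<psi> \<eta>" if "\<eta> \<in> ball 0 r" for \<eta>
    using bd[OF that] by (cases "\<kappa> \<eta> = 0") (simp_all add: \<psi>_def h_def)
  ultimately show ?thesis by (rule that)
qed

text \<open>On lines \<open>z + \<zeta> *s w\<close> inside \<open>T\<close> the bounded quotient
  extends over the zeros of \<open>c\<close>, and its value at \<zeta> = 0 is its mean over a circle
  free of zeros. This mean is holomorphic on the full ball, although bound and identity concern
  \<open>T\<close> only.\<close>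

lemma ghol_division:
  fixes w :: "complex ^ 'n"
  assumes H: "ghol H (ball 0 R)" and c: "ghol c (ball 0 R)" and T: "vec.subspace T" and w: "w \<in> T"
    and \<zeta>: "\<zeta> *s w \<in> ball 0 R" "c (\<zeta> *s w) \<noteq> 0"
    and bd: "\<And>z. z \<in> T \<Longrightarrow> z \<in> ball 0 R \<Longrightarrow> norm (H z) \<le> B * norm (c z)"
  obtains f \<delta> where "0 < \<delta>" "\<delta> \<le> R" "ghol f (ball 0 \<delta>)"
    "\<And>z. z \<in> T \<Longrightarrow> z \<in> ball 0 \<delta> \<Longrightarrow> H z = c z * f z"
proof -
  have R: "0 < R" using \<zeta>(1) norm_ge_zero[of "\<zeta> *s w"] unfolding mem_ball_0 by linarith
  define r0 where "r0 = R / (2 * (norm w + 1))"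
  have nw: "0 < norm w + 1" using norm_ge_zero[of w] by linarith
  have "R / (2 * n) * n = R / 2" if "0 < n" for n :: real using that by simp
  from this[OF nw] have r0: "0 < r0" "r0 * (norm w + 1) = R / 2" using R nw by (simp_all add: r0_def)
  have inb: "u + \<zeta> *s w \<in> ball 0 R" if "u \<in> ball 0 (R/2)" "\<zeta> \<in> ball 0 r0" for u \<zeta>
  proof -
    have "norm (\<zeta> *s w) \<le> r0 * (norm w + 1)"
      unfolding norm_smult_vec by (rule mult_mono) (use that r0 in auto)
    then show ?thesis using norm_triangle_ineq[of u "\<zeta> *s w"] that r0 by simp
  qed
  have lin: "Vector_Spaces.linear (*s) (*s) (\<lambda>z :: complex ^ 'n. z)" by unfold_locales auto
  have hol: "hol2 (\<lambda>z \<zeta>. f (z + \<zeta> *s w)) (R/2) r0" if "ghol f (ball 0 R)" for f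
    by (rule hol2_line[OF that lin]) (rule inb)
  obtain \<eta> where \<eta>: "norm \<eta> < r0" "c (\<eta> *s w) \<noteq> 0" using ghol_line_nonzero[OF c \<zeta> r0(1)] by blast
  have pre: "\<eta> \<in> ball 0 r0" "c (0 + \<eta> *s w) \<noteq> 0" "0 < R/2" using \<eta> R by auto
  obtain \<delta> r d M where *: "0 < \<delta>" "\<delta> < R/2" "\<delta> < 1" "0 < r" "r < r0" "r < 1"
    and "\<And>u. u \<in> ball 0 \<delta> \<Longrightarrow> size (M u) = d \<and> set_mset (M u) = {\<zeta>\<in>ball 0 r. c (u + \<zeta> *s w) = 0}"
    and cnz: "\<And>u \<zeta>. u \<in> ball 0 \<delta> \<Longrightarrow> norm \<zeta> = r \<Longrightarrow> c (u + \<zeta> *s w) \<noteq> 0"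
    and "\<And>u v. (\<lambda>\<zeta>. c (u + \<zeta> *s w)) = (\<lambda>\<zeta>. c (v + \<zeta> *s w)) \<Longrightarrow> M u = M v"
    and "\<And>\<zeta>. \<zeta> \<in># M 0 \<Longrightarrow> \<zeta> = 0"
    and "\<And>\<phi>. hol2 \<phi> \<delta> r0 \<Longrightarrow> ghol (\<lambda>u. \<Prod>\<zeta>\<in>#M u. \<phi> u \<zeta>) (ball 0 \<delta>)"
    by (rule holomorphic_roots[OF hol[OF c] pre zero_less_one]) (rule that)
  have sub: "ball (0 :: complex ^ 'n) \<delta> \<times> sphere (0 :: complex) r \<subseteq> ball 0 (R/2) \<times> ball 0 r0" using * by auto
  show ?thesis
  proof (rule that[of \<delta> "\<lambda>z. cmean r (\<lambda>\<eta>. H (z + \<eta> *s w) / c (z + \<eta> *s w))"])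
    show "ghol (\<lambda>z. cmean r (\<lambda>\<eta>. H (z + \<eta> *s w) / c (z + \<eta> *s w))) (ball 0 \<delta>)"
    proof (rule ghol_cmean)
      have "continuous_on (ball 0 \<delta> \<times> sphere 0 r) (\<lambda>(z, \<eta>). H (z + \<eta> *s w))"
        "continuous_on (ball 0 \<delta> \<times> sphere 0 r) (\<lambda>(z, \<eta>). c (z + \<eta> *s w))"
        using hol[OF H] hol[OF c] continuous_on_subset[OF _ sub] by (auto simp: hol2_def)
      then show "continuous_on (ball 0 \<delta> \<times> sphere 0 r) (\<lambda>(z, \<eta>). H (z + \<eta> *s w) / c (z + \<eta> *s w))"
        unfolding case_prod_unfold by (intro continuous_on_divide) (use cnz in auto)
      fix \<eta> :: complex assume \<eta>: "\<eta> \<in> sphere 0 r"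
      have "\<eta> \<in> ball 0 r0" using \<eta> * by simp
      then have "ghol (\<lambda>z. H (z + \<eta> *s w)) (ball 0 (R/2))" "ghol (\<lambda>z. c (z + \<eta> *s w)) (ball 0 (R/2))"
        using hol[OF H] hol[OF c] by (simp_all add: hol2_def)
      then show "ghol (\<lambda>z. H (z + \<eta> *s w) / c (z + \<eta> *s w)) (ball 0 \<delta>)"
        using * cnz \<eta> by (intro ghol_divide ghol_subset[of _ "ball 0 (R/2)" "ball 0 \<delta>"]) auto
    qed (use * in auto)
    fix z assume z: "z \<in> T" "z \<in> ball 0 \<delta>"
    have z2: "z \<in> ball 0 (R/2)" using z * by simp
    have \<phi>: "(\<lambda>\<eta>. H (z + \<eta> *s w)) holomorphic_on ball 0 r0" and \<kappa>: "(\<lambda>\<eta>. c (z + \<eta> *s w)) holomorphic_on ball 0 r0"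
      using hol[OF H] hol[OF c] z2 by (auto simp: hol2_def)
    have ne: "of_real r \<in> ball (0 :: complex) r0" "c (z + of_real r *s w) \<noteq> 0"
      using * cnz[OF z(2), of "of_real r"] by auto
    have le: "norm (H (z + \<eta> *s w)) \<le> B * norm (c (z + \<eta> *s w))" if "\<eta> \<in> ball 0 r0" for \<eta>
      by (rule bd[OF _ inb[OF z2 that]]) (intro vec.subspace_add[OF T] vec.subspace_scale[OF T] z(1) w)
    obtain \<psi> where \<psi>: "\<psi> holomorphic_on ball 0 r0" "\<And>\<eta>. \<eta> \<in> ball 0 r0 \<Longrightarrow> H (z + \<eta> *s w) = c (z + \<eta> *s w) * \<psi> \<eta>"
      by (rule holomorphic_division[OF \<phi> \<kappa> ne le]) (assumption, rule that)
    have "cmean r (\<lambda>\<eta>. H (z + \<eta> *s w) / c (z + \<eta> *s w)) = cmean r (\<lambda>\<eta>. \<psi> \<eta> * \<eta> / (\<eta> - 0))"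
    proof (rule cmean_cong)
      fix \<eta> :: complex assume "norm \<eta> = r"
      then show "H (z + \<eta> *s w) / c (z + \<eta> *s w) = \<psi> \<eta> * \<eta> / (\<eta> - 0)"
        using \<psi>(2)[of \<eta>] cnz[OF z(2), of \<eta>] * by auto
    qed (use * in simp)
    also have "\<dots> = \<psi> 0" by (rule cmean_Cauchy[OF \<psi>(1)]) (use * in auto)
    finally show "H z = c z * cmean r (\<lambda>\<eta>. H (z + \<eta> *s w) / c (z + \<eta> *s w))"
      using \<psi>(2)[of 0] r0 by simp
  qed (use * R in auto)
qed

section \<open>Linear functionals, projections along a line and their kernels\<close>

lemma linear_functional_bound:
  fixes \<tau> :: "complex ^ 'n \<Rightarrow> complex"
  assumes "Vector_Spaces.linear (*s) (*) \<tau>"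
  obtains C where "0 < C" "\<And>z. norm (\<tau> z) \<le> C * norm z"
  using bounded_linear.pos_bounded[OF clinear_functional_bounded[OF assms]] by (auto simp: mult.commute)

lemma linear_proj:
  fixes w :: "complex ^ 'n"
  assumes "Vector_Spaces.linear (*s) (*) \<tau>"
  shows "Vector_Spaces.linear (*s) (*s) (\<lambda>z. z - \<tau> z *s w)"
proof -
  interpret l: Vector_Spaces.linear "(*s)" "(*)" \<tau> by fact
  show ?thesis
    by unfold_locales
      (simp_all add: l.add l.scale vec.scale_left_distrib vec.scale_right_diff_distrib)
qed

lemma linear_proj_bound:
  fixes w :: "complex ^ 'n"
  assumes "Vector_Spaces.linear (*s) (*) \<tau>"
  obtains C where "0 < C" "\<And>z. norm (z - \<tau> z *s w) \<le> C * norm z"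
  using bounded_linear.pos_bounded[OF clinear_scaleR[OF linear_proj[OF assms]]] by (auto simp: mult.commute)

lemma exists_dual_functional:
  fixes w :: "complex ^ 'n"
  assumes "w \<noteq> 0"
  obtains \<tau> where "Vector_Spaces.linear (*s) (*) \<tau>" "\<tau> w = 1"
proof -
  obtain j where j: "w $ j \<noteq> 0" using assms by (auto simp: vec_eq_iff)
  have "Vector_Spaces.linear (*s) (*) (\<lambda>z :: complex ^ 'n. z $ j / w $ j)"
    by unfold_locales (simp_all add: algebra_simps add_divide_distrib)
  then show ?thesis by (rule that) (use j in simp)
qed

lemma subspace_kernel:
  assumes "Vector_Spaces.linear (*s) (*) (\<tau> :: complex ^ 'n \<Rightarrow> complex)" "vec.subspace T"
  shows "vec.subspace {z\<in>T. \<tau> z = 0}"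
proof -
  interpret l: Vector_Spaces.linear "(*s)" "(*)" \<tau> by fact
  show ?thesis using assms(2) by (auto simp: vec.subspace_def l.add l.scale l.zero)
qed

lemma dim_kernel_less:
  assumes "Vector_Spaces.linear (*s) (*) (\<tau> :: complex ^ 'n \<Rightarrow> complex)" "vec.subspace T" "w \<in> T" "\<tau> w \<noteq> 0"
  shows "vec.dim {z\<in>T. \<tau> z = 0} < vec.dim T"
proof -
  have sub: "vec.subspace {z\<in>T. \<tau> z = 0}" by (rule subspace_kernel[OF assms(1,2)])
  have "vec.span {z\<in>T. \<tau> z = 0} = {z\<in>T. \<tau> z = 0}" "vec.span T = T"
    using sub assms(2) by (simp_all add: vec.span_eq_iff)
  then have "vec.span {z\<in>T. \<tau> z = 0} \<subset> vec.span T"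
    using assms(3,4) by (simp only:) auto
  then show ?thesis by (rule vec.dim_psubset)
qed

text \<open>\<open>w\<close> is a direction on which the lowest homogeneous part of \<open>c\<close>
  restricted to \<open>T\<close> is nonzero. Zeros of \<open>c\<close> tending to 0 in direction
  \<open>w\<close> would make \<open>scaled c q\<close> vanish in the limit, against its limit
  \<open>\<psi> w 0\<close>.\<close>

lemma vanishing_direction:
  fixes c :: "complex ^ 'n \<Rightarrow> complex"
  assumes c: "ghol c (ball 0 R)" and T: "vec.subspace T" and z0: "z0 \<in> T" "z0 \<in> ball 0 R" "c z0 \<noteq> 0" and c0: "c 0 = 0"
  obtains w \<zeta> \<tau> K \<delta> where "w \<in> T" "\<zeta> *s w \<in> ball 0 R" "c (\<zeta> *s w) \<noteq> 0"
    "Vector_Spaces.linear (*s) (*) \<tau>" "\<tau> w = 1" "0 < K" "0 < \<delta>"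
    "\<And>a. a \<in> T \<Longrightarrow> norm a < \<delta> \<Longrightarrow> c a = 0 \<Longrightarrow> norm a \<le> K * norm (a - \<tau> a *s w)"
proof -
  have R: "0 < R" using z0(2) norm_ge_zero[of z0] unfolding mem_ball_0 by linarith
  define Rv where "Rv = (\<lambda>v :: complex ^ 'n. R / (norm v + 1))"
  have nv: "0 < norm v + 1" for v :: "complex ^ 'n" using norm_ge_zero[of v] by linarith
  have Rv: "0 < Rv v" for v unfolding Rv_def using R nv[of v] by simp
  have inb: "\<eta> *s v \<in> ball 0 R" if "\<eta> \<in> ball 0 (Rv v)" for \<eta> v
  proof -
    have "norm \<eta> * (norm v + 1) < R" using that nv[of v] by (simp add: Rv_def pos_less_divide_eq)
    moreover have "norm \<eta> * norm v \<le> norm \<eta> * (norm v + 1)" by (intro mult_left_mono) auto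
    ultimately show ?thesis by (simp add: norm_smult_vec)
  qed
  have hol: "(\<lambda>\<eta>. c (\<eta> *s v)) holomorphic_on ball 0 (Rv v)" for v
  proof -
    have "(\<lambda>\<eta>. c (0 + \<eta> *s v)) holomorphic_on ball 0 (Rv v)"
      by (rule holomorphic_on_subset[OF ghol_line[OF c]]) (use inb in auto)
    then show ?thesis by simp
  qed
  obtain \<eta> where \<eta>: "norm \<eta> < Rv z0" "c (\<eta> *s z0) \<noteq> 0"
    using ghol_line_nonzero[OF c, of 1 z0 "Rv z0"] z0 Rv by auto
  have ex: "\<exists>v\<in>T. \<exists>\<eta>\<in>ball 0 (Rv v). c (\<eta> *s v) \<noteq> 0" using z0(1) \<eta> by (intro bexI[of _ z0] bexI[of _ \<eta>]) auto
  obtain q w \<psi> where w: "w \<in> T" "\<psi> w 0 \<noteq> 0"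
    and \<psi>hol: "\<And>v. v \<in> T \<Longrightarrow> \<psi> v holomorphic_on ball 0 (Rv v)"
    and \<psi>: "\<And>v \<eta>. v \<in> T \<Longrightarrow> \<eta> \<in> ball 0 (Rv v) \<Longrightarrow> c (\<eta> *s v) = \<eta> ^ q * \<psi> v \<eta>"
    by (rule holomorphic_family_factor[OF hol ex]) (rule that)
  have "q \<noteq> 0"
  proof
    assume "q = 0"
    then have "c (0 *s w) = \<psi> w 0" using \<psi>[OF w(1), of 0] Rv[of w] by simp
    then show False using c0 w(2) by simp
  qed
  have w0: "w \<noteq> 0"
  proof
    assume "w = 0"
    then have eq: "\<eta> ^ q * \<psi> w \<eta> = 0" if "\<eta> \<in> ball 0 (Rv w)" for \<eta> using \<psi>[OF w(1) that] c0 by simp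
    have "isCont (\<psi> w) 0"
      using holomorphic_on_imp_continuous_on[OF \<psi>hol[OF w(1)]] Rv[of w] by (simp add: continuous_on_eq_continuous_at)
    from continuous_at_avoid[OF this w(2)] obtain e where e: "e > 0" "\<forall>y. dist 0 y < e \<longrightarrow> \<psi> w y \<noteq> 0" by blast
    define s where "s = min e (Rv w) / 2"
    have "0 < s" "s < e" "s < Rv w" using e Rv[of w] by (auto simp: s_def min_def)
    then show False using eq[of "of_real s"] e(2) by auto
  qed
  obtain \<tau> where \<tau>: "Vector_Spaces.linear (*s) (*) \<tau>" "\<tau> w = 1" by (rule exists_dual_functional[OF w0])
  define S where "S = {a\<in>T. c a = 0}"
  have "\<exists>K>0. \<exists>\<delta>>0. \<forall>a\<in>S. norm a < \<delta> \<longrightarrow> norm a \<le> K * norm (a - \<tau> a *s w)"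
  proof (rule ccontr)
    assume neg: "\<not> ?thesis"
    obtain t b where tb: "\<And>i. t i \<noteq> 0" "\<And>i. t i *s b i \<in> S" "t \<longlonglongrightarrow> 0" "b \<longlonglongrightarrow> w"
      by (rule cone_condition_or_sequence[OF \<tau> neg]) (rule that)
    have bT: "b i \<in> T" for i
    proof -
      have "t i *s b i \<in> T" using tb(2)[of i] by (simp add: S_def)
      from vec.subspace_scale[OF T this, of "inverse (t i)"] show ?thesis using tb(1)[of i] by simp
    qed
    define B where "B = norm w + 1"
    have B: "0 < B" unfolding B_def by (rule nv)
    define \<rho> where "\<rho> = R / (B + 1)"
    have \<rho>: "0 < \<rho>" "\<rho> * B \<le> R" using R B by (auto simp: \<rho>_def field_simps)
    have \<rho>': "\<rho> < Rv v" if "v \<in> ball 0 B" for v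
      unfolding \<rho>_def Rv_def using that R nv[of v] by (intro divide_strict_left_mono) auto
    have val: "scaled c q \<rho> t v = \<psi> v t" if "norm t < \<rho>" "v \<in> ball 0 B" "v \<in> T" for t v
      by (rule scaled_props(3)[OF c B \<rho> that(1) \<rho>'[OF that(2)] \<psi>hol[OF that(3)] \<psi>[OF that(3)]])
    have win: "w \<in> ball 0 B" by (simp add: B_def)
    have "isCont (\<lambda>(t, z). scaled c q \<rho> t z) (0, w)"
      using scaled_props(1)[OF c B \<rho>] \<rho>(1) win by (simp add: continuous_on_eq_continuous_at open_Times)
    from isCont_tendsto_compose[OF this tendsto_Pair[OF tb(3,4)]]
    have lim: "(\<lambda>i. scaled c q \<rho> (t i) (b i)) \<longlonglongrightarrow> \<psi> w 0" using val[of 0 w] \<rho>(1) win w(1) by simp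
    have "\<forall>\<^sub>F i in sequentially. scaled c q \<rho> (t i) (b i) = 0"
    proof -
      have "\<forall>\<^sub>F i in sequentially. t i \<in> ball 0 \<rho>" using topological_tendstoD[OF tb(3), of "ball 0 \<rho>"] \<rho>(1) by simp
      moreover have "\<forall>\<^sub>F i in sequentially. b i \<in> ball 0 B" using topological_tendstoD[OF tb(4), of "ball 0 B"] win by simp
      ultimately show ?thesis
      proof eventually_elim
        case (elim i)
        have tin: "t i \<in> ball 0 (Rv (b i))" using elim \<rho>'[of "b i"] by simp
        have "t i ^ q * \<psi> (b i) (t i) = 0" using \<psi>[OF bT tin] tb(2)[of i] by (simp add: S_def)
        then show ?case using val[of "t i" "b i"] elim bT[of i] tb(1)[of i] by simp
      qed
    qed
    then have "(\<lambda>i. scaled c q \<rho> (t i) (b i)) \<longlonglongrightarrow> 0" by (rule tendsto_eventually)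
    from LIMSEQ_unique[OF this lim] show False using w(2) by simp
  qed
  then obtain K \<delta> where K: "0 < K" "0 < \<delta>" "\<And>a. a \<in> S \<Longrightarrow> norm a < \<delta> \<Longrightarrow> norm a \<le> K * norm (a - \<tau> a *s w)" by blast
  obtain \<zeta> where \<zeta>: "\<zeta> *s w \<in> ball 0 R" "c (\<zeta> *s w) \<noteq> 0"
  proof -
    have "isCont (\<psi> w) 0"
      using holomorphic_on_imp_continuous_on[OF \<psi>hol[OF w(1)]] Rv[of w] by (simp add: continuous_on_eq_continuous_at)
    from continuous_at_avoid[OF this w(2)] obtain e where e: "e > 0" "\<forall>y. dist 0 y < e \<longrightarrow> \<psi> w y \<noteq> 0" by blast
    define s where "s = min e (Rv w) / 2"
    have s: "0 < s" "s < e" "s < Rv w" using e Rv[of w] by (auto simp: s_def min_def)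
    have sin: "of_real s \<in> ball (0 :: complex) (Rv w)" using s by simp
    have "c (of_real s *s w) \<noteq> 0" using \<psi>[OF w(1) sin] e(2) s by simp
    then show ?thesis using inb[OF sin] by (intro that)
  qed
  show ?thesis
    by (rule that[OF w(1) \<zeta> \<tau> K(1,2)]) (rule K(3), simp_all add: S_def)
qed

lemma prod_mset_bounds:
  fixes f :: "'a \<Rightarrow> complex"
  shows "(\<And>x. x \<in># M \<Longrightarrow> norm (f x) \<le> b) \<Longrightarrow> norm (\<Prod>x\<in>#M. f x) \<le> b ^ size M"
    and "(\<And>x. x \<in># M \<Longrightarrow> l \<le> norm (f x)) \<Longrightarrow> 0 \<le> l \<Longrightarrow> l ^ size M \<le> norm (\<Prod>x\<in>#M. f x)"
proof (induction M)
  case (add x M)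
  {
    case 1
    have "norm (f x) \<le> b" using 1 by simp
    moreover have "norm (\<Prod>x\<in>#M. f x) \<le> b ^ size M" using add.IH(1) 1 by simp
    moreover have "0 \<le> b" using \<open>norm (f x) \<le> b\<close> norm_ge_zero[of "f x"] by linarith
    ultimately show ?case by (simp add: norm_mult mult_mono)
  next
    case 2
    have "l \<le> norm (f x)" using 2 by simp
    moreover have "l ^ size M \<le> norm (\<Prod>x\<in>#M. f x)" using add.IH(2) 2 by simp
    ultimately show ?case using 2(2) by (simp add: norm_mult mult_mono)
  }
qed auto

text \<open>The generic part of an analytic set over its projection along \<open>w\<close>: \<open>H = c * f\<close> where, for generic \<open>z\<close>,
  \<open>f z\<close> is the product of \<open>\<tau> z - \<zeta>\<close> over those roots \<open>\<zeta>\<close> of the first equation that lie on the set.\<close>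

lemma cone_generic_part:
  fixes w :: "complex ^ 'n"
  assumes T: "vec.subspace T" and wT: "w \<in> T" and \<tau>: "Vector_Spaces.linear (*s) (*) \<tau>" "\<tau> w = 1"
    and R: "0 < R" and F: "\<And>f. f \<in> F \<Longrightarrow> ghol f (ball 0 R)" and K: "0 < K"
    and cone: "\<And>a. a \<in> T \<Longrightarrow> a \<in> ball 0 R \<Longrightarrow> (\<And>f. f \<in> F \<Longrightarrow> f a = 0) \<Longrightarrow> norm a \<le> K * norm (a - \<tau> a *s w)"
  obtains c H \<delta> C q u0 where "0 < \<delta>" "\<delta> \<le> R" "ghol c (ball 0 \<delta>)" "ghol H (ball 0 \<delta>)" "0 < C"
    "\<And>z. c (z - \<tau> z *s w) = c z" "u0 \<in> T" "\<tau> u0 = 0" "u0 \<in> ball 0 \<delta>" "c u0 \<noteq> 0"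
    "\<And>z. z \<in> T \<Longrightarrow> norm z < \<delta> / C \<Longrightarrow> norm (H z) \<le> norm (c z) * (C * norm z) ^ q"
    "\<And>z. z \<in> T \<Longrightarrow> norm z < \<delta> / C \<Longrightarrow>
       norm (c z) * (max 0 (norm (\<tau> z) - C * norm (z - \<tau> z *s w))) ^ q \<le> norm (H z)"
    "\<And>z. z \<in> T \<Longrightarrow> norm z < \<delta> / C \<Longrightarrow> \<forall>f\<in>F. f z = 0 \<Longrightarrow> H z = 0"
proof -
  interpret l: Vector_Spaces.linear "(*s)" "(*)" \<tau> by fact
  define P where "P = (\<lambda>z. z - \<tau> z *s w)"
  have P_eq: "P z = z - \<tau> z *s w" for z by (simp add: P_def)
  have Plin: "Vector_Spaces.linear (*s) (*s) P" unfolding P_def by (rule linear_proj[OF \<tau>(1)])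
  have \<tau>P: "\<tau> (P z) = 0" for z by (simp add: P_def l.diff l.scale \<tau>(2))
  have PP: "P (P z) = P z" for z unfolding P_eq[of "P z"] \<tau>P by simp
  have Pid: "P u = u" if "\<tau> u = 0" for u using that by (simp add: P_def)
  have PT: "P z \<in> T" if "z \<in> T" for z unfolding P_def by (intro vec.subspace_diff[OF T] vec.subspace_scale[OF T] that wT)
  have Pline: "P (u + \<zeta> *s w) = u" "\<tau> (u + \<zeta> *s w) = \<zeta>" if "\<tau> u = 0" for u \<zeta>
    using that by (simp_all add: P_def l.add l.scale \<tau>(2))
  have w0: "w \<noteq> 0" using \<tau>(2) l.zero by auto
  have nw: "0 < norm w" using w0 by simp
  obtain CP where CP0: "0 < CP" "\<And>z. norm (z - \<tau> z *s w) \<le> CP * norm z"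
    by (rule linear_proj_bound[OF \<tau>(1)]) (rule that)
  have CP: "0 < CP" "\<And>z. norm (P z) \<le> CP * norm z" using CP0 by (simp_all add: P_eq)
  obtain CT where CT: "0 < CT" "\<And>z. norm (\<tau> z) \<le> CT * norm z" by (rule linear_functional_bound[OF \<tau>(1)]) (rule that)
  \<comment> \<open>A nonzero multiple of \<open>w\<close> has projection 0 and violates the cone
    condition, so some equation is nonzero there.\<close>
  obtain f1 \<zeta>1 where f1: "f1 \<in> F" "\<zeta>1 *s w \<in> ball 0 R" "f1 (\<zeta>1 *s w) \<noteq> 0"
  proof -
    define t where "t = complex_of_real (R / (2 * norm w))"
    have t: "norm (t *s w) = R / 2" unfolding norm_smult_vec t_def norm_of_real using R nw by simp
    have "\<exists>f\<in>F. f (t *s w) \<noteq> 0"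
    proof (rule ccontr)
      assume "\<not> ?thesis"
      then have "norm (t *s w) \<le> K * norm (t *s w - \<tau> (t *s w) *s w)"
        using t R by (intro cone vec.subspace_scale[OF T] wT) auto
      then show False using t R by (simp add: l.scale \<tau>(2))
    qed
    then obtain f where "f \<in> F" "f (t *s w) \<noteq> 0" by blast
    then show ?thesis using t R by (intro that[of f t]) auto
  qed
  define r0 where "r0 = R / (2 * norm w)"
  define \<delta>0 where "\<delta>0 = min R (R / (2 * CP))"
  have r0: "0 < r0" "r0 * norm w = R / 2" using R nw by (simp_all add: r0_def)
  have \<delta>0: "0 < \<delta>0" "\<delta>0 \<le> R" "CP * \<delta>0 \<le> R / 2"
  proof -
    have "CP * \<delta>0 \<le> CP * (R / (2 * CP))" using CP(1) by (intro mult_left_mono) (auto simp: \<delta>0_def)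
    then show "CP * \<delta>0 \<le> R / 2" using CP(1) by simp
  qed (use R CP(1) in \<open>auto simp: \<delta>0_def\<close>)
  have inb: "P z + \<zeta> *s w \<in> ball 0 R" if "z \<in> ball 0 \<delta>0" "\<zeta> \<in> ball 0 r0" for z \<zeta>
  proof -
    have "norm \<zeta> * norm w < r0 * norm w" using that nw by (intro mult_strict_right_mono) auto
    then have "norm (\<zeta> *s w) < R / 2" unfolding norm_smult_vec r0(2) .
    moreover have "norm (P z) \<le> R / 2"
    proof -
      have "CP * norm z \<le> CP * \<delta>0" using that CP(1) by (intro mult_left_mono) auto
      then show ?thesis using CP(2)[of z] \<delta>0(3) by linarith
    qed
    ultimately show ?thesis using norm_triangle_ineq[of "P z" "\<zeta> *s w"] by simp
  qed
  have hol: "hol2 (\<lambda>z \<zeta>. f (P z + \<zeta> *s w)) \<delta>0 r0" if "ghol f (ball 0 R)" for f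
    by (rule hol2_line[OF that Plin]) (rule inb)
  obtain \<eta> where \<eta>: "norm \<eta> < r0" "f1 (\<eta> *s w) \<noteq> 0"
    using ghol_line_nonzero[OF F[OF f1(1)] f1(2,3) r0(1)] by blast
  have P0: "P 0 = 0" by (simp add: P_def)
  have pre: "\<eta> \<in> ball 0 r0" "f1 (P 0 + \<eta> *s w) \<noteq> 0" using \<eta> by (auto simp: P0)
  obtain \<delta> r d M where *: "0 < \<delta>" "\<delta> < \<delta>0" "\<delta> < 1" "0 < r" "r < r0" "r < 1"
    and M: "\<And>u. u \<in> ball 0 \<delta> \<Longrightarrow> size (M u) = d \<and> set_mset (M u) = {\<zeta>\<in>ball 0 r. f1 (P u + \<zeta> *s w) = 0}"
    and "\<And>u \<zeta>. u \<in> ball 0 \<delta> \<Longrightarrow> norm \<zeta> = r \<Longrightarrow> f1 (P u + \<zeta> *s w) \<noteq> 0"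
    and Mcong: "\<And>u v. (\<lambda>\<zeta>. f1 (P u + \<zeta> *s w)) = (\<lambda>\<zeta>. f1 (P v + \<zeta> *s w)) \<Longrightarrow> M u = M v"
    and "\<And>\<zeta>. \<zeta> \<in># M 0 \<Longrightarrow> \<zeta> = 0"
    and prod: "\<And>\<phi>. hol2 \<phi> \<delta> r0 \<Longrightarrow> ghol (\<lambda>u. \<Prod>\<zeta>\<in>#M u. \<phi> u \<zeta>) (ball 0 \<delta>)"
    by (rule holomorphic_roots[OF hol[OF F[OF f1(1)]] pre \<delta>0(1) zero_less_one]) (rule that)
  have MP: "M (P z) = M z" for z by (rule Mcong) (simp add: PP)
  define n where "n = (\<lambda>g z. size (filter_mset (\<lambda>\<zeta>. (g (P z + \<zeta> *s w) :: complex) \<noteq> 0) (M z)))"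
  \<comment> \<open>\<open>n g z\<close> counts the roots on the line through \<open>z\<close> at
    which \<open>g\<close> is nonzero. \<open>g\<close> is chosen to attain the maximum
    \<open>k\<close>; wherever it is attained, the remaining roots are common zeros of
    \<open>F\<close>.\<close>
  define A where "A = {n g u |g u. g \<in> lspan F \<and> u \<in> T \<and> \<tau> u = 0 \<and> u \<in> ball 0 \<delta>}"
  have "A \<subseteq> {..d}"
  proof
    fix k assume "k \<in> A"
    then obtain g u where "k = n g u" "u \<in> ball 0 \<delta>" by (auto simp: A_def)
    then show "k \<in> {..d}" using M[of u] size_filter_mset_lesseq[of _ "M u"] by (simp add: n_def)
  qed
  then have finA: "finite A" by (rule finite_subset) simp
  have "n (\<lambda>_. 0) 0 \<in> A" unfolding A_def using lspan.zero[of F] vec.subspace_0[OF T] l.zero *(1) by fastforce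
  then have "Max A \<in> A" using finA by (intro Max_in) auto
  then obtain g u0 where g: "g \<in> lspan F" and u0: "u0 \<in> T" "\<tau> u0 = 0" "u0 \<in> ball 0 \<delta>" and nmax: "n g u0 = Max A"
    by (auto simp: A_def)
  define k where "k = n g u0"
  have nle: "n g' u \<le> k" if "g' \<in> lspan F" "u \<in> T" "\<tau> u = 0" "u \<in> ball 0 \<delta>" for g' u
    unfolding k_def nmax by (rule Max_ge[OF finA]) (use that in \<open>auto simp: A_def\<close>)
  have nP: "n g' (P z) = n g' z" for g' z by (simp add: n_def MP PP)
  \<comment> \<open>Coefficients of X^k. Where \<open>n g z = k\<close>, \<open>c\<close> is the
    product of the nonzero values of \<open>g\<close> and \<open>H\<close> is \<open>c\<close> times
    the product of \<open>\<tau> z - \<zeta>\<close> over the other roots; where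
    \<open>n g z < k\<close>, both vanish. In this way roots are selected holomorphically.\<close>
  define c where "c = (\<lambda>z. coeff (\<Prod>\<zeta>\<in>#M z. [:1, g (P z + \<zeta> *s w):]) k)"
  define H where "H = (\<lambda>z. coeff (\<Prod>\<zeta>\<in>#M z. [:\<tau> z - \<zeta>, g (P z + \<zeta> *s w):]) k)"
  have ghg: "ghol g (ball 0 R)" by (rule lspan_ghol[OF g]) (auto intro: F)
  have h2g: "hol2 (\<lambda>z \<zeta>. g (P z + \<zeta> *s w)) \<delta> r0" using hol2_subset[OF hol[OF ghg]] * by simp
  have h2l: "hol2 (\<lambda>z \<zeta>. \<tau> z - \<zeta>) \<delta> r0"
  proof -
    have "hol2 (\<lambda>z \<zeta>. \<tau> z + (- 1) * \<zeta>) \<delta> r0"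
      by (intro hol2_add hol2_fst hol2_mult hol2_const hol2_snd ghol_functional[OF \<tau>(1)]) simp
    then show ?thesis by simp
  qed
  have Msize: "size (M u) = d" if "u \<in> ball 0 \<delta>" for u using M[OF that] by simp
  have ghc: "ghol c (ball 0 \<delta>)" unfolding c_def by (rule ghol_coeff_prod[OF prod Msize hol2_const h2g])
  have ghH: "ghol H (ball 0 \<delta>)" unfolding H_def by (rule ghol_coeff_prod[OF prod Msize h2l h2g])
  define q where "q = d - k"
  define NZ where "NZ = (\<lambda>z. filter_mset (\<lambda>\<zeta>. g (P z + \<zeta> *s w) \<noteq> 0) (M z))"
  define Z where "Z = (\<lambda>z. filter_mset (\<lambda>\<zeta>. g (P z + \<zeta> *s w) = 0) (M z))"
  define G where "G = (\<lambda>z. \<Prod>\<zeta>\<in>#NZ z. g (P z + \<zeta> *s w))"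
  have Gnz: "G z \<noteq> 0" for z by (auto simp: G_def NZ_def prod_mset_zero_iff)
  have low: "c z = 0" "H z = 0" if "n g z < k" for z
    using coeff_prod_linear(2)[of "\<lambda>\<zeta>. g (P z + \<zeta> *s w)" "M z" k] that unfolding c_def H_def n_def by auto
  have top: "c z = G z" "H z = G z * (\<Prod>\<zeta>\<in>#Z z. \<tau> z - \<zeta>)" if "n g z = k" for z
    using coeff_prod_linear(1)[of "\<lambda>\<zeta>. 1" "\<lambda>\<zeta>. g (P z + \<zeta> *s w)" "M z"]
      coeff_prod_linear(1)[of "\<lambda>\<zeta>. \<tau> z - \<zeta>" "\<lambda>\<zeta>. g (P z + \<zeta> *s w)" "M z"] that
    unfolding c_def H_def n_def G_def NZ_def Z_def by simp_all
  have Zsize: "size (Z z) = q" if "n g z = k" "z \<in> ball 0 \<delta>" for z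
  proof -
    have "size N = size (filter_mset (\<lambda>\<zeta>. g (P z + \<zeta> *s w) \<noteq> 0) N) + size (filter_mset (\<lambda>\<zeta>. g (P z + \<zeta> *s w) = 0) N)" for N
      by (induction N) auto
    from this[of "M z"] have "size (M z) = size (NZ z) + size (Z z)" unfolding NZ_def Z_def .
    then show ?thesis using that Msize[OF that(2)] by (simp add: q_def n_def NZ_def)
  qed
  \<comment> \<open>If some \<open>f\<close> were nonzero at such a root,
    \<open>lspan_improve\<close> would give a combination nonzero at more than \<open>k\<close>
    roots.\<close>
  have onA: "f (P z + \<zeta> *s w) = 0" if zk: "n g z = k" and \<zeta>Z: "\<zeta> \<in># Z z" and fF: "f \<in> F" and PzT: "P z \<in> T" "P z \<in> ball 0 \<delta>" for f z \<zeta>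
  proof (rule ccontr)
    assume nz: "f (P z + \<zeta> *s w) \<noteq> 0"
    obtain g' where g': "g' \<in> lspan F"
      "\<forall>p\<in>(\<lambda>\<zeta>. P z + \<zeta> *s w) ` set_mset (M z). g p \<noteq> 0 \<or> f p \<noteq> 0 \<longrightarrow> g' p \<noteq> 0"
      using lspan_improve[OF g fF, of "(\<lambda>\<zeta>. P z + \<zeta> *s w) ` set_mset (M z)"] by auto
    have "NZ z \<subseteq># filter_mset (\<lambda>\<zeta>. g' (P z + \<zeta> *s w) \<noteq> 0) (M z)"
    proof (rule mset_subset_eqI)
      show "count (NZ z) x \<le> count (filter_mset (\<lambda>\<zeta>. g' (P z + \<zeta> *s w) \<noteq> 0) (M z)) x" for x
        using g'(2) by (cases "x \<in># M z") (auto simp: NZ_def not_in_iff)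
    qed
    moreover have "\<zeta> \<in># filter_mset (\<lambda>\<zeta>. g' (P z + \<zeta> *s w) \<noteq> 0) (M z)"
      using g'(2) \<zeta>Z nz by (auto simp: Z_def)
    moreover have "\<zeta> \<notin># NZ z" using \<zeta>Z by (auto simp: Z_def NZ_def)
    ultimately have "NZ z \<subset># filter_mset (\<lambda>\<zeta>. g' (P z + \<zeta> *s w) \<noteq> 0) (M z)"
      by (metis subset_mset.le_neq_trans)
    then have "n g z < n g' z" unfolding n_def NZ_def by (rule mset_subset_size)
    moreover have "n g' z \<le> k" using nle[OF g'(1) PzT(1) \<tau>P PzT(2)] by (simp add: nP)
    ultimately show False using zk by simp
  qed
  define C2 where "C2 = (K + 1) / norm w"
  have C2: "0 < C2" using K nw by (simp add: C2_def)
  \<comment> \<open>These roots give points of the analytic set, whose projection is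
    \<open>P z\<close>, so the cone condition bounds them by \<open>P z\<close>.\<close>
  have root: "norm \<zeta> \<le> C2 * norm (P z)"
    if z: "z \<in> T" "z \<in> ball 0 \<delta>" "P z \<in> ball 0 \<delta>" "n g z = k" and \<zeta>: "\<zeta> \<in># Z z" for z \<zeta>
  proof -
    let ?a = "P z + \<zeta> *s w"
    have "\<zeta> \<in> ball 0 r" using \<zeta> M[OF z(2)] by (auto simp: Z_def)
    then have "?a \<in> ball 0 R" using inb[of z \<zeta>] z * by simp
    moreover have "?a \<in> T" by (intro vec.subspace_add[OF T] vec.subspace_scale[OF T] PT z wT)
    moreover have "f ?a = 0" if "f \<in> F" for f by (rule onA[OF z(4) \<zeta> that PT[OF z(1)] z(3)])
    ultimately have "norm ?a \<le> K * norm (?a - \<tau> ?a *s w)" using cone by blast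
    then have "norm ?a \<le> K * norm (P z)" using Pline[OF \<tau>P[of z], of \<zeta>] by (simp add: P_eq[of ?a])
    moreover have "norm (\<zeta> *s w) \<le> norm ?a + norm (P z)"
      using norm_triangle_ineq4[of ?a "P z"] by simp
    ultimately have "norm \<zeta> * norm w \<le> (K + 1) * norm (P z)" by (simp add: norm_smult_vec algebra_simps)
    then show ?thesis using nw by (simp add: C2_def field_simps)
  qed
  \<comment> \<open>1 and \<open>CP\<close> keep \<open>z\<close> and \<open>P z\<close> in the
    ball, \<open>CT + C2 * CP\<close> bounds \<open>\<tau> z - \<zeta>\<close>, \<open>C2\<close>
    gives the lower bound, and \<open>CT * \<delta> / r\<close> puts \<open>\<tau> z\<close> into
    the disc where roots are counted.\<close>
  define C where "C = max (max 1 CP) (max (CT + C2 * CP) (max C2 (CT * \<delta> / r)))"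
  have C: "1 \<le> C" "CP \<le> C" "CT + C2 * CP \<le> C" "C2 \<le> C" "CT * \<delta> / r \<le> C" by (auto simp: C_def)
  have small: "z \<in> ball 0 \<delta>" "P z \<in> ball 0 \<delta>" "norm (\<tau> z) < r" if "norm z < \<delta> / C" for z
  proof -
    have z: "C * norm z < \<delta>" using that C(1) by (simp add: field_simps)
    have "1 * norm z \<le> C * norm z" by (intro mult_right_mono C) simp
    then show "z \<in> ball 0 \<delta>" using z by simp
    have "CP * norm z \<le> C * norm z" by (intro mult_right_mono C) simp
    then show "P z \<in> ball 0 \<delta>" using CP(2)[of z] z by simp
    have "CT * \<delta> \<le> C * r" using C(5) *(4) by (simp add: field_simps)
    have "(CT * norm z) * \<delta> = (CT * \<delta>) * norm z" by simp
    also have "\<dots> \<le> (C * r) * norm z" by (intro mult_right_mono \<open>CT * \<delta> \<le> C * r\<close>) simp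
    also have "\<dots> = r * (C * norm z)" by simp
    also have "\<dots> < r * \<delta>" using z *(4) by simp
    finally have "CT * norm z < r" using *(1) by simp
    then show "norm (\<tau> z) < r" using CT(2)[of z] by simp
  qed
  show ?thesis
  proof (rule that[of \<delta> c H C u0 q])
    show "c (z - \<tau> z *s w) = c z" for z by (simp add: c_def P_eq[symmetric] MP PP)
    have "P u0 = u0" by (rule Pid[OF u0(2)])
    show "c u0 \<noteq> 0" using top(1)[of u0] Gnz[of u0] k_def by simp
    fix z assume z: "z \<in> T" "norm z < \<delta> / C"
    have nz: "n g z \<le> k" using nle[OF g PT[OF z(1)] \<tau>P small(2)[OF z(2)]] by (simp add: nP)
    have lo: "0 \<le> max 0 (norm (\<tau> z) - C * norm (z - \<tau> z *s w))" by simp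
    show "norm (H z) \<le> norm (c z) * (C * norm z) ^ q"
    proof (cases "n g z = k")
      case True
      have "norm (\<tau> z - \<zeta>) \<le> C * norm z" if "\<zeta> \<in># Z z" for \<zeta>
      proof -
        have "norm (\<tau> z - \<zeta>) \<le> norm (\<tau> z) + norm \<zeta>" by (rule norm_triangle_ineq4)
        also have "norm \<zeta> \<le> C2 * norm (P z)" by (rule root[OF z(1) small(1,2)[OF z(2)] True that])
        also have "C2 * norm (P z) \<le> C2 * (CP * norm z)" using C2 CP(2)[of z] by simp
        finally have "norm (\<tau> z - \<zeta>) \<le> (CT + C2 * CP) * norm z" using CT(2)[of z] by (simp add: algebra_simps)
        also have "\<dots> \<le> C * norm z" by (intro mult_right_mono C) simp
        finally show ?thesis .
      qed
      from prod_mset_bounds(1)[of "Z z" "\<lambda>\<zeta>. \<tau> z - \<zeta>", OF this]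
      have "norm (\<Prod>\<zeta>\<in>#Z z. \<tau> z - \<zeta>) \<le> (C * norm z) ^ q" by (simp add: Zsize[OF True small(1)[OF z(2)]])
      then show ?thesis unfolding top[OF True] norm_mult by (intro mult_left_mono) auto
    qed (use nz low in auto)
    show "norm (c z) * (max 0 (norm (\<tau> z) - C * norm (z - \<tau> z *s w))) ^ q \<le> norm (H z)"
    proof (cases "n g z = k")
      case True
      have "max 0 (norm (\<tau> z) - C * norm (z - \<tau> z *s w)) \<le> norm (\<tau> z - \<zeta>)" if "\<zeta> \<in># Z z" for \<zeta>
      proof -
        have "norm \<zeta> \<le> C2 * norm (P z)" by (rule root[OF z(1) small(1,2)[OF z(2)] True that])
        also have "\<dots> \<le> C * norm (P z)" by (intro mult_right_mono C) simp
        finally show ?thesis using norm_triangle_ineq2[of "\<tau> z" \<zeta>] by (simp add: P_def)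
      qed
      from prod_mset_bounds(2)[of "Z z" _ "\<lambda>\<zeta>. \<tau> z - \<zeta>", OF this lo]
      have "(max 0 (norm (\<tau> z) - C * norm (z - \<tau> z *s w))) ^ q \<le> norm (\<Prod>\<zeta>\<in>#Z z. \<tau> z - \<zeta>)"
        by (simp add: Zsize[OF True small(1)[OF z(2)]])
      then show ?thesis unfolding top[OF True] norm_mult by (intro mult_left_mono) auto
    qed (use nz low in auto)
    show "H z = 0" if "\<forall>f\<in>F. f z = 0"
    proof (cases "n g z = k")
      case True
      have 0: "f z = 0" if "f \<in> F" for f using \<open>\<forall>f\<in>F. f z = 0\<close> that by blast
      \<comment> \<open>A point \<open>z\<close> of the set sits on its own line at the parameter
        \<open>\<tau> z\<close>, which is thus a root where \<open>g\<close> vanishes; one factor of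
        \<open>H z\<close> is 0.\<close>
      have zz: "P z + \<tau> z *s w = z" by (simp add: P_def)
      have "\<tau> z \<in># M z" using M[OF small(1)[OF z(2)]] small(3)[OF z(2)] 0[OF f1(1)] by (simp add: zz)
      moreover have "g z = 0" by (rule lspan_zero[OF g 0])
      ultimately have "\<tau> z \<in># Z z" by (simp add: Z_def zz)
      then show ?thesis unfolding top[OF True] by (force simp: prod_mset_zero_iff)
    qed (use nz low in auto)
  qed (use * \<delta>0 ghc ghH C u0 in auto)
qed

text \<open>The nonzero points of \<open>c\<close> are dense in \<open>T\<close> near 0. This
  carries estimates obtained by cancelling \<open>c\<close> over to its zeros.\<close>

lemma le_by_density:
  fixes c :: "complex ^ 'n \<Rightarrow> complex" and \<phi> \<psi> :: "complex ^ 'n \<Rightarrow> real"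
  assumes c: "ghol c (ball 0 R)" and T: "vec.subspace T" and u0: "u0 \<in> T" "u0 \<in> ball 0 R" "c u0 \<noteq> 0"
    and \<delta>: "\<delta> \<le> R" and cont: "continuous_on (ball 0 \<delta>) \<phi>" "continuous_on (ball 0 \<delta>) \<psi>"
    and le: "\<And>z. z \<in> T \<Longrightarrow> z \<in> ball 0 \<delta> \<Longrightarrow> c z \<noteq> 0 \<Longrightarrow> \<phi> z \<le> \<psi> z"
    and z: "z \<in> T" "z \<in> ball 0 \<delta>"
  shows "\<phi> z \<le> \<psi> z"
proof (rule ccontr)
  assume neg: "\<not> \<phi> z \<le> \<psi> z"
  have cd: "continuous_on (ball 0 \<delta>) (\<lambda>z. \<phi> z - \<psi> z)" by (intro continuous_intros cont)
  have "open (ball 0 \<delta> \<inter> (\<lambda>z. \<phi> z - \<psi> z) -` {0<..})"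
    by (rule continuous_open_preimage[OF cd]) auto
  moreover have "z \<in> ball 0 \<delta> \<inter> (\<lambda>z. \<phi> z - \<psi> z) -` {0<..}" using neg z by simp
  ultimately obtain e where e: "e > 0" "ball z e \<subseteq> ball 0 \<delta> \<inter> (\<lambda>z. \<phi> z - \<psi> z) -` {0<..}"
    using openE by blast
  have "z \<in> ball 0 R" using z(2) \<delta> by simp
  from ghol_nonzero_near[OF c T z(1) this u0 e(1)] obtain y where y: "y \<in> T" "dist z y < e" "c y \<noteq> 0" by blast
  have "y \<in> ball z e" using y(2) by simp
  then have "y \<in> ball 0 \<delta>" "\<phi> y > \<psi> y" using e(2) by auto
  then show False using le[OF y(1) _ y(3)] by linarith
qed

text \<open>The last two properties of \<open>f\<close> say that its lowest homogeneous part has degree \<open>q\<close> and does not vanish at \<open>w\<close>.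
  Away from the zero set of \<open>c\<close> the generic part does the job; the rest is projected to a
  lower-dimensional space.\<close>

lemma cone_function:
  fixes w :: "complex ^ 'n"
  assumes "vec.subspace T" "w \<in> T" "Vector_Spaces.linear (*s) (*) \<tau>" "\<tau> w = 1"
    and "0 < R" "\<And>f. f \<in> F \<Longrightarrow> ghol f (ball 0 R)" "0 < K"
    and "\<And>a. a \<in> T \<Longrightarrow> a \<in> ball 0 R \<Longrightarrow> (\<And>f. f \<in> F \<Longrightarrow> f a = 0) \<Longrightarrow> norm a \<le> K * norm (a - \<tau> a *s w)"
  shows "\<exists>f \<delta> C q. 0 < \<delta> \<and> ghol f (ball 0 \<delta>) \<and> 0 < C \<and>
    (\<forall>a\<in>T. norm a < \<delta> \<longrightarrow> (\<forall>g\<in>F. g a = 0) \<longrightarrow> f a = 0) \<and>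
    (\<forall>z\<in>T. norm z < \<delta> \<longrightarrow> norm (f z) \<le> (C * norm z) ^ q) \<and>
    (\<forall>t. norm (t *s w) < \<delta> \<longrightarrow> norm t ^ q \<le> norm (f (t *s w)))"
  using assms
proof (induction "vec.dim T" arbitrary: T F R K rule: less_induct)
  case less
  note T = less.prems(1) and wT = less.prems(2) and \<tau> = less.prems(3,4) and R = less.prems(5)
    and F = less.prems(6) and K = less.prems(7) and cone = less.prems(8)
  interpret l: Vector_Spaces.linear "(*s)" "(*)" \<tau> by fact
  obtain c H \<delta> C q u0 where \<delta>: "0 < \<delta>" "\<delta> \<le> R" and ghc: "ghol c (ball 0 \<delta>)" and ghH: "ghol H (ball 0 \<delta>)" and C: "0 < C"
    and cP: "\<And>z. c (z - \<tau> z *s w) = c z" and u0: "u0 \<in> T" "\<tau> u0 = 0" "u0 \<in> ball 0 \<delta>" "c u0 \<noteq> 0"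
    and up: "\<And>z. z \<in> T \<Longrightarrow> norm z < \<delta> / C \<Longrightarrow> norm (H z) \<le> norm (c z) * (C * norm z) ^ q"
    and lo: "\<And>z. z \<in> T \<Longrightarrow> norm z < \<delta> / C \<Longrightarrow>
       norm (c z) * (max 0 (norm (\<tau> z) - C * norm (z - \<tau> z *s w))) ^ q \<le> norm (H z)"
    and Hz: "\<And>z. z \<in> T \<Longrightarrow> norm z < \<delta> / C \<Longrightarrow> \<forall>f\<in>F. f z = 0 \<Longrightarrow> H z = 0"
  proof (rule cone_generic_part[OF T wT \<tau> R])
    show "ghol f (ball 0 R)" if "f \<in> F" for f by (rule F[OF that])
    show "norm a \<le> K * norm (a - \<tau> a *s w)"
      if "a \<in> T" "a \<in> ball 0 R" "\<And>f. f \<in> F \<Longrightarrow> f a = 0" for a by (rule cone[OF that(1,2)]) (rule that(3))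
    show "0 < K" by (rule K)
  qed (rule_tac \<delta> = \<delta> and c = c and H = H and C = C in that)
  define Rd where "Rd = min \<delta> (\<delta> / C)"
  have Rd: "0 < Rd" "Rd \<le> \<delta>" "Rd \<le> \<delta> / C" using \<delta> C by (auto simp: Rd_def)
  \<comment> \<open>\<open>ghol_division\<close> needs a direction in \<open>T\<close> on which
    \<open>c\<close> is nonzero within the smaller ball.\<close>
  obtain w2 where w2: "w2 \<in> T" "dist 0 w2 < Rd" "c w2 \<noteq> 0"
  proof -
    have "0 \<in> ball (0 :: complex ^ 'n) \<delta>" using \<delta>(1) by simp
    from ghol_nonzero_near[OF ghc T vec.subspace_0[OF T] this u0(1,3,4) Rd(1)] show ?thesis using that by blast
  qed
  have sub: "ball (0 :: complex ^ 'n) Rd \<subseteq> ball 0 \<delta>" using Rd by auto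
  have pre: "1 *s w2 \<in> ball 0 Rd" "c (1 *s w2) \<noteq> 0" using w2 by auto
  have bd: "norm (H z) \<le> (C * Rd) ^ q * norm (c z)" if "z \<in> T" "z \<in> ball 0 Rd" for z
  proof -
    have "norm (H z) \<le> norm (c z) * (C * norm z) ^ q" using that Rd by (intro up) auto
    also have "\<dots> \<le> norm (c z) * (C * Rd) ^ q" using that C by (intro mult_left_mono power_mono) auto
    finally show ?thesis by (simp add: mult.commute)
  qed
  obtain f0 \<delta>1 where \<delta>1: "0 < \<delta>1" "\<delta>1 \<le> Rd" and f0: "ghol f0 (ball 0 \<delta>1)"
    and Hcf: "\<And>z. z \<in> T \<Longrightarrow> z \<in> ball 0 \<delta>1 \<Longrightarrow> H z = c z * f0 z"
  proof (rule ghol_division[OF ghol_subset[OF ghH sub open_ball] ghol_subset[OF ghc sub open_ball] T w2(1) pre])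
    show "norm (H z) \<le> (C * Rd) ^ q * norm (c z)" if "z \<in> T" "z \<in> ball 0 Rd" for z by (rule bd[OF that])
  qed (rule that)
  have small: "norm z < \<delta> / C" if "z \<in> ball 0 \<delta>1" for z :: "complex ^ 'n" using that \<delta>1 Rd by simp
  have contf: "continuous_on (ball 0 \<delta>1) (\<lambda>z. norm (f0 z))"
    by (intro continuous_on_norm ghol_continuous[OF f0])
  have Pcont: "continuous_on X (\<lambda>z. z - \<tau> z *s w)" for X
    by (rule linear_continuous_on[OF clinear_scaleR[OF linear_proj[OF \<tau>(1)]]])
  have \<tau>cont: "continuous_on X \<tau>" for X
    by (rule linear_continuous_on[OF clinear_functional_bounded[OF \<tau>(1)]])
  have \<delta>1\<delta>: "\<delta>1 \<le> \<delta>" using \<delta>1 Rd by simp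
  have fup: "norm (f0 z) \<le> (C * norm z) ^ q" if "z \<in> T" "z \<in> ball 0 \<delta>1" for z
  proof (rule le_by_density[OF ghc T u0(1,3,4) \<delta>1\<delta> contf _ _ that])
    fix z assume z: "z \<in> T" "z \<in> ball 0 \<delta>1" "c z \<noteq> 0"
    have "norm (c z) * norm (f0 z) \<le> norm (c z) * (C * norm z) ^ q"
      using up[OF z(1) small[OF z(2)]] Hcf[OF z(1,2)] by (simp add: norm_mult)
    then show "norm (f0 z) \<le> (C * norm z) ^ q" using z(3) by simp
  qed (intro continuous_intros)
  have flo: "(max 0 (norm (\<tau> z) - C * norm (z - \<tau> z *s w))) ^ q \<le> norm (f0 z)" if "z \<in> T" "z \<in> ball 0 \<delta>1" for z
  proof (rule le_by_density[OF ghc T u0(1,3,4) \<delta>1\<delta> _ contf _ that])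
    fix z assume z: "z \<in> T" "z \<in> ball 0 \<delta>1" "c z \<noteq> 0"
    have "norm (c z) * (max 0 (norm (\<tau> z) - C * norm (z - \<tau> z *s w))) ^ q \<le> norm (c z) * norm (f0 z)"
      using lo[OF z(1) small[OF z(2)]] Hcf[OF z(1,2)] by (simp add: norm_mult)
    then show "(max 0 (norm (\<tau> z) - C * norm (z - \<tau> z *s w))) ^ q \<le> norm (f0 z)" using z(3) by simp
  qed (intro continuous_intros Pcont \<tau>cont)
  have f0z: "f0 z = 0" if "z \<in> T" "z \<in> ball 0 \<delta>1" "\<forall>f\<in>F. f z = 0" "c z \<noteq> 0" for z
    using Hz[OF that(1) small[OF that(2)] that(3)] Hcf[OF that(1,2)] that(4) by simp
  have f0w: "norm t ^ q \<le> norm (f0 (t *s w))" if "norm (t *s w) < \<delta>1" for t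
    using flo[OF vec.subspace_scale[OF T wT], of t] that by (simp add: l.scale \<tau>(2))
  show ?case
  \<comment> \<open>If \<open>c 0 \<noteq> 0\<close>, then \<open>c\<close> has no zeros near 0 and
    \<open>f0\<close> alone suffices. Otherwise the points of the set with \<open>c = 0\<close>
    remain, and the induction hypothesis is applied to their projection.\<close>
  proof (cases "c 0 = 0")
    case False
    have "isCont c 0" using ghol_continuous[OF ghc] \<delta> by (simp add: continuous_on_eq_continuous_at)
    from continuous_at_avoid[OF this False] obtain e where e: "e > 0" "\<And>y. dist 0 y < e \<Longrightarrow> c y \<noteq> 0" by blast
    define \<delta>2 where "\<delta>2 = min e \<delta>1"
    have \<delta>2: "0 < \<delta>2" "\<delta>2 \<le> e" "\<delta>2 \<le> \<delta>1" using e \<delta>1 by (auto simp: \<delta>2_def)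
    show ?thesis
    proof (intro exI conjI ballI allI impI)
      show "ghol f0 (ball 0 \<delta>2)" by (rule ghol_subset[OF f0]) (use \<delta>2 in auto)
      show "f0 a = 0" if "a \<in> T" "norm a < \<delta>2" "\<forall>g\<in>F. g a = 0" for a
        by (rule f0z) (use that e(2) \<delta>2 in auto)
      show "norm (f0 z) \<le> (C * norm z) ^ q" if "z \<in> T" "norm z < \<delta>2" for z by (rule fup) (use that \<delta>2 in auto)
      show "norm t ^ q \<le> norm (f0 (t *s w))" if "norm (t *s w) < \<delta>2" for t by (rule f0w) (use that \<delta>2 in auto)
    qed (use \<delta>2 C in auto)
  next
    case True
    define P where "P = (\<lambda>z. z - \<tau> z *s w)"
    have P_eq: "P z = z - \<tau> z *s w" for z by (simp add: P_def)
    interpret Pl: Vector_Spaces.linear "(*s)" "(*s)" P unfolding P_def by (rule linear_proj[OF \<tau>(1)])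
    have \<tau>P: "\<tau> (P z) = 0" for z by (simp add: P_def l.diff l.scale \<tau>(2))
    have Pid: "P u = u" if "\<tau> u = 0" for u using that by (simp add: P_def)
    have Pw: "P w = 0" by (simp add: P_def \<tau>(2))
    obtain CP where CP0: "0 < CP" "\<And>z. norm (z - \<tau> z *s w) \<le> CP * norm z"
      by (rule linear_proj_bound[OF \<tau>(1)]) (rule that)
    have CP: "0 < CP" "\<And>z. norm (P z) \<le> CP * norm z" using CP0 by (simp_all add: P_eq)
    define Tp where "Tp = {z\<in>T. \<tau> z = 0}"
    have Tp: "vec.subspace Tp" unfolding Tp_def by (rule subspace_kernel[OF \<tau>(1) T])
    have PT: "P z \<in> Tp" if "z \<in> T" for z
      unfolding Tp_def using \<tau>P by (auto simp: P_def intro!: vec.subspace_diff[OF T] vec.subspace_scale[OF T] that wT)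
    have u0p: "u0 \<in> Tp" using u0 by (simp add: Tp_def)
    \<comment> \<open>Within the kernel of \<tau> the zeros of \<open>c\<close> avoid a cone about
      \<open>w'\<close>. Since \<open>c\<close> depends on \<open>P z\<close> only, projecting its
      zeros along \<open>w'\<close> loses no size of \<open>P z\<close> beyond a factor.\<close>
    obtain w' \<zeta> \<tau>' K' \<delta>' where w': "w' \<in> Tp" and \<zeta>: "\<zeta> *s w' \<in> ball 0 \<delta>" "c (\<zeta> *s w') \<noteq> 0"
      and \<tau>': "Vector_Spaces.linear (*s) (*) \<tau>'" "\<tau>' w' = 1" and K': "0 < K'" "0 < \<delta>'"
      and cone': "\<And>a. a \<in> Tp \<Longrightarrow> norm a < \<delta>' \<Longrightarrow> c a = 0 \<Longrightarrow> norm a \<le> K' * norm (a - \<tau>' a *s w')"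
      by (rule vanishing_direction[OF ghc Tp u0p u0(3,4) True]) (rule that)
    interpret l': Vector_Spaces.linear "(*s)" "(*)" \<tau>' by fact
    \<comment> \<open>Composition with \<open>P\<close> makes \<sigma> vanish on \<open>w\<close>,
      so \<open>w\<close> stays in the hyperplane \<open>T2\<close> and remains the distinguished
      direction in the induction.\<close>
    define \<sigma> where "\<sigma> = (\<lambda>z. \<tau>' (P z))"
    have \<sigma>: "Vector_Spaces.linear (*s) (*) \<sigma>"
      unfolding \<sigma>_def by unfold_locales (simp_all add: Pl.add Pl.scale l'.add l'.scale algebra_simps)
    interpret ls: Vector_Spaces.linear "(*s)" "(*)" \<sigma> by (rule \<sigma>)
    have w'T: "w' \<in> T" "\<tau> w' = 0" "P w' = w'" using w' Pid by (auto simp: Tp_def)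
    have \<sigma>w: "\<sigma> w' = 1" "\<sigma> w = 0" by (simp_all add: \<sigma>_def w'T \<tau>' Pw l'.zero)
    define T2 where "T2 = {z\<in>T. \<sigma> z = 0}"
    have T2: "vec.subspace T2" unfolding T2_def by (rule subspace_kernel[OF \<sigma> T])
    have dim: "vec.dim T2 < vec.dim T" unfolding T2_def by (rule dim_kernel_less[OF \<sigma> T w'T(1)]) (simp add: \<sigma>w)
    have wT2: "w \<in> T2" using wT by (simp add: T2_def \<sigma>w)
    define N where "N = 1 + norm w'"
    have N: "0 < N" unfolding N_def using norm_ge_zero[of w'] by linarith
    \<comment> \<open>Small enough that the lift \<open>a = u + \<xi> *s w'\<close> of a projected
      point has \<open>norm (P a) < \<delta>'\<close>, where \<open>cone'\<close> applies.\<close>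
    define \<epsilon> where "\<epsilon> = \<delta>' / (2 * CP * N)"
    have \<epsilon>: "0 < \<epsilon>" "CP * (\<epsilon> * N) = \<delta>' / 2" using K' CP N by (simp_all add: \<epsilon>_def)
    have FF: "ghol f (ball 0 \<delta>)" if "f \<in> F" for f by (rule ghol_subset[OF F[OF that]]) (use \<delta> in auto)
    obtain \<delta>3 r3 G where *: "0 < \<delta>3" "\<delta>3 < \<epsilon>" "0 < r3" "r3 < \<epsilon>"
      and inb: "\<And>u \<zeta>. u \<in> ball 0 \<delta>3 \<Longrightarrow> \<zeta> \<in> ball 0 r3 \<Longrightarrow> u + \<zeta> *s w' \<in> ball 0 \<delta>"
      and G: "\<And>N. N \<in> G \<Longrightarrow> ghol N (ball 0 \<delta>3)"
      and Giff: "\<And>u. u \<in> ball 0 \<delta>3 \<Longrightarrow> (\<forall>N\<in>G. N u = 0) \<longleftrightarrow>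
        (\<exists>\<zeta>\<in>ball 0 r3. c (u + \<zeta> *s w') = 0 \<and> (\<forall>f\<in>F. f (u + \<zeta> *s w') = 0))"
    proof (rule analytic_projection[OF ghc _ \<zeta> \<epsilon>(1)])
      show "ghol f (ball 0 \<delta>)" if "f \<in> F" for f by (rule FF[OF that])
    qed (rule that)
    obtain C3 where C3: "0 < C3" "\<And>z. norm (z - \<sigma> z *s w') \<le> C3 * norm z"
      by (rule linear_proj_bound[OF \<sigma>]) (rule that)
    obtain C4 where C4: "0 < C4" "\<And>z. norm (\<sigma> z) \<le> C4 * norm z" by (rule linear_functional_bound[OF \<sigma>]) (rule that)
    have K2: "0 < C3 * (K * K')" using C3 K K' by simp
    \<comment> \<open>The cone condition survives projection: the size of \<open>u\<close> is
      bounded by that of its lift \<open>a\<close>, that of \<open>a\<close> by \<open>P a\<close>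
      through \<open>cone\<close>, and that of \<open>P a\<close> by \<open>P u\<close> through
      \<open>cone'\<close>.\<close>
    have cone2: "norm u \<le> C3 * (K * K') * norm (u - \<tau> u *s w)"
      if u: "u \<in> T2" "u \<in> ball 0 \<delta>3" and Gu: "\<And>N. N \<in> G \<Longrightarrow> N u = 0" for u
    proof -
      from Giff[OF u(2)] Gu obtain \<xi> where \<xi>: "\<xi> \<in> ball 0 r3" "c (u + \<xi> *s w') = 0" "\<And>f. f \<in> F \<Longrightarrow> f (u + \<xi> *s w') = 0" by blast
      define a where "a = u + \<xi> *s w'"
      have uT: "u \<in> T" "\<sigma> u = 0" using u by (simp_all add: T2_def)
      have aT: "a \<in> T" unfolding a_def by (intro vec.subspace_add[OF T] vec.subspace_scale[OF T] uT w'T)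
      have "a \<in> ball 0 \<delta>" unfolding a_def by (rule inb[OF u(2) \<xi>(1)])
      then have aR: "a \<in> ball 0 R" using \<delta>(2) by simp
      have \<sigma>a: "\<sigma> a = \<xi>" by (simp add: a_def ls.add ls.scale uT \<sigma>w)
      have ua: "u = a - \<sigma> a *s w'" by (simp add: \<sigma>a) (simp add: a_def)
      have "norm a \<le> K * norm (P a)" using cone[OF aT aR] \<xi>(3) by (simp add: a_def P_eq)
      also have "norm (P a) \<le> K' * norm (P a - \<tau>' (P a) *s w')"
      proof (rule cone'[OF PT[OF aT]])
        have "norm a \<le> norm u + norm (\<xi> *s w')" unfolding a_def by (rule norm_triangle_ineq)
        also have "norm (\<xi> *s w') \<le> \<epsilon> * norm w'" unfolding norm_smult_vec using \<xi>(1) * by (intro mult_right_mono) auto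
        finally have "norm a < \<epsilon> * N" using u(2) * by (simp add: N_def algebra_simps)
        then have "CP * norm a < \<delta>' / 2" unfolding \<epsilon>(2)[symmetric] using CP(1) by simp
        then show "norm (P a) < \<delta>'" using CP(2)[of a] K'(2) by linarith
        show "c (P a) = 0" using \<xi>(2) cP[of a] by (simp add: P_eq a_def)
      qed
      also have "P a - \<tau>' (P a) *s w' = P u"
        using \<sigma>a by (simp add: \<sigma>_def) (simp add: a_def Pl.add Pl.scale w'T)
      finally have "norm a \<le> K * (K' * norm (P u))" using K by simp
      moreover have "norm u \<le> C3 * norm a" using C3(2)[of a] ua by simp
      ultimately have "norm u \<le> C3 * (K * (K' * norm (P u)))" using C3(1) by (meson mult_left_mono less_imp_le order_trans)
      then show ?thesis by (simp add: P_eq mult.assoc)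
    qed
    have "\<exists>f \<delta> C q. 0 < \<delta> \<and> ghol f (ball 0 \<delta>) \<and> 0 < C \<and>
      (\<forall>a\<in>T2. norm a < \<delta> \<longrightarrow> (\<forall>g\<in>G. g a = 0) \<longrightarrow> f a = 0) \<and>
      (\<forall>z\<in>T2. norm z < \<delta> \<longrightarrow> norm (f z) \<le> (C * norm z) ^ q) \<and>
      (\<forall>t. norm (t *s w) < \<delta> \<longrightarrow> norm t ^ q \<le> norm (f (t *s w)))"
    proof (rule less.hyps[OF dim T2 wT2 \<tau> *(1) _ K2])
      show "ghol N (ball 0 \<delta>3)" if "N \<in> G" for N by (rule G[OF that])
      show "norm u \<le> C3 * (K * K') * norm (u - \<tau> u *s w)"
        if "u \<in> T2" "u \<in> ball 0 \<delta>3" "\<And>N. N \<in> G \<Longrightarrow> N u = 0" for u by (rule cone2[OF that(1,2)]) (rule that(3))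
    qed
    then obtain f2 \<delta>4 C5 q2 where f20: "0 < \<delta>4 \<and> ghol f2 (ball 0 \<delta>4) \<and> 0 < C5 \<and>
      (\<forall>a\<in>T2. norm a < \<delta>4 \<longrightarrow> (\<forall>g\<in>G. g a = 0) \<longrightarrow> f2 a = 0) \<and>
      (\<forall>z\<in>T2. norm z < \<delta>4 \<longrightarrow> norm (f2 z) \<le> (C5 * norm z) ^ q2) \<and>
      (\<forall>t. norm (t *s w) < \<delta>4 \<longrightarrow> norm t ^ q2 \<le> norm (f2 (t *s w)))" by (elim exE)
    then have f2: "0 < \<delta>4" "ghol f2 (ball 0 \<delta>4)" "0 < C5"
      "\<And>a. a \<in> T2 \<Longrightarrow> norm a < \<delta>4 \<Longrightarrow> (\<And>g. g \<in> G \<Longrightarrow> g a = 0) \<Longrightarrow> f2 a = 0"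
      "\<And>z. z \<in> T2 \<Longrightarrow> norm z < \<delta>4 \<Longrightarrow> norm (f2 z) \<le> (C5 * norm z) ^ q2"
      "\<And>t. norm (t *s w) < \<delta>4 \<Longrightarrow> norm t ^ q2 \<le> norm (f2 (t *s w))"
      by simp_all
    define Q where "Q = (\<lambda>z. z - \<sigma> z *s w')"
    have Qlin: "Vector_Spaces.linear (*s) (*s) Q" unfolding Q_def by (rule linear_proj[OF \<sigma>])
    have QT: "Q z \<in> T2" if "z \<in> T" for z
      unfolding T2_def Q_def using that w'T
      by (auto simp: ls.diff ls.scale \<sigma>w intro!: vec.subspace_diff[OF T] vec.subspace_scale[OF T])
    have Qb: "norm (Q z) \<le> C3 * norm z" for z using C3(2) by (simp add: Q_def)
    have Qw: "Q (t *s w) = t *s w" for t by (simp add: Q_def ls.scale \<sigma>w)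
    define \<delta>5 where "\<delta>5 = Min {\<delta>1, \<delta>4 / C3, \<delta>3 / C3, r3 / C4, \<delta>4}"
    have \<delta>5: "0 < \<delta>5" "\<delta>5 \<le> \<delta>1" "\<delta>5 \<le> \<delta>4 / C3" "\<delta>5 \<le> \<delta>3 / C3" "\<delta>5 \<le> r3 / C4" "\<delta>5 \<le> \<delta>4"
      using \<delta>1 f2(1) C3(1) C4(1) * by (auto simp: \<delta>5_def)
    have b4: "norm (Q z) < \<delta>4" "norm (Q z) < \<delta>3" "norm (\<sigma> z) < r3" if "norm z < \<delta>5" for z
    proof -
      have "norm z < \<delta>4 / C3" "norm z < \<delta>3 / C3" "norm z < r3 / C4" using that \<delta>5 by linarith+
      then have "C3 * norm z < \<delta>4" "C3 * norm z < \<delta>3" "C4 * norm z < r3"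
        using C3(1) C4(1) by (simp_all add: pos_less_divide_eq mult.commute)
      then show "norm (Q z) < \<delta>4" "norm (Q z) < \<delta>3" "norm (\<sigma> z) < r3" using Qb[of z] C4(2)[of z] by linarith+
    qed
    define C6 where "C6 = max C (C5 * C3)"
    have C6: "0 < C6" "C \<le> C6" "C5 * C3 \<le> C6" using C by (auto simp: C6_def)
    show ?thesis
    proof (intro exI conjI ballI allI impI)
      \<comment> \<open>In the product, \<open>f0\<close> kills the points of the set with
        \<open>c \<noteq> 0\<close>, and \<open>f2\<close> kills the projections of the others. As
        \<open>Q\<close> fixes the line of \<open>w\<close>, the lower bounds multiply and the
        orders add.\<close>
      have "ghol (\<lambda>z. f2 (Q z)) (ball 0 \<delta>5)"
        by (rule ghol_comp_clinear[OF f2(2) open_ball Qlin]) (use b4 in simp)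
      moreover have "ghol f0 (ball 0 \<delta>5)" by (rule ghol_subset[OF f0]) (use \<delta>5 in auto)
      ultimately show "ghol (\<lambda>z. f0 z * f2 (Q z)) (ball 0 \<delta>5)" by (intro ghol_mult)
      show "f0 a * f2 (Q a) = 0" if a: "a \<in> T" "norm a < \<delta>5" "\<forall>g\<in>F. g a = 0" for a
      proof (cases "c a = 0")
        case True
        have eq: "Q a + \<sigma> a *s w' = a" by (simp add: Q_def)
        have "\<forall>N\<in>G. N (Q a) = 0"
          using Giff[of "Q a"] b4[OF a(2)] True a(3) by (auto simp: eq intro!: bexI[of _ "\<sigma> a"])
        then have "f2 (Q a) = 0" by (intro f2(4) QT a(1) b4(1) a(2)) auto
        then show ?thesis by simp
      next
        case False
        have "f0 a = 0" by (rule f0z) (use a \<delta>5 False in auto)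
        then show ?thesis by simp
      qed
      show "norm (f0 z * f2 (Q z)) \<le> (C6 * norm z) ^ (q + q2)" if z: "z \<in> T" "norm z < \<delta>5" for z
      proof -
        have "norm (f0 z) \<le> (C * norm z) ^ q" by (rule fup) (use z \<delta>5 in auto)
        also have "\<dots> \<le> (C6 * norm z) ^ q" using C C6 by (intro power_mono mult_right_mono) auto
        finally have 1: "norm (f0 z) \<le> (C6 * norm z) ^ q" .
        have "norm (f2 (Q z)) \<le> (C5 * norm (Q z)) ^ q2" by (intro f2(5) QT z(1) b4(1) z(2))
        also have "\<dots> \<le> (C6 * norm z) ^ q2"
        proof (intro power_mono)
          have "C5 * norm (Q z) \<le> C5 * (C3 * norm z)" using f2(3) Qb[of z] by simp
          also have "\<dots> = (C5 * C3) * norm z" by simp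
          also have "\<dots> \<le> C6 * norm z" by (intro mult_right_mono C6) simp
          finally show "C5 * norm (Q z) \<le> C6 * norm z" .
        qed (use f2(3) in simp)
        finally have 2: "norm (f2 (Q z)) \<le> (C6 * norm z) ^ q2" .
        show ?thesis unfolding norm_mult power_add by (intro mult_mono 1 2) (use C6 in auto)
      qed
      show "norm t ^ (q + q2) \<le> norm (f0 (t *s w) * f2 (Q (t *s w)))" if t: "norm (t *s w) < \<delta>5" for t
        unfolding Qw norm_mult power_add
        by (intro mult_mono f0w f2(6)) (use t \<delta>5 in auto)
    qed (use \<delta>5 C6 in auto)
  qed
qed

section \<open>Nonzero tangent vectors as limits of rescaled points\<close>

lemma LD_starI_scaled:
  fixes v :: "complex ^ 'n"
  assumes t: "t \<longlonglongrightarrow> 0" "\<And>i. t i \<noteq> 0" and b: "b \<longlonglongrightarrow> v" "v \<noteq> 0" and A: "\<And>i. t i *s b i \<in> A"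
  shows "v \<in> LD_star A"
proof -
  have "\<forall>\<^sub>F i in sequentially. b i \<noteq> 0" using tendsto_imp_eventually_ne[OF b] .
  then obtain m where m: "\<And>i. i \<ge> m \<Longrightarrow> b i \<noteq> 0" by (auto simp: eventually_sequentially)
  define s where "s = (\<lambda>i. t (i + m))"
  define b' where "b' = (\<lambda>i. b (i + m))"
  have s: "s \<longlonglongrightarrow> 0" "b' \<longlonglongrightarrow> v" unfolding s_def b'_def by (intro LIMSEQ_ignore_initial_segment t b)+
  have nz: "s i \<noteq> 0" "b' i \<noteq> 0" "s i *s b' i \<in> A" for i using m[of "i + m"] t(2) A by (auto simp: s_def b'_def)
  have "(\<lambda>i. s i *s b' i) \<longlonglongrightarrow> 0 *s v" by (intro tendsto_intros s)
  moreover have "(\<lambda>i. inverse (s i) *s (s i *s b' i)) \<longlonglongrightarrow> v" using s(2) nz(1) by simp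
  moreover have "s i *s b' i \<in> A - {0}" for i using nz[of i] by simp
  ultimately show ?thesis
    unfolding LD_star_def by (auto intro!: exI[of _ "\<lambda>i. inverse (s i)"] exI[of _ "\<lambda>i. s i *s b' i"])
qed

text \<open>Since \<open>a i\<close> tends to 0 while \<open>c i *s a i\<close> tends to
  \<open>y \<noteq> 0\<close>, the multipliers are eventually nonzero and tend to infinity; their
  inverses are the scales \<open>t\<close>.\<close>

lemma LD_starE_scaled:
  fixes y :: "complex ^ 'n"
  assumes "y \<in> LD_star A" "y \<noteq> 0"
  obtains t b where "t \<longlonglongrightarrow> 0" "b \<longlonglongrightarrow> y" "\<And>i. t i \<noteq> 0" "\<And>i. t i *s b i \<in> A"
proof -
  obtain c a where ca: "\<And>i. a i \<in> A - {0}" "a \<longlonglongrightarrow> 0" "(\<lambda>i. c i *s a i) \<longlonglongrightarrow> y"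
    using assms(1) by (auto simp: LD_star_def)
  have "\<forall>\<^sub>F i in sequentially. c i *s a i \<noteq> 0" by (rule tendsto_imp_eventually_ne[OF ca(3) assms(2)])
  then obtain m where m: "\<And>i. i \<ge> m \<Longrightarrow> c i *s a i \<noteq> 0" by (auto simp: eventually_sequentially)
  have cnz: "c (i + m) \<noteq> 0" for i using m[of "i + m"] by auto
  have anz: "norm (a i) \<noteq> 0" for i using ca(1)[of i] by simp
  have "(\<lambda>i. norm (a i) / norm (c i *s a i)) \<longlonglongrightarrow> norm (0 :: complex ^ 'n) / norm y"
    by (intro tendsto_intros ca) (use assms(2) in auto)
  then have "(\<lambda>i. norm (a (i + m)) / norm (c (i + m) *s a (i + m))) \<longlonglongrightarrow> 0"
    by (intro LIMSEQ_ignore_initial_segment) simp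
  moreover have "norm (a (i + m)) / norm (c (i + m) *s a (i + m)) = norm (inverse (c (i + m)))" for i
    unfolding norm_smult_vec norm_inverse using anz[of "i + m"] by (simp add: inverse_eq_divide)
  ultimately have 1: "(\<lambda>i. inverse (c (i + m))) \<longlonglongrightarrow> 0" by (simp add: tendsto_norm_zero_iff)
  have 2: "(\<lambda>i. c (i + m) *s a (i + m)) \<longlonglongrightarrow> y" by (rule LIMSEQ_ignore_initial_segment[OF ca(3)])
  show ?thesis by (rule that[OF 1 2]) (use cnz ca(1) in auto)
qed

text \<open>\<open>G z\<close> below is the lowest homogeneous part \<open>lim f (t *s z) / t ^ q\<close> of the function provided by
  \<open>cone_function\<close>.\<close>

lemma LD_star_separation:
  fixes A :: "(complex ^ 'n) set"
  assumes A: "analytic_germ_at0 A" "0 \<in> A" and v: "v \<notin> LD_star A"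
  obtains G where "ghol G UNIV" "\<And>y. y \<in> LD_star A \<Longrightarrow> G y = 0" "G v \<noteq> 0"
proof (cases "LD_star A = {}")
  case True
  show ?thesis by (rule that[of "\<lambda>_. 1"]) (use True in \<open>auto intro: ghol_const\<close>)
next
  case False
  \<comment> \<open>A nonempty cone contains 0: take all multipliers equal to 0.\<close>
  have v0: "v \<noteq> 0"
  proof
    assume "v = 0"
    from False obtain c a where a: "\<And>i. a i \<in> A - {0}" "a \<longlonglongrightarrow> 0" by (auto simp: LD_star_def)
    then have "0 \<in> LD_star A" unfolding LD_star_def by (auto intro!: exI[of _ "\<lambda>_. 0"] exI[of _ a])
    then show False using v \<open>v = 0\<close> by simp
  qed
  obtain V F where V: "open V" "0 \<in> V" "finite F" "\<And>f. f \<in> F \<Longrightarrow> holo_fun_on f V"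
    "A \<inter> V = {z\<in>V. \<forall>f\<in>F. f z = 0}" using A(1) by (auto simp: analytic_germ_at0_def)
  obtain R0 where R0: "0 < R0" "ball 0 R0 \<subseteq> V" using openE[OF V(1,2)] by blast
  obtain \<tau> where \<tau>: "Vector_Spaces.linear (*s) (*) \<tau>" "\<tau> v = 1" by (rule exists_dual_functional[OF v0])
  have "\<exists>K>0. \<exists>\<delta>>0. \<forall>a\<in>A. norm a < \<delta> \<longrightarrow> norm a \<le> K * norm (a - \<tau> a *s v)"
  proof (rule ccontr)
    assume neg: "\<not> ?thesis"
    obtain t b where tb: "\<And>i. t i \<noteq> 0" "\<And>i. t i *s b i \<in> A" "t \<longlonglongrightarrow> 0" "b \<longlonglongrightarrow> v"
      by (rule cone_condition_or_sequence[OF \<tau> neg]) (rule that)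
    have "v \<in> LD_star A" by (rule LD_starI_scaled[OF tb(3,1,4) v0 tb(2)])
    then show False using v by simp
  qed
  then obtain K \<delta>0 where K: "0 < K" "0 < \<delta>0" "\<And>a. a \<in> A \<Longrightarrow> norm a < \<delta>0 \<Longrightarrow> norm a \<le> K * norm (a - \<tau> a *s v)" by blast
  define R where "R = min R0 \<delta>0"
  have R: "0 < R" "R \<le> R0" "R \<le> \<delta>0" using R0 K by (auto simp: R_def)
  have ghF: "ghol f (ball 0 R)" if "f \<in> F" for f
    by (rule ghol_subset[OF ghol_if_holo_fun_on[OF V(4)[OF that]]]) (use R R0 in auto)
  have AF: "a \<in> A \<longleftrightarrow> (\<forall>f\<in>F. f a = 0)" if "a \<in> ball 0 R" for a
  proof -
    have "a \<in> V" using that R R0(2) by auto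
    then show ?thesis using V(5) by blast
  qed
  have cone: "norm a \<le> K * norm (a - \<tau> a *s v)" if "a \<in> UNIV" "a \<in> ball 0 R" "\<And>f. f \<in> F \<Longrightarrow> f a = 0" for a
    using K(3)[of a] AF[of a] that R by auto
  have "\<exists>f \<delta> C q. 0 < \<delta> \<and> ghol f (ball 0 \<delta>) \<and> 0 < C \<and>
    (\<forall>a\<in>UNIV. norm a < \<delta> \<longrightarrow> (\<forall>g\<in>F. g a = 0) \<longrightarrow> f a = 0) \<and>
    (\<forall>z\<in>UNIV. norm z < \<delta> \<longrightarrow> norm (f z) \<le> (C * norm z) ^ q) \<and>
    (\<forall>t. norm (t *s v) < \<delta> \<longrightarrow> norm t ^ q \<le> norm (f (t *s v)))"
  proof (rule cone_function[OF vec.subspace_UNIV UNIV_I \<tau> R(1) _ K(1)])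
    show "ghol f (ball 0 R)" if "f \<in> F" for f by (rule ghF[OF that])
    show "norm a \<le> K * norm (a - \<tau> a *s v)"
      if "a \<in> UNIV" "a \<in> ball 0 R" "\<And>f. f \<in> F \<Longrightarrow> f a = 0" for a by (rule cone[OF that(1,2)]) (rule that(3))
  qed
  then obtain f \<delta> C q where "0 < \<delta> \<and> ghol f (ball 0 \<delta>) \<and> 0 < C \<and>
    (\<forall>a\<in>UNIV. norm a < \<delta> \<longrightarrow> (\<forall>g\<in>F. g a = 0) \<longrightarrow> f a = 0) \<and>
    (\<forall>z\<in>UNIV. norm z < \<delta> \<longrightarrow> norm (f z) \<le> (C * norm z) ^ q) \<and>
    (\<forall>t. norm (t *s v) < \<delta> \<longrightarrow> norm t ^ q \<le> norm (f (t *s v)))" by (elim exE)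
  then have f: "0 < \<delta>" "ghol f (ball 0 \<delta>)" "0 < C"
    "\<And>a. norm a < \<delta> \<Longrightarrow> \<forall>g\<in>F. g a = 0 \<Longrightarrow> f a = 0"
    "\<And>z. norm z < \<delta> \<Longrightarrow> norm (f z) \<le> (C * norm z) ^ q"
    "\<And>t. norm (t *s v) < \<delta> \<Longrightarrow> norm t ^ q \<le> norm (f (t *s v))"
    by simp_all
  have fA: "f a = 0" if "a \<in> A" "norm a < \<delta>" "norm a < R" for a
    using f(4)[OF that(2)] AF[of a] that by simp
  define \<rho> where "\<rho> = (\<lambda>B. \<delta> / (2 * B))"
  have \<rho>: "0 < \<rho> B" "\<rho> B * B \<le> \<delta>" "\<rho> B < \<delta> / B" if "0 < B" for B
    using that f(1) by (auto simp: \<rho>_def field_simps)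
  have fac: "\<exists>\<psi>. \<psi> holomorphic_on ball 0 (\<delta> / B) \<and> (\<forall>\<eta>\<in>ball 0 (\<delta> / B). f (\<eta> *s z) = \<eta> ^ q * \<psi> \<eta>)"
    if z: "norm z < B" and B: "0 < B" for z B
  proof -
    have inb: "norm (\<eta> *s z) < \<delta>" if "\<eta> \<in> ball 0 (\<delta> / B)" for \<eta>
    proof -
      have "norm \<eta> * B < \<delta>" using that B by (simp add: pos_less_divide_eq)
      moreover have "norm \<eta> * norm z \<le> norm \<eta> * B" using z by (intro mult_left_mono) auto
      ultimately show ?thesis by (simp add: norm_smult_vec)
    qed
    have hol: "(\<lambda>\<eta>. f (0 + \<eta> *s z)) holomorphic_on ball 0 (\<delta> / B)"
      by (rule holomorphic_on_subset[OF ghol_line[OF f(2)]]) (use inb in auto)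
    have pw: "(\<lambda>\<eta>. \<eta> ^ q) holomorphic_on ball 0 (\<delta> / B)" by (intro holomorphic_intros)
    have ne: "of_real (\<rho> B) \<in> ball (0 :: complex) (\<delta> / B)" "(of_real (\<rho> B) :: complex) ^ q \<noteq> 0"
      using \<rho>[OF B] by auto
    obtain \<psi> where "\<psi> holomorphic_on ball 0 (\<delta> / B)" "\<And>\<eta>. \<eta> \<in> ball 0 (\<delta> / B) \<Longrightarrow> f (0 + \<eta> *s z) = \<eta> ^ q * \<psi> \<eta>"
    proof (rule holomorphic_division[OF hol pw ne])
      show "norm (f (0 + \<eta> *s z)) \<le> (C * norm z) ^ q * norm (\<eta> ^ q)" if "\<eta> \<in> ball 0 (\<delta> / B)" for \<eta>
        using f(5)[OF inb[OF that]] by (simp add: norm_smult_vec norm_power power_mult_distrib mult_ac)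
    qed (rule that)
    then show ?thesis by auto
  qed
  \<comment> \<open>The radius shrinks as \<open>z\<close> grows, so that \<open>G\<close> is
    defined everywhere; \<open>Gval\<close> shows that any bound \<open>B\<close> on
    \<open>z\<close> gives the same value.\<close>
  define G where "G = (\<lambda>z. scaled f q (\<rho> (norm z + 1)) 0 z)"
  have Gval: "scaled f q (\<rho> B) 0 z = G z" if z: "norm z < B" for z B
  proof -
    define m where "m = min B (norm z + 1)"
    have m: "norm z < m" "m \<le> B" "m \<le> norm z + 1" using z by (auto simp: m_def)
    have m0: "0 < m" using m(1) norm_ge_zero[of z] by linarith
    have B0: "0 < B" "0 < norm z + 1" using m m0 by linarith+
    obtain \<psi> where \<psi>: "\<psi> holomorphic_on ball 0 (\<delta> / m)" "\<forall>\<eta>\<in>ball 0 (\<delta> / m). f (\<eta> *s z) = \<eta> ^ q * \<psi> \<eta>"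
      using fac[OF m(1) m0] by blast
    have val: "scaled f q (\<rho> B') 0 z = \<psi> 0" if B': "0 < B'" "m \<le> B'" for B'
    proof (rule scaled_props(3)[OF f(2) B'(1) \<rho>(1,2)[OF B'(1)] _ _ \<psi>(1)])
      have "\<delta> / B' \<le> \<delta> / m" using B' m0 f(1) by (intro divide_left_mono) auto
      then show "\<rho> B' < \<delta> / m" using \<rho>(3)[OF B'(1)] by linarith
    qed (use \<psi>(2) \<rho>(1)[OF B'(1)] in auto)
    show ?thesis unfolding G_def using val[OF B0(1) m(2)] val[OF B0(2) m(3)] by simp
  qed
  have lim0: "G z = 0"
    if tb: "t \<longlonglongrightarrow> 0" "b \<longlonglongrightarrow> z" "\<And>i. t i \<noteq> 0" "\<And>i. t i *s b i \<in> A" for z t b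
  proof -
    define B where "B = norm z + 1"
    have B: "0 < B" "norm z < B" unfolding B_def using norm_ge_zero[of z] by linarith+
    have zin: "z \<in> ball 0 B" using B by simp
    have "isCont (\<lambda>(t, z). scaled f q (\<rho> B) t z) (0, z)"
      using scaled_props(1)[OF f(2) B(1) \<rho>(1,2)[OF B(1)]] \<rho>(1)[OF B(1)] zin
      by (simp add: continuous_on_eq_continuous_at open_Times)
    from isCont_tendsto_compose[OF this tendsto_Pair[OF tb(1,2)]]
    have lim: "(\<lambda>i. scaled f q (\<rho> B) (t i) (b i)) \<longlonglongrightarrow> G z" using Gval[OF B(2)] by simp
    have tb0: "(\<lambda>i. t i *s b i) \<longlonglongrightarrow> 0 *s z" by (intro tendsto_intros tb)
    have "\<forall>\<^sub>F i in sequentially. t i \<in> ball 0 (\<rho> B)" using topological_tendstoD[OF tb(1), of "ball 0 (\<rho> B)"] \<rho>(1)[OF B(1)] by simp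
    moreover have "\<forall>\<^sub>F i in sequentially. b i \<in> ball 0 B" using topological_tendstoD[OF tb(2), of "ball 0 B"] zin by simp
    moreover have "\<forall>\<^sub>F i in sequentially. t i *s b i \<in> ball 0 (min \<delta> R)"
      using topological_tendstoD[OF tb0, of "ball 0 (min \<delta> R)"] f(1) R by simp
    ultimately have "\<forall>\<^sub>F i in sequentially. scaled f q (\<rho> B) (t i) (b i) = 0"
    proof eventually_elim
      case (elim i)
      obtain \<psi> where \<psi>: "\<psi> holomorphic_on ball 0 (\<delta> / B)" "\<forall>\<eta>\<in>ball 0 (\<delta> / B). f (\<eta> *s b i) = \<eta> ^ q * \<psi> \<eta>"
        using fac[of "b i" B] elim(2) B(1) by auto
      have "scaled f q (\<rho> B) (t i) (b i) = \<psi> (t i)"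
        by (rule scaled_props(3)[OF f(2) B(1) \<rho>(1,2)[OF B(1)] _ \<rho>(3)[OF B(1)] \<psi>(1)]) (use elim \<psi>(2) in auto)
      moreover have "f (t i *s b i) = t i ^ q * \<psi> (t i)" using \<psi>(2) elim(1) \<rho>(3)[OF B(1)] by auto
      moreover have "f (t i *s b i) = 0" by (rule fA[OF tb(4)]) (use elim(3) in auto)
      ultimately show ?case using tb(3)[of i] by simp
    qed
    then have "(\<lambda>i. scaled f q (\<rho> B) (t i) (b i)) \<longlonglongrightarrow> 0" by (rule tendsto_eventually)
    from LIMSEQ_unique[OF this lim] show ?thesis by simp
  qed
  show ?thesis
  proof (rule that[of G])
    show "ghol G UNIV"
    proof (rule ghol_local)
      fix p :: "complex ^ 'n"
      define B where "B = norm p + 1"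
      have B: "0 < B" "norm p < B" unfolding B_def using norm_ge_zero[of p] by linarith+
      have "ghol (scaled f q (\<rho> B) 0) (ball 0 B)"
        by (rule scaled_props(2)[OF f(2) B(1) \<rho>(1,2)[OF B(1)]]) (use \<rho>(1)[OF B(1)] in simp)
      then have "ghol G (ball 0 B)" by (rule ghol_cong) (simp add: Gval)
      then show "\<exists>O'. open O' \<and> p \<in> O' \<and> ghol G O'" using B by (intro exI[of _ "ball 0 B"]) auto
    qed simp
    show "G y = 0" if y: "y \<in> LD_star A" for y
    proof -
      show ?thesis
      proof (cases "y = 0")
        case True
        \<comment> \<open>At the vertex the constant sequence 0 of \<open>A\<close> serves, since
          \<open>LD_starE_scaled\<close> covers nonzero vectors only.\<close>
        have 1: "(\<lambda>i. complex_of_real (inverse (real (Suc i)))) \<longlonglongrightarrow> 0"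
          using tendsto_of_real[OF LIMSEQ_inverse_real_of_nat, where 'a = complex] by simp
        have 2: "(\<lambda>i. 0 :: complex ^ 'n) \<longlonglongrightarrow> y" unfolding True by (rule tendsto_const)
        have ne: "complex_of_real (inverse (real (Suc i))) \<noteq> 0" for i by (simp del: of_nat_Suc)
        show ?thesis by (rule lim0[OF 1 2 ne]) (use A(2) in simp)
      next
        case False
        obtain t b where "t \<longlonglongrightarrow> 0" "b \<longlonglongrightarrow> y" "\<And>i. t i \<noteq> 0" "\<And>i. t i *s b i \<in> A"
          by (rule LD_starE_scaled[OF y False]) (rule that)
        then show ?thesis by (rule lim0)
      qed
    qed
    show "G v \<noteq> 0"
    proof
      assume Gv: "G v = 0"
      define B where "B = norm v + 1"
      have B: "0 < B" "norm v < B" unfolding B_def using norm_ge_zero[of v] by linarith+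
      obtain \<psi> where \<psi>: "\<psi> holomorphic_on ball 0 (\<delta> / B)" "\<forall>\<eta>\<in>ball 0 (\<delta> / B). f (\<eta> *s v) = \<eta> ^ q * \<psi> \<eta>"
        using fac[OF B(2,1)] by blast
      have "scaled f q (\<rho> B) 0 v = \<psi> 0"
        by (rule scaled_props(3)[OF f(2) B(1) \<rho>(1,2)[OF B(1)] _ \<rho>(3)[OF B(1)] \<psi>(1)]) (use \<psi>(2) \<rho>(1)[OF B(1)] in auto)
      then have \<psi>0: "\<psi> 0 = 0" using Gval[OF B(2)] Gv by simp
      have dB: "0 < \<delta> / B" using f(1) B by simp
      have "isCont \<psi> 0" using holomorphic_on_imp_continuous_on[OF \<psi>(1)] dB by (simp add: continuous_on_eq_continuous_at)
      then obtain e where e: "e > 0" "\<And>x. dist x 0 < e \<Longrightarrow> dist (\<psi> x) (\<psi> 0) < 1"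
        using zero_less_one unfolding continuous_at_eps_delta by blast
      define x where "x = min e (\<delta> / B)"
      have x: "x \<le> e" "x \<le> \<delta> / B" "0 < x" using e(1) dB by (auto simp: x_def)
      define s where "s = x / 2"
      have s: "0 < s" "s < e" "s < \<delta> / B" unfolding s_def using x by linarith+
      have sB: "norm (of_real s *s v) < \<delta>"
      proof -
        have "s * B < \<delta>" using s(3) B(1) by (simp add: pos_less_divide_eq)
        moreover have "s * norm v \<le> s * B" using s(1) B(2) by simp
        ultimately have "s * norm v < \<delta>" by linarith
        then show ?thesis using s(1) by (simp add: norm_smult_vec)
      qed
      \<comment> \<open>The lower bound along \<open>v\<close> gives
        \<open>norm (\<psi> s) \<ge> 1\<close> for small positive \<open>s\<close>, against
        continuity and \<open>\<psi> 0 = 0\<close>.\<close>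
      have "s ^ q \<le> norm (f (of_real s *s v))" using f(6)[OF sB] s(1) by simp
      also have "f (of_real s *s v) = of_real s ^ q * \<psi> (of_real s)" using \<psi>(2) s by simp
      also have "norm \<dots> = s ^ q * norm (\<psi> (of_real s))" using s(1) by (simp add: norm_mult norm_power)
      finally have "1 \<le> norm (\<psi> (of_real s))" using s(1) by simp
      moreover have "norm (\<psi> (of_real s)) < 1" using e(2)[of "of_real s"] s \<psi>0 by simp
      ultimately show False by simp
    qed
  qed
qed

section \<open>Approximation of tangent vectors at every scale\<close>

text \<open>Total differentiability of \<open>f\<close> gives the chain rule on each line. The
  condition on \<Theta> is again line-wise, so it fits holomorphic maps as well as the quadratic map
  used for \<open>LD_star_sequence\<close>.\<close>

lemma ghol_compose:
  fixes \<Theta> :: "complex ^ 'm \<Rightarrow> complex ^ 'n"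
  assumes f: "ghol f S" and S': "open S'" "continuous_on S' \<Theta>" "\<And>p. p \<in> S' \<Longrightarrow> \<Theta> p \<in> S"
    and der: "\<And>p u. p \<in> S' \<Longrightarrow> \<exists>x. ((\<lambda>\<zeta>. \<Theta> (p + \<zeta> *s u)) has_derivative (\<lambda>\<zeta>. \<zeta> *s x)) (at 0)"
  shows "ghol (\<lambda>p. f (\<Theta> p)) S'"
  unfolding ghol_def
proof (intro conjI ballI allI)
  show "continuous_on S' (\<lambda>p. f (\<Theta> p))"
    by (rule continuous_on_compose2[OF ghol_continuous[OF f] S'(2)]) (use S'(3) in auto)
  fix p u :: "complex ^ 'm" assume p: "p \<in> S'"
  obtain x where x: "((\<lambda>\<zeta>. \<Theta> (p + \<zeta> *s u)) has_derivative (\<lambda>\<zeta>. \<zeta> *s x)) (at 0)" using der[OF p] by blast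
  have "(f has_derivative (\<lambda>v. dder f v (\<Theta> (p + 0 *s u)))) (at (\<Theta> (p + 0 *s u)))"
    by (rule ghol_has_derivative[OF f]) (use S'(3)[OF p] in simp)
  from diff_chain_at[OF x this]
  have "((\<lambda>\<zeta>. f (\<Theta> (p + \<zeta> *s u))) has_derivative (\<lambda>\<zeta>. dder f (\<zeta> *s x) (\<Theta> p))) (at 0)" by (simp add: o_def)
  then have "((\<lambda>\<zeta>. f (\<Theta> (p + \<zeta> *s u))) has_field_derivative dder f x (\<Theta> p)) (at 0)"
    using dder_scale[OF f S'(3)[OF p]] by (simp add: has_field_derivative_def mult.commute[of _ "dder f x (\<Theta> p)"])
  then show "(\<lambda>\<zeta>. f (\<Theta> (p + \<zeta> *s u))) field_differentiable at 0" by (auto simp: field_differentiable_def)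
qed fact

text \<open>Divide an equation by the highest possible power of \<open>\<xi>\<close>, then project along a direction
  inside \<open>\<xi> = 0\<close>.\<close>

lemma analytic_meets_parallel_hyperplanes:
  fixes \<xi> :: "complex ^ 'n \<Rightarrow> complex"
  assumes "vec.subspace T" "Vector_Spaces.linear (*s) (*) \<xi>" "0 < R" "\<And>f. f \<in> F \<Longrightarrow> ghol f (ball 0 R)"
    and "\<And>\<delta>. 0 < \<delta> \<Longrightarrow> \<exists>z\<in>T. norm z < \<delta> \<and> \<xi> z \<noteq> 0 \<and> (\<forall>f\<in>F. f z = 0)" and "0 < \<epsilon>"
  shows "\<exists>s0>0. \<forall>s. norm s < s0 \<longrightarrow> s \<noteq> 0 \<longrightarrow> (\<exists>x\<in>T. norm x < \<epsilon> \<and> \<xi> x = s \<and> (\<forall>f\<in>F. f x = 0))"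
  using assms
proof (induction "vec.dim T" arbitrary: T F R \<epsilon> rule: less_induct)
  case less
  note T = less.prems(1) and \<xi> = less.prems(2) and R = less.prems(3) and F = less.prems(4)
    and near = less.prems(5) and \<epsilon> = less.prems(6)
  interpret l: Vector_Spaces.linear "(*s)" "(*)" \<xi> by (rule \<xi>)
  obtain z1 where z1: "z1 \<in> T" "\<xi> z1 \<noteq> 0" using near[OF zero_less_one] by blast
  define e where "e = inverse (\<xi> z1) *s z1"
  have e: "e \<in> T" "\<xi> e = 1" using z1 by (auto simp: e_def l.scale intro: vec.subspace_scale[OF T])
  have ne: "0 < norm e + 1" using norm_ge_zero[of e] by linarith
  show ?case
  proof (cases "\<forall>f\<in>F. \<forall>z\<in>T. norm z < R \<longrightarrow> f z = 0")
    case True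
    define s0 where "s0 = min R \<epsilon> / (norm e + 1)"
    have s0: "0 < s0" using R \<epsilon> ne by (simp add: s0_def)
    have "\<exists>x\<in>T. norm x < \<epsilon> \<and> \<xi> x = s \<and> (\<forall>f\<in>F. f x = 0)" if "norm s < s0" for s
    proof -
      have "norm s * (norm e + 1) < min R \<epsilon>" using that ne by (simp add: s0_def pos_less_divide_eq)
      moreover have "norm s * norm e \<le> norm s * (norm e + 1)" by (intro mult_left_mono) auto
      ultimately have "norm (s *s e) < R" "norm (s *s e) < \<epsilon>" by (simp_all add: norm_smult_vec)
      then show ?thesis using True e by (intro bexI[of _ "s *s e"]) (auto simp: l.scale vec.subspace_scale[OF T])
    qed
    then show ?thesis using s0 by blast
  next
    case False
    then obtain f q0 where f: "f \<in> F" and q0: "q0 \<in> T" "q0 \<in> ball 0 R" "f q0 \<noteq> 0" by auto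
    have ghf: "ghol f (ball 0 R)" by (rule F[OF f])
    define Q where "Q = (\<lambda>z. z - \<xi> z *s e)"
    have Qlin: "Vector_Spaces.linear (*s) (*s) Q" unfolding Q_def by (rule linear_proj[OF \<xi>])
    have \<xi>Q: "\<xi> (Q z) = 0" for z by (simp add: Q_def l.diff l.scale e)
    have QT: "Q z \<in> T" if "z \<in> T" for z
      unfolding Q_def by (intro vec.subspace_diff[OF T] vec.subspace_scale[OF T] that e)
    have Qdec: "Q z + \<xi> z *s e = z" for z by (simp add: Q_def)
    obtain CQ where "0 < CQ" "\<And>z. norm (z - \<xi> z *s e) \<le> CQ * norm z" by (rule linear_proj_bound[OF \<xi>]) (rule that)
    then have CQ: "0 < CQ" "\<And>z. norm (Q z) \<le> CQ * norm z" by (simp_all add: Q_def)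
    obtain CX where CX: "0 < CX" "\<And>z. norm (\<xi> z) \<le> CX * norm z" by (rule linear_functional_bound[OF \<xi>]) (rule that)
    define r0 where "r0 = R / (2 * (norm e + 1))"
    have "R / (2 * n) * n = R / 2" if "0 < n" for n :: real using that by simp
    from this[OF ne] have r0: "0 < r0" "r0 * (norm e + 1) = R / 2" using R ne by (simp_all add: r0_def)
    define \<rho> where "\<rho> = r0 / 2"
    have \<rho>: "0 < \<rho>" "\<rho> < r0" using r0 by (auto simp: \<rho>_def)
    have inb: "u + \<eta> *s e \<in> ball 0 R" if "u \<in> ball 0 (R/2)" "\<eta> \<in> ball 0 r0" for u \<eta>
    proof -
      have "norm (\<eta> *s e) \<le> r0 * (norm e + 1)" unfolding norm_smult_vec by (rule mult_mono) (use that r0 in auto)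
      then show ?thesis using norm_triangle_ineq[of u "\<eta> *s e"] that r0 by simp
    qed
    define \<delta>0 where "\<delta>0 = Min {R / 2, R / (2 * CQ), \<rho> / CX}"
    have "0 < \<delta>0" using R CQ(1) CX(1) \<rho> by (auto simp: \<delta>0_def)
    moreover have "\<delta>0 \<le> R / 2" "\<delta>0 \<le> R / (2 * CQ)" "\<delta>0 \<le> \<rho> / CX" unfolding \<delta>0_def by (rule Min_le; simp)+
    ultimately have \<delta>0: "0 < \<delta>0" "\<delta>0 \<le> R / 2" "\<delta>0 \<le> R / (2 * CQ)" "\<delta>0 \<le> \<rho> / CX" .
    have small: "norm (Q z) < R / 2" "norm (\<xi> z) < \<rho>" if "z \<in> ball 0 \<delta>0" for z
    proof -
      have "norm z < R / (2 * CQ)" "norm z < \<rho> / CX" using that \<delta>0 by auto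
      then have "CQ * norm z < R / 2" "CX * norm z < \<rho>" using CQ(1) CX(1) by (simp_all add: pos_less_divide_eq mult_ac)
      then show "norm (Q z) < R / 2" "norm (\<xi> z) < \<rho>" using CQ(2)[of z] CX(2)[of z] by linarith+
    qed
    \<comment> \<open>On the line \<open>v + \<eta> *s e\<close> with \<open>\<xi> v = 0\<close> the
      parameter \<eta> is the value of \<xi>, so a factor \<open>\<eta> ^ k\<close> common to all
      these lines is a factor \<open>\<xi> ^ k\<close> of \<open>f\<close> on
      \<open>T\<close>.\<close>
    define V where "V = {v\<in>T. \<xi> v = 0 \<and> norm v < \<delta>0}"
    have hol: "(\<lambda>\<eta>. f (v + \<eta> *s e)) holomorphic_on ball 0 r0" if "v \<in> V" for v
      by (rule holomorphic_on_subset[OF ghol_line[OF ghf]]) (use inb[of v] that \<delta>0 in \<open>auto simp: V_def\<close>)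
    have ex: "\<exists>v\<in>V. \<exists>\<eta>\<in>ball 0 r0. f (v + \<eta> *s e) \<noteq> 0"
    proof -
      define \<delta>1 where "\<delta>1 = min \<delta>0 (\<delta>0 / CQ)"
      have \<delta>1: "0 < \<delta>1" "\<delta>1 \<le> \<delta>0" "\<delta>1 \<le> \<delta>0 / CQ" using \<delta>0 CQ(1) by (auto simp: \<delta>1_def)
      have "0 \<in> ball (0 :: complex ^ 'n) R" using R by simp
      from ghol_nonzero_near[OF ghf T vec.subspace_0[OF T] this q0 \<delta>1(1)]
      obtain z where z: "z \<in> T" "dist 0 z < \<delta>1" "f z \<noteq> 0" by blast
      have nz: "norm z < \<delta>0" "norm z < \<delta>0 / CQ" using z \<delta>1 by auto
      have "CQ * norm z < \<delta>0" using nz(2) CQ(1) by (simp add: pos_less_divide_eq mult.commute)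
      then have "norm (Q z) < \<delta>0" using CQ(2)[of z] by linarith
      then have "Q z \<in> V" using QT[OF z(1)] \<xi>Q by (simp add: V_def)
      moreover have "\<xi> z \<in> ball 0 r0" using small(2)[of z] nz \<rho> by simp
      ultimately show ?thesis using z(3) by (intro bexI[of _ "Q z"] bexI[of _ "\<xi> z"]) (auto simp: Qdec)
    qed
    obtain k v0 \<psi> where v0: "v0 \<in> V" "\<psi> v0 0 \<noteq> 0"
      and \<psi>hol: "\<And>v. v \<in> V \<Longrightarrow> \<psi> v holomorphic_on ball 0 r0"
      and \<psi>: "\<And>v \<eta>. v \<in> V \<Longrightarrow> \<eta> \<in> ball 0 r0 \<Longrightarrow> f (v + \<eta> *s e) = \<eta> ^ k * \<psi> v \<eta>"
      by (rule holomorphic_family_factor[where V = V and R = "\<lambda>_. r0", OF hol ex], assumption) (rule that)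
    \<comment> \<open>Cauchy mean for \<open>f\<close> divided by \<open>\<xi> ^ k\<close>,
      holomorphic across the hyperplane \<xi> = 0.\<close>
    define f' where "f' = (\<lambda>z. cmean \<rho> (\<lambda>\<eta>. f (Q z + \<eta> *s e) * \<eta> / (\<eta> ^ k * (\<eta> - \<xi> z))))"
    have f'val: "f' z = \<psi> (Q z) (\<xi> z)" if "norm (\<xi> z) < \<rho>" "Q z \<in> V" for z
      unfolding f'_def by (rule cmean_factor[OF \<psi>hol[OF that(2)] \<rho> that(1)]) (rule \<psi>[OF that(2)])
    have ghf': "ghol f' (ball 0 \<delta>0)"
      unfolding f'_def
    proof (rule ghol_cmean)
      have inb': "Q z + \<eta> *s e \<in> ball 0 R" if "z \<in> ball 0 \<delta>0" "\<eta> \<in> sphere 0 \<rho>" for z \<eta>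
        by (rule inb) (use small[OF that(1)] that \<rho> in auto)
      have nz: "\<eta> \<noteq> 0" "\<eta> - \<xi> z \<noteq> 0" if "z \<in> ball 0 \<delta>0" "\<eta> \<in> sphere 0 \<rho>" for z \<eta>
        using small(2)[OF that(1)] that(2) \<rho> by auto
      have cQ: "continuous_on X (\<lambda>x. Q (g x))" if "continuous_on X g" for X and g :: "'z::topological_space \<Rightarrow> _"
        using that bounded_linear.continuous_on[OF clinear_scaleR[OF Qlin]] by blast
      have cX: "continuous_on X (\<lambda>x. \<xi> (g x))" if "continuous_on X g" for X and g :: "'z::topological_space \<Rightarrow> _"
        using that bounded_linear.continuous_on[OF clinear_functional_bounded[OF \<xi>]] by blast
      have "continuous_on (ball 0 \<delta>0 \<times> sphere 0 \<rho>) (\<lambda>x. f (Q (fst x) + snd x *s e))"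
        by (rule continuous_on_compose2[OF ghol_continuous[OF ghf]])
           (use inb' in \<open>auto intro!: continuous_intros cQ\<close>)
      then show "continuous_on (ball 0 \<delta>0 \<times> sphere 0 \<rho>) (\<lambda>(z, \<eta>). f (Q z + \<eta> *s e) * \<eta> / (\<eta> ^ k * (\<eta> - \<xi> z)))"
        unfolding case_prod_unfold by (intro continuous_intros cX) (use nz in auto)
      fix \<eta> :: complex assume \<eta>: "\<eta> \<in> sphere 0 \<rho>"
      interpret Ql: Vector_Spaces.linear "(*s)" "(*s)" Q by (rule Qlin)
      have "ghol (\<lambda>z. f (Q z + \<eta> *s e)) (ball 0 \<delta>0)"
      proof (rule ghol_comp_affine[OF ghf])
        show "\<exists>v'. \<forall>\<zeta>. Q (p + \<zeta> *s v) + \<eta> *s e = Q p + \<eta> *s e + \<zeta> *s v'" for p v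
          by (rule exI[of _ "Q v"]) (simp add: Ql.add Ql.scale)
      qed (use inb' \<eta> in \<open>auto intro!: continuous_intros cQ\<close>)
      then show "ghol (\<lambda>z. f (Q z + \<eta> *s e) * \<eta> / (\<eta> ^ k * (\<eta> - \<xi> z))) (ball 0 \<delta>0)"
        by (intro ghol_divide ghol_mult ghol_const ghol_diff ghol_functional[OF \<xi>]) (use nz \<eta> in auto)
    qed (use \<rho> in auto)
    have v0': "v0 \<in> T" "\<xi> v0 = 0" "norm v0 < \<delta>0" using v0 by (auto simp: V_def)
    have Qv0: "Q v0 = v0" using v0' by (simp add: Q_def)
    have f'v0: "f' v0 \<noteq> 0" using f'val[of v0] v0 v0' \<rho> by (simp add: Qv0)
    define \<delta>1 where "\<delta>1 = min \<delta>0 (\<delta>0 / CQ)"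
    have \<delta>1: "0 < \<delta>1" "\<delta>1 \<le> \<delta>0" "\<delta>1 \<le> \<delta>0 / CQ" using \<delta>0 CQ(1) by (auto simp: \<delta>1_def)
    have f'zero: "f' z = 0" if z: "z \<in> T" "norm z < \<delta>1" "\<xi> z \<noteq> 0" "f z = 0" for z
    proof -
      have nz: "norm z < \<delta>0" "norm z < \<delta>0 / CQ" using z \<delta>1 by auto
      have "CQ * norm z < \<delta>0" using nz(2) CQ(1) by (simp add: pos_less_divide_eq mult.commute)
      then have "norm (Q z) < \<delta>0" using CQ(2)[of z] by linarith
      then have V: "Q z \<in> V" using QT[OF z(1)] \<xi>Q by (simp add: V_def)
      have x: "norm (\<xi> z) < \<rho>" using small(2)[of z] nz by simp
      then have "f z = \<xi> z ^ k * \<psi> (Q z) (\<xi> z)" using \<psi>[OF V, of "\<xi> z"] \<rho> by (simp add: Qdec)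
      then show ?thesis using f'val[OF x V] z by simp
    qed
    \<comment> \<open>Points of the set with \<xi> nonzero accumulate at 0, and near 0 they are
      zeros of \<open>f'\<close>.\<close>
    have f'0: "f' 0 = 0"
    proof (rule ccontr)
      assume n0: "f' 0 \<noteq> 0"
      have "isCont f' 0" using ghol_continuous[OF ghf'] \<delta>0 by (simp add: continuous_on_eq_continuous_at)
      from continuous_at_avoid[OF this n0] obtain e1 where e1: "e1 > 0" "\<forall>y. dist 0 y < e1 \<longrightarrow> f' y \<noteq> 0" by blast
      obtain z where "z \<in> T" "norm z < min e1 \<delta>1" "\<xi> z \<noteq> 0" "\<forall>f\<in>F. f z = 0"
        using near[of "min e1 \<delta>1"] e1(1) \<delta>1(1) by auto
      then show False using f'zero[of z] e1(2) f by simp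
    qed
    \<comment> \<open>\<open>f'\<close> vanishes at 0 but not at \<open>v0\<close>, so
      \<open>v0\<close> spans a line in the hyperplane \<xi> = 0 on which \<open>f'\<close> is not
      identically zero. Projecting along it leaves \<xi> unchanged, so hypothesis and conclusion
      both pass through the projection.\<close>
    have v0nz: "v0 \<noteq> 0" using f'0 f'v0 by auto
    obtain \<tau> where \<tau>: "Vector_Spaces.linear (*s) (*) \<tau>" "\<tau> v0 = 1" by (rule exists_dual_functional[OF v0nz])
    interpret lt: Vector_Spaces.linear "(*s)" "(*)" \<tau> by (rule \<tau>(1))
    define P where "P = (\<lambda>z. z - \<tau> z *s v0)"
    have Pdec: "P z + \<tau> z *s v0 = z" for z by (simp add: P_def)
    have \<xi>P: "\<xi> (P z) = \<xi> z" for z by (simp add: P_def l.diff l.scale v0')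
    define T' where "T' = {z\<in>T. \<tau> z = 0}"
    have T': "vec.subspace T'" unfolding T'_def by (rule subspace_kernel[OF \<tau>(1) T])
    have dim: "vec.dim T' < vec.dim T" unfolding T'_def by (rule dim_kernel_less[OF \<tau>(1) T v0'(1)]) (simp add: \<tau>)
    have PT: "P z \<in> T'" if "z \<in> T" for z
      unfolding T'_def P_def using that v0' \<tau>
      by (auto simp: lt.diff lt.scale intro!: vec.subspace_diff[OF T] vec.subspace_scale[OF T])
    obtain CP where "0 < CP" "\<And>z. norm (z - \<tau> z *s v0) \<le> CP * norm z" by (rule linear_proj_bound[OF \<tau>(1)]) (rule that)
    then have CP: "0 < CP" "\<And>z. norm (P z) \<le> CP * norm z" by (simp_all add: P_def)
    obtain CT where CT: "0 < CT" "\<And>z. norm (\<tau> z) \<le> CT * norm z" by (rule linear_functional_bound[OF \<tau>(1)]) (rule that)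
    define N where "N = 1 + norm v0"
    have N: "0 < N" unfolding N_def using norm_ge_zero[of v0] by linarith
    have eN: "0 < \<epsilon> / N" "\<epsilon> / N * N = \<epsilon>" using \<epsilon> N by simp_all
    have FF: "ghol g (ball 0 \<delta>0)" if "g \<in> F" for g by (rule ghol_subset[OF F[OF that]]) (use \<delta>0 R in auto)
    have one: "1 *s v0 \<in> ball 0 \<delta>0" "f' (1 *s v0) \<noteq> 0" using v0' f'v0 by auto
    obtain \<delta> r G where *: "0 < \<delta>" "\<delta> < \<epsilon> / N" "0 < r" "r < \<epsilon> / N"
      and inb2: "\<And>u \<zeta>. u \<in> ball 0 \<delta> \<Longrightarrow> \<zeta> \<in> ball 0 r \<Longrightarrow> u + \<zeta> *s v0 \<in> ball 0 \<delta>0"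
      and G: "\<And>N. N \<in> G \<Longrightarrow> ghol N (ball 0 \<delta>)"
      and Giff: "\<And>u. u \<in> ball 0 \<delta> \<Longrightarrow> (\<forall>N\<in>G. N u = 0) \<longleftrightarrow>
        (\<exists>\<zeta>\<in>ball 0 r. f' (u + \<zeta> *s v0) = 0 \<and> (\<forall>f\<in>F. f (u + \<zeta> *s v0) = 0))"
    proof (rule analytic_projection[OF ghf' _ one eN(1)])
      show "ghol f (ball 0 \<delta>0)" if "f \<in> F" for f by (rule FF[OF that])
    qed (rule that)
    have near': "\<exists>z\<in>T'. norm z < \<delta>' \<and> \<xi> z \<noteq> 0 \<and> (\<forall>f\<in>G. f z = 0)" if \<delta>': "0 < \<delta>'" for \<delta>'
    proof -
      define d where "d = Min {\<delta>1, \<delta>' / CP, \<delta> / CP, r / CT}"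
      have d: "0 < d" "d \<le> \<delta>1" "d \<le> \<delta>' / CP" "d \<le> \<delta> / CP" "d \<le> r / CT"
        using \<delta>1 \<delta>' CP(1) CT(1) * by (auto simp: d_def)
      obtain z where z: "z \<in> T" "norm z < d" "\<xi> z \<noteq> 0" "\<forall>f\<in>F. f z = 0" using near[OF d(1)] by blast
      have "norm z < \<delta>' / CP" "norm z < \<delta> / CP" "norm z < r / CT" using z(2) d by linarith+
      then have "CP * norm z < \<delta>'" "CP * norm z < \<delta>" "CT * norm z < r"
        using CP(1) CT(1) by (simp_all add: pos_less_divide_eq mult.commute)
      then have b: "norm (P z) < \<delta>'" "norm (P z) < \<delta>" "norm (\<tau> z) < r" using CP(2)[of z] CT(2)[of z] by linarith+
      have "f' z = 0" by (rule f'zero) (use z d f in auto)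
      then have "\<exists>\<zeta>\<in>ball 0 r. f' (P z + \<zeta> *s v0) = 0 \<and> (\<forall>f\<in>F. f (P z + \<zeta> *s v0) = 0)"
        using b z(4) by (intro bexI[of _ "\<tau> z"]) (auto simp: Pdec)
      then have "\<forall>N\<in>G. N (P z) = 0" using Giff[of "P z"] b by simp
      then show ?thesis using b z(3) PT[OF z(1)] by (intro bexI[of _ "P z"]) (auto simp: \<xi>P)
    qed
    have "\<exists>s0>0. \<forall>s. norm s < s0 \<longrightarrow> s \<noteq> 0 \<longrightarrow> (\<exists>x\<in>T'. norm x < \<delta> \<and> \<xi> x = s \<and> (\<forall>f\<in>G. f x = 0))"
    proof (rule less.hyps[OF dim T' \<xi> *(1)])
      show "ghol N (ball 0 \<delta>)" if "N \<in> G" for N by (rule G[OF that])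
      show "\<exists>z\<in>T'. norm z < \<delta>' \<and> \<xi> z \<noteq> 0 \<and> (\<forall>f\<in>G. f z = 0)" if "0 < \<delta>'" for \<delta>' by (rule near'[OF that])
      show "0 < \<delta>" by (rule *(1))
    qed
    then obtain s0 where s0: "0 < s0"
      "\<And>s. norm s < s0 \<Longrightarrow> s \<noteq> 0 \<Longrightarrow> \<exists>x\<in>T'. norm x < \<delta> \<and> \<xi> x = s \<and> (\<forall>f\<in>G. f x = 0)" by auto
    have "\<exists>x\<in>T. norm x < \<epsilon> \<and> \<xi> x = s \<and> (\<forall>f\<in>F. f x = 0)" if s: "norm s < s0" "s \<noteq> 0" for s
    proof -
      obtain u where u: "u \<in> T'" "norm u < \<delta>" "\<xi> u = s" "\<forall>f\<in>G. f u = 0" using s0(2)[OF s] by blast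
      have "u \<in> ball 0 \<delta>" using u by simp
      from Giff[OF this] u(4) obtain \<zeta> where \<zeta>: "\<zeta> \<in> ball 0 r" "\<forall>f\<in>F. f (u + \<zeta> *s v0) = 0" by blast
      have "norm (u + \<zeta> *s v0) \<le> norm u + norm \<zeta> * norm v0"
        using norm_triangle_ineq[of u "\<zeta> *s v0"] by (simp add: norm_smult_vec)
      also have "norm \<zeta> * norm v0 \<le> \<epsilon> / N * norm v0" using \<zeta>(1) * by (intro mult_right_mono) auto
      finally have "norm (u + \<zeta> *s v0) < \<epsilon> / N * N" using u(2) *(2) unfolding N_def distrib_left by linarith
      then have "norm (u + \<zeta> *s v0) < \<epsilon>" unfolding eN(2) .
      moreover have "u + \<zeta> *s v0 \<in> T" using u(1) v0' by (auto simp: T'_def intro!: vec.subspace_add[OF T] vec.subspace_scale[OF T])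
      moreover have "\<xi> (u + \<zeta> *s v0) = s" using u(3) v0' by (simp add: l.add l.scale)
      ultimately show ?thesis using \<zeta>(2) by blast
    qed
    then show ?thesis using s0(1) by blast
  qed
qed

text \<open>A point within 1/(i+1) of the optimal distance is taken for each \<open>i\<close>, so
  one sequence serves all \<epsilon>.\<close>

lemma approximating_sequence:
  fixes g :: "nat \<Rightarrow> 'a \<Rightarrow> 'b::metric_space"
  assumes "A \<noteq> {}" and ev: "\<And>\<epsilon>. 0 < \<epsilon> \<Longrightarrow> \<forall>\<^sub>F i in sequentially. \<exists>a\<in>A. dist (g i a) v < \<epsilon>"
  obtains a where "\<And>i. a i \<in> A" "(\<lambda>i. g i (a i)) \<longlonglongrightarrow> v"
proof -
  have "\<exists>a\<in>A. dist v (g i a) < infdist v (g i ` A) + inverse (real (Suc i))" for i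
  proof -
    have "\<exists>x\<in>g i ` A. dist v x < infdist v (g i ` A) + inverse (real (Suc i))"
    proof (rule ccontr)
      assume "\<not> ?thesis"
      then have "infdist v (g i ` A) + inverse (real (Suc i)) \<le> infdist v (g i ` A)"
        using assms(1) by (subst (2) infdist_notempty) (auto intro!: cINF_greatest simp: not_less)
      then show False by simp
    qed
    then show ?thesis by blast
  qed
  then obtain a where a: "\<And>i. a i \<in> A" "\<And>i. dist v (g i (a i)) < infdist v (g i ` A) + inverse (real (Suc i))" by metis
  have "(\<lambda>i. g i (a i)) \<longlonglongrightarrow> v"
  proof (rule tendstoI)
    fix e :: real assume e: "0 < e"
    have "\<forall>\<^sub>F i in sequentially. inverse (real (Suc i)) < e / 2"
      using order_tendstoD(2)[OF LIMSEQ_inverse_real_of_nat, of "e/2"] e by simp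
    with ev[of "e/2"] e have "\<forall>\<^sub>F i in sequentially. (\<exists>a\<in>A. dist (g i a) v < e / 2) \<and> inverse (real (Suc i)) < e / 2"
      by (simp add: eventually_conj)
    then show "\<forall>\<^sub>F i in sequentially. dist (g i (a i)) v < e"
    proof eventually_elim
      case (elim i)
      then obtain x where x: "x \<in> A" "dist (g i x) v < e / 2" by blast
      then have "infdist v (g i ` A) < e / 2" using infdist_le[of "g i x" "g i ` A" v] by (simp add: dist_commute)
      then have "dist v (g i (a i)) < e" using a(2)[of i] elim by linarith
      then show ?case by (simp add: dist_commute)
    qed
  qed
  then show ?thesis using a(1) by (rule_tac that)
qed

text \<open>\<open>A\<close> is pulled back under (t, x) -> t (v + x). The given scales yield points
  (t, b - v) of the pullback that tend to 0 with t nonzero; so the pullback meets every hyperplane t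
  = s for small nonzero s, arbitrarily close to 0, and s = 1/(i+1) may be prescribed.\<close>

lemma LD_star_sequence:
  fixes A :: "(complex ^ 'n) set"
  assumes A: "analytic_germ_at0 A" "0 \<in> A" and v: "v \<in> LD_star A"
  obtains a where "\<And>i. a i \<in> A" "(\<lambda>i. of_nat (Suc i) *s a i) \<longlonglongrightarrow> v"
proof (cases "v = 0")
  case True
  show ?thesis by (rule that[of "\<lambda>_. 0"]) (use A True in auto)
next
  case False
  obtain t b where tb: "t \<longlonglongrightarrow> 0" "b \<longlonglongrightarrow> v" "\<And>i. t i \<noteq> 0" "\<And>i. t i *s b i \<in> A"
    by (rule LD_starE_scaled[OF v False]) (rule that)
  obtain V F where V: "open V" "0 \<in> V" "finite F" "\<And>f. f \<in> F \<Longrightarrow> holo_fun_on f V"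
    "A \<inter> V = {z\<in>V. \<forall>f\<in>F. f z = 0}" using A(1) by (auto simp: analytic_germ_at0_def)
  \<comment> \<open>In the index type \<open>'n option\<close>, \<open>None\<close> is the scale
    coordinate t and the remaining coordinates, extracted by \<open>L\<close>, form x.\<close>
  define L :: "complex ^ 'n option \<Rightarrow> complex ^ 'n" where "L = (\<lambda>x. \<chi> i. x $ Some i)"
  define \<Theta> where "\<Theta> = (\<lambda>x. x $ None *s (v + L x))"
  have Llin: "Vector_Spaces.linear (*s) (*s) L" unfolding L_def by unfold_locales (simp_all add: vec_eq_iff)
  interpret L: Vector_Spaces.linear "(*s)" "(*s)" L by (rule Llin)
  have Lcont: "continuous_on UNIV L" by (rule linear_continuous_on[OF clinear_scaleR[OF Llin]])
  have Ncont: "continuous_on UNIV (\<lambda>x :: complex ^ 'n option. x $ None)" by (intro continuous_intros)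
  have cont: "continuous_on UNIV \<Theta>" unfolding \<Theta>_def by (intro continuous_intros Lcont)
  have "open (\<Theta> -` V)" by (rule open_vimage[OF V(1) cont])
  moreover have "0 \<in> \<Theta> -` V" using V(2) by (simp add: \<Theta>_def)
  ultimately obtain R where R: "0 < R" "ball 0 R \<subseteq> \<Theta> -` V" using openE by blast
  define F' where "F' = (\<lambda>f x. f (\<Theta> x)) ` F"
  have gh: "ghol g (ball 0 R)" if gF: "g \<in> F'" for g
  proof -
    obtain f where f: "f \<in> F" "g = (\<lambda>x. f (\<Theta> x))" using gF by (auto simp: F'_def)
    show ?thesis unfolding f(2)
    proof (rule ghol_compose[OF ghol_if_holo_fun_on[OF V(4)[OF f(1)]]])
      show "continuous_on (ball 0 R) \<Theta>" by (rule continuous_on_subset[OF cont]) simp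
      show "\<Theta> p \<in> V" if "p \<in> ball 0 R" for p using R(2) that by auto
      fix p u :: "complex ^ 'n option"
      have bl: "bounded_linear (\<lambda>\<zeta>. \<zeta> *s y)" for y :: "complex ^ 'n"
        by (rule bounded_bilinear.bounded_linear_left[OF bounded_bilinear_smult_vec])
      have 1: "((\<lambda>\<zeta>. p $ None + \<zeta> * u $ None) has_derivative (\<lambda>\<zeta>. \<zeta> * u $ None)) (at 0)"
        by (auto intro!: derivative_eq_intros)
      have 2: "((\<lambda>\<zeta>. (v + L p) + \<zeta> *s L u) has_derivative (\<lambda>\<zeta>. \<zeta> *s L u)) (at 0)"
        using has_derivative_add[OF has_derivative_const bounded_linear.has_derivative[OF bl has_derivative_ident]] by simp
      have "((\<lambda>\<zeta>. (p $ None + \<zeta> * u $ None) *s ((v + L p) + \<zeta> *s L u)) has_derivative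
          (\<lambda>\<zeta>. (p $ None + 0 * u $ None) *s (\<zeta> *s L u) + (\<zeta> * u $ None) *s ((v + L p) + 0 *s L u))) (at 0)"
        by (rule bounded_bilinear.FDERIV[OF bounded_bilinear_smult_vec 1 2])
      moreover have "(\<lambda>\<zeta>. (p $ None + \<zeta> * u $ None) *s ((v + L p) + \<zeta> *s L u)) = (\<lambda>\<zeta>. \<Theta> (p + \<zeta> *s u))"
        by (simp add: \<Theta>_def L.add L.scale add.assoc)
      moreover have "(\<lambda>\<zeta>. (p $ None + 0 * u $ None) *s (\<zeta> *s L u) + (\<zeta> * u $ None) *s ((v + L p) + 0 *s L u))
          = (\<lambda>\<zeta>. \<zeta> *s (p $ None *s L u + u $ None *s (v + L p)))"
        by (simp add: vec.scale_right_distrib mult.commute)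
      ultimately show "\<exists>x. ((\<lambda>\<zeta>. \<Theta> (p + \<zeta> *s u)) has_derivative (\<lambda>\<zeta>. \<zeta> *s x)) (at 0)" by metis
    qed simp
  qed
  have lin: "Vector_Spaces.linear (*s) (*) (\<lambda>x :: complex ^ 'n option. x $ None)" by unfold_locales simp_all
  have F'A: "(\<forall>g\<in>F'. g x = 0) \<longleftrightarrow> \<Theta> x \<in> A" if "x \<in> ball 0 R" for x
  proof -
    have "\<Theta> x \<in> V" using that R(2) by auto
    then show ?thesis using V(5) by (auto simp: F'_def)
  qed
  have near: "\<exists>z\<in>UNIV. norm z < \<delta> \<and> z $ None \<noteq> 0 \<and> (\<forall>g\<in>F'. g z = 0)" if \<delta>: "0 < \<delta>" for \<delta>
  proof -
    define x where "x = (\<lambda>i. \<chi> j. case j of None \<Rightarrow> t i | Some k \<Rightarrow> (b i - v) $ k)"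
    have "(\<lambda>i. b i - v) \<longlonglongrightarrow> 0" using tb(2) by (simp add: LIM_zero)
    then have bv: "(\<lambda>i. (b i - v) $ k) \<longlonglongrightarrow> 0" for k using tendsto_vec_nth[of "\<lambda>i. b i - v" 0 sequentially k] by simp
    have "x \<longlonglongrightarrow> 0"
    proof (rule vec_tendstoI)
      show "(\<lambda>i. x i $ j) \<longlonglongrightarrow> 0 $ j" for j using tb(1) bv by (cases j) (auto simp: x_def)
    qed
    then have "\<forall>\<^sub>F i in sequentially. x i \<in> ball 0 (min \<delta> R)"
      by (rule topological_tendstoD) (use \<delta> R in auto)
    then obtain i where i: "x i \<in> ball 0 (min \<delta> R)" by (auto simp: eventually_sequentially)
    have "L (x i) = b i - v" by (simp add: L_def x_def vec_eq_iff)
    then have "\<Theta> (x i) = t i *s b i" by (simp add: \<Theta>_def x_def)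
    then have "\<forall>g\<in>F'. g (x i) = 0" using F'A[of "x i"] i tb(4)[of i] by simp
    moreover have "x i $ None \<noteq> 0" using tb(3) by (simp add: x_def)
    ultimately show ?thesis using i by (intro bexI[of _ "x i"]) auto
  qed
  have LC: "\<exists>C>0. \<forall>x. norm (L x) \<le> C * norm x"
    using bounded_linear.pos_bounded[OF clinear_scaleR[OF Llin]] by (auto simp: mult.commute)
  then obtain C where C: "0 < C" "\<And>x. norm (L x) \<le> C * norm x" by blast
  have "\<forall>\<^sub>F i in sequentially. \<exists>a\<in>A. dist (of_nat (Suc i) *s a) v < \<epsilon>" if \<epsilon>: "0 < \<epsilon>" for \<epsilon>
  proof -
    \<comment> \<open>Keeps \<open>x\<close> in the domain of the pullback and makes
      \<open>norm (L x) < \<epsilon>\<close>, which is the distance of the rescaled point from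
      \<open>v\<close>.\<close>
    define \<epsilon>' where "\<epsilon>' = min R (\<epsilon> / C)"
    have \<epsilon>': "0 < \<epsilon>'" "\<epsilon>' \<le> R" "\<epsilon>' \<le> \<epsilon> / C" using R \<epsilon> C by (auto simp: \<epsilon>'_def)
    have "\<exists>s0>0. \<forall>s. norm s < s0 \<longrightarrow> s \<noteq> 0 \<longrightarrow> (\<exists>x\<in>UNIV. norm x < \<epsilon>' \<and> x $ None = s \<and> (\<forall>f\<in>F'. f x = 0))"
    proof (rule analytic_meets_parallel_hyperplanes[OF vec.subspace_UNIV lin R(1)])
      show "ghol g (ball 0 R)" if "g \<in> F'" for g by (rule gh[OF that])
      show "\<exists>z\<in>UNIV. norm z < \<delta> \<and> z $ None \<noteq> 0 \<and> (\<forall>g\<in>F'. g z = 0)" if "0 < \<delta>" for \<delta> by (rule near[OF that])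
      show "0 < \<epsilon>'" by (rule \<epsilon>'(1))
    qed
    then obtain s0 where s0: "0 < s0" "\<And>s. norm s < s0 \<Longrightarrow> s \<noteq> 0 \<Longrightarrow> \<exists>x. norm x < \<epsilon>' \<and> x $ None = s \<and> (\<forall>f\<in>F'. f x = 0)" by auto
    have "\<forall>\<^sub>F i in sequentially. inverse (real (Suc i)) < s0"
      using order_tendstoD(2)[OF LIMSEQ_inverse_real_of_nat, of s0] s0(1) by simp
    then show ?thesis
    proof eventually_elim
      case (elim i)
      define s where "s = complex_of_real (inverse (real (Suc i)))"
      have ns: "norm s = inverse (real (Suc i))" unfolding s_def norm_of_real by simp
      have "norm s < s0" "s \<noteq> 0" "of_nat (Suc i) * s = 1" using elim ns by (simp_all add: s_def del: of_nat_Suc)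
      then obtain x where x: "norm x < \<epsilon>'" "x $ None = s" "\<forall>f\<in>F'. f x = 0" using s0(2) by blast
      have "\<Theta> x \<in> A" using F'A[of x] x \<epsilon>' by simp
      moreover have "of_nat (Suc i) *s \<Theta> x = v + L x"
        using \<open>of_nat (Suc i) * s = 1\<close> by (simp add: \<Theta>_def x(2) del: of_nat_Suc)
      moreover have "norm (L x) < \<epsilon>"
      proof -
        have "norm x < \<epsilon> / C" using x(1) \<epsilon>'(3) by linarith
        then have "C * norm x < \<epsilon>" using C(1) by (simp add: pos_less_divide_eq mult.commute)
        then show ?thesis using C(2)[of x] by linarith
      qed
      ultimately show ?case by (intro bexI[of _ "\<Theta> x"]) (simp_all add: dist_norm del: of_nat_Suc)
    qed
  qed
  then obtain a where "\<And>i. a i \<in> A" "(\<lambda>i. of_nat (Suc i) *s a i) \<longlonglongrightarrow> v"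
    using approximating_sequence[of A "\<lambda>i a. of_nat (Suc i) *s a" v] A(2) by blast
  then show ?thesis by (rule that)
qed

section \<open>Composition with holomorphic maps and rules for directional derivatives\<close>

lemma ghol_compose_holo_map:
  fixes \<Theta> :: "complex ^ 'm \<Rightarrow> complex ^ 'n"
  assumes f: "ghol f S" and \<Theta>: "holo_map_on \<Theta> S'" "\<And>p. p \<in> S' \<Longrightarrow> \<Theta> p \<in> S"
  shows "ghol (\<lambda>p. f (\<Theta> p)) S'"
proof (rule ghol_compose[OF f])
  show "open S'" using \<Theta>(1) by (simp add: holo_map_on_def)
  show "continuous_on S' \<Theta>"
    using \<Theta>(1) by (auto simp: holo_map_on_def intro!: continuous_at_imp_continuous_on dest!: has_derivative_continuous)
  fix p u :: "complex ^ 'm" assume p: "p \<in> S'"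
  then obtain D where D: "(\<Theta> has_derivative D) (at p)" "Vector_Spaces.linear (*s) (*s) D"
    using \<Theta>(1) by (auto simp: holo_map_on_def)
  interpret l: Vector_Spaces.linear "(*s)" "(*s)" D by fact
  have bl: "bounded_linear (\<lambda>\<zeta>. \<zeta> *s u)"
    by (rule bounded_bilinear.bounded_linear_left[OF bounded_bilinear_smult_vec])
  have 1: "((\<lambda>\<zeta>. p + \<zeta> *s u) has_derivative (\<lambda>\<zeta>. \<zeta> *s u)) (at 0)"
    using has_derivative_add[OF has_derivative_const bounded_linear.has_derivative[OF bl has_derivative_ident]] by simp
  have "(\<Theta> has_derivative D) (at (p + 0 *s u))" using D by simp
  from diff_chain_at[OF 1 this] show "\<exists>x. ((\<lambda>\<zeta>. \<Theta> (p + \<zeta> *s u)) has_derivative (\<lambda>\<zeta>. \<zeta> *s x)) (at 0)"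
    by (intro exI[of _ "D u"]) (simp add: o_def l.scale)
qed (rule \<Theta>(2))

lemma dder_compose:
  fixes \<Theta> :: "complex ^ 'm \<Rightarrow> complex ^ 'n"
  assumes f: "ghol f S" "\<Theta> y \<in> S" and \<Theta>: "(\<Theta> has_derivative D) (at y)"
    and k: "ghol k S'" "y \<in> S'" and eq: "\<And>x. x \<in> S' \<Longrightarrow> f (\<Theta> x) = k x"
  shows "dder k v y = dder f (D v) (\<Theta> y)"
proof -
  have "((\<lambda>x. f (\<Theta> x)) has_derivative (\<lambda>v. dder f (D v) (\<Theta> y))) (at y)"
    using diff_chain_at[OF \<Theta> ghol_has_derivative[OF f]] by (simp add: o_def)
  then have "(k has_derivative (\<lambda>v. dder f (D v) (\<Theta> y))) (at y)"
    by (rule has_derivative_transform_within_open[OF _ ghol_open[OF k(1)] k(2)]) (rule eq)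
  from has_derivative_unique[OF this ghol_has_derivative[OF k]] show ?thesis by metis
qed

lemma dder_sub: "ghol f S \<Longrightarrow> ghol g S \<Longrightarrow> p \<in> S \<Longrightarrow> dder (\<lambda>z. f z - g z) v p = dder f v p - dder g v p"
  unfolding dder_def by (rule deriv_diff) (auto simp: ghol_def)

lemma dder_cmult: "ghol f S \<Longrightarrow> p \<in> S \<Longrightarrow> dder (\<lambda>z. c * f z) v p = c * dder f v p"
  unfolding dder_def by (rule deriv_cmult) (auto simp: ghol_def)

lemma dder_sum:
  assumes "\<And>i. i \<in> I \<Longrightarrow> ghol (f i) S" "p \<in> S"
  shows "dder (\<lambda>z. \<Sum>i\<in>I. f i z) v p = (\<Sum>i\<in>I. dder (f i) v p)"
proof -
  have "((\<lambda>\<zeta>. \<Sum>i\<in>I. f i (p + \<zeta> *s v)) has_field_derivative (\<Sum>i\<in>I. dder (f i) v p)) (at 0)"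
    by (rule DERIV_sum) (use dder_has_derivative[OF assms(1), of _ p 0 v] assms(2) in simp)
  from DERIV_imp_deriv[OF this] show ?thesis unfolding dder_def .
qed

section \<open>Density of regular points\<close>

lemma clinear_inv:
  fixes L :: "complex ^ 'n \<Rightarrow> complex ^ 'n"
  assumes "Vector_Spaces.linear (*s) (*s) L" "bij L"
  shows "Vector_Spaces.linear (*s) (*s) (inv L)"
proof -
  interpret l: Vector_Spaces.linear "(*s)" "(*s)" L by fact
  have s: "L (inv L x) = x" for x using assms(2) by (simp add: bij_is_surj surj_f_inv_f)
  have i: "inv L (L x) = x" for x using assms(2) by (simp add: bij_is_inj)
  have "inv L (x + y) = inv L x + inv L y" for x y using i[of "inv L x + inv L y"] by (simp add: l.add s)
  moreover have "inv L (c *s x) = c *s inv L x" for c x using i[of "c *s inv L x"] by (simp add: l.scale s)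
  ultimately show ?thesis by unfold_locales simp_all
qed

text \<open>The vectors of a dual system are independent. This bounds the rank that
  \<open>regular_points_dense\<close> maximizes.\<close>

lemma dual_system_card:
  fixes l :: "nat \<Rightarrow> complex ^ 'n \<Rightarrow> complex" and b :: "nat \<Rightarrow> complex ^ 'n"
  assumes lin: "\<And>i. i < r \<Longrightarrow> Vector_Spaces.linear (*s) (*) (l i)"
    and dual: "\<And>i j. i < r \<Longrightarrow> j < r \<Longrightarrow> l i (b j) = (if i = j then 1 else 0)"
  shows "r \<le> CARD('n)"
proof -
  have inj: "inj_on b {..<r}"
  proof (rule inj_onI)
    fix i j assume ij: "i \<in> {..<r}" "j \<in> {..<r}" "b i = b j"
    have "l i (b j) = 1" using dual[of i i] ij by simp
    then show "i = j" using dual[of i j] ij by (auto split: if_splits)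
  qed
  have "vec.independent (b ` {..<r})"
  proof (rule vec.independent_if_scalars_zero)
    fix u x assume sum: "(\<Sum>x\<in>b ` {..<r}. u x *s x) = 0" and x: "x \<in> b ` {..<r}"
    then obtain i where i: "i < r" "x = b i" by auto
    interpret li: Vector_Spaces.linear "(*s)" "(*)" "l i" by (rule lin[OF i(1)])
    have "0 = l i (\<Sum>j<r. u (b j) *s b j)" using sum by (simp add: sum.reindex[OF inj] li.zero)
    also have "\<dots> = (\<Sum>j<r. u (b j) * l i (b j))" by (simp add: li.sum li.scale)
    also have "\<dots> = (\<Sum>j<r. if j = i then u (b j) else 0)" by (rule sum.cong) (auto simp: dual i)
    also have "\<dots> = u x" using i by simp
    finally show "u x = 0" by simp
  qed simp
  then have "card (b ` {..<r}) \<le> vec.dim (UNIV :: (complex ^ 'n) set)" by (intro vec.independent_card_le_dim) auto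
  then show ?thesis unfolding vec_dim_card card_image[OF inj] by simp
qed

text \<open>The iterated derivatives at \<open>y0\<close> are the Taylor data of \<open>h\<close> on
  the line \<open>y0 + \<zeta> *s e\<close>, and the disc of radius
  \<open>\<epsilon> / norm e\<close> contains \<zeta> = 1.\<close>

lemma iterated_dder_zero:
  fixes h :: "complex ^ 'n \<Rightarrow> complex"
  assumes h: "ghol h (ball y0 \<epsilon>)" and e: "norm e < \<epsilon>"
    and zero: "\<And>k. ((\<lambda>g. dder g e) ^^ k) h y0 = 0"
  shows "h (y0 + e) = 0"
proof (cases "e = 0")
  case True
  then show ?thesis using zero[of 0] by simp
next
  case False
  have gh: "ghol (((\<lambda>g. dder g e) ^^ k) h) (ball y0 \<epsilon>)" for k by (induction k) (auto intro: h ghol_dder)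
  define S where "S = ball (0 :: complex) (\<epsilon> / norm e)"
  have ne: "0 < norm e" using False by simp
  have inb: "y0 + \<zeta> *s e \<in> ball y0 \<epsilon>" if "\<zeta> \<in> S" for \<zeta>
    using that ne by (simp add: S_def dist_norm norm_smult_vec pos_less_divide_eq)
  define \<phi> where "\<phi> = (\<lambda>\<zeta>. h (y0 + \<zeta> *s e))"
  have hol: "\<phi> holomorphic_on S"
    unfolding \<phi>_def by (rule holomorphic_on_subset[OF ghol_line[OF h]]) (use inb in auto)
  have it: "(deriv ^^ k) \<phi> \<zeta> = ((\<lambda>g. dder g e) ^^ k) h (y0 + \<zeta> *s e)" if "\<zeta> \<in> S" for k \<zeta>
    using that
  proof (induction k arbitrary: \<zeta>)
    case (Suc k)
    have "\<forall>\<^sub>F x in nhds \<zeta>. x \<in> S" using Suc.prems by (intro eventually_nhds_in_open) (simp_all add: S_def)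
    then have "\<forall>\<^sub>F x in nhds \<zeta>. (deriv ^^ k) \<phi> x = ((\<lambda>g. dder g e) ^^ k) h (y0 + x *s e)"
      by eventually_elim (rule Suc.IH)
    then have "deriv ((deriv ^^ k) \<phi>) \<zeta> = deriv (\<lambda>x. ((\<lambda>g. dder g e) ^^ k) h (y0 + x *s e)) \<zeta>"
      by (intro deriv_cong_ev) auto
    also have "\<dots> = dder (((\<lambda>g. dder g e) ^^ k) h) e (y0 + \<zeta> *s e)"
      by (rule DERIV_imp_deriv[OF dder_has_derivative[OF gh inb[OF Suc.prems]]])
    finally show ?case by simp
  qed (simp add: \<phi>_def)
  have S: "open S" "connected S" "0 \<in> S" "1 \<in> S" using ne e order.strict_trans1[OF norm_ge_zero e] by (auto simp: S_def)
  have "\<phi> 1 = 0"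
  proof (rule holomorphic_fun_eq_0_on_connected[OF hol S(1,2)])
    show "(deriv ^^ n) \<phi> 0 = 0" for n using it[OF S(3), of n] zero[of n] by simp
  qed (use S in auto)
  then show ?thesis by (simp add: \<phi>_def)
qed

text \<open>At a point where the rank \<open>r\<close>
  of the functions vanishing on \<open>Y\<close> is maximal, \<open>r\<close> of them cut out a submanifold containing \<open>Y\<close>. By maximality
  the functions vanishing on \<open>Y\<close> are closed under tangential derivatives, so they vanish on the submanifold.\<close>

lemma regular_points_dense:
  fixes Y :: "(complex ^ 'n) set"
  assumes Y: "\<And>v. v \<notin> Y \<Longrightarrow> \<exists>G. ghol G UNIV \<and> (\<forall>y\<in>Y. G y = 0) \<and> G v \<noteq> 0"
    and O: "open O'" "q \<in> O'" "q \<in> Y"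
  shows "\<exists>p\<in>O'. \<exists>d. regular_point_dim Y p d"
proof -
  \<comment> \<open>Rank at least \<open>r\<close> at \<open>p\<close>, for functions vanishing on
    \<open>Y\<close> near \<open>p\<close>, is expressed by vectors \<open>b\<close> dual to their
    differentials.\<close>
  define Pr where "Pr = (\<lambda>r p. p \<in> Y \<and> p \<in> O' \<and> (\<exists>g b W. open W \<and> p \<in> W \<and>
    (\<forall>i<r. ghol (g i) W \<and> (\<forall>y\<in>Y \<inter> W. g i y = 0)) \<and>
    (\<forall>i<r. \<forall>j<r. dder (g i) (b j) p = (if i = (j :: nat) then 1 else 0))))"
  have bound: "r \<le> CARD('n)" if "Pr r p" for r p
  proof -
    from that obtain g b W where g: "p \<in> W" "\<And>i. i < r \<Longrightarrow> ghol (g i) W"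
      "\<And>i j. i < r \<Longrightarrow> j < r \<Longrightarrow> dder (g i) (b j) p = (if i = j then 1 else 0)" unfolding Pr_def by blast
    show ?thesis
    proof (rule dual_system_card[of r "\<lambda>i v. dder (g i) v p" b])
      show "Vector_Spaces.linear (*s) (*) (\<lambda>v. dder (g i) v p)" if "i < r" for i
        by (rule dder_linear[OF g(2)[OF that] g(1)])
    qed (rule g(3))
  qed
  have "Pr 0 q" using O by (auto simp: Pr_def intro!: exI[of _ UNIV])
  then have P0: "\<exists>p. Pr 0 p" ..
  have bd: "\<forall>r. (\<exists>p. Pr r p) \<longrightarrow> r < Suc CARD('n)" using bound by (simp add: less_Suc_eq_le) blast
  from ex_has_greatest_nat[of "\<lambda>r. \<exists>p. Pr r p" 0 "\<lambda>r. r", OF P0 bd]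
  obtain r where r: "\<exists>p. Pr r p" "\<forall>r'. (\<exists>p. Pr r' p) \<longrightarrow> r' \<le> r" by auto
  then obtain p where rp: "Pr r p" by blast
  have rmax: "r' \<le> r" if "Pr r' p'" for r' p' using r(2) that by blast
  from rp obtain g b W0 where pY: "p \<in> Y" "p \<in> O'" and W0: "open W0" "p \<in> W0"
    and g0: "\<And>i. i < r \<Longrightarrow> ghol (g i) W0" and gY: "\<And>i y. i < r \<Longrightarrow> y \<in> Y \<Longrightarrow> y \<in> W0 \<Longrightarrow> g i y = 0"
    and dual: "\<And>i j. i < r \<Longrightarrow> j < r \<Longrightarrow> dder (g i) (b j) p = (if i = j then 1 else 0)"
    unfolding Pr_def by blast
  define W where "W = W0 \<inter> O'"
  have W: "open W" "p \<in> W" "W \<subseteq> W0" "W \<subseteq> O'" using W0 O pY by (auto simp: W_def)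
  have g: "ghol (g i) W" if "i < r" for i by (rule ghol_subset[OF g0[OF that] W(3,1)])
  define l where "l = (\<lambda>i v. dder (g i) v p)"
  have llin: "Vector_Spaces.linear (*s) (*) (l i)" if "i < r" for i
    unfolding l_def by (rule dder_linear[OF g[OF that] W(2)])
  \<comment> \<open>The components dual to \<open>b\<close> are replaced by the functions
    \<open>g i\<close>, so that the derivative at \<open>p\<close> is the identity and
    \<open>l i\<close> composed with \<Phi> is \<open>g i\<close>. The zero set of the
    \<open>g i\<close> becomes the linear space \<open>L\<close>.\<close>
  define \<Phi> where "\<Phi> = (\<lambda>z. z - (\<Sum>i<r. l i z *s b i) + (\<Sum>i<r. g i z *s b i))"
  define D where "D = (\<lambda>z v. v - (\<Sum>i<r. l i v *s b i) + (\<Sum>i<r. dder (g i) v z *s b i))"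
  have Dlin: "Vector_Spaces.linear (*s) (*s) (D z)" if "z \<in> W" for z
  proof -
    have 1: "l i (x + y) = l i x + l i y" "l i (c *s x) = c * l i x" if "i < r" for i c x y
      using dder_add[OF g[OF that] W(2)] dder_scale[OF g[OF that] W(2)] by (simp_all add: l_def)
    have 2: "dder (g i) (x + y) z = dder (g i) x z + dder (g i) y z" "dder (g i) (c *s x) z = c * dder (g i) x z" if "i < r" for i c x y
      using dder_add[OF g[OF that] \<open>z \<in> W\<close>] dder_scale[OF g[OF that] \<open>z \<in> W\<close>] by simp_all
    show ?thesis unfolding D_def
      by unfold_locales
        (simp_all add: 1 2 vec.scale_left_distrib sum.distrib vec.scale_right_distrib vec.scale_right_diff_distrib vec.scale_sum_right)
  qed
  have D: "(\<Phi> has_derivative D z) (at z)" if "z \<in> W" for z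
  proof -
    have bl: "bounded_linear (\<lambda>\<zeta>. \<zeta> *s y)" for y :: "complex ^ 'n"
      by (rule bounded_bilinear.bounded_linear_left[OF bounded_bilinear_smult_vec])
    have 1: "((\<lambda>z. l i z *s b i) has_derivative (\<lambda>v. l i v *s b i)) (at z)" if "i < r" for i
      by (rule bounded_linear.has_derivative[OF bl bounded_linear_imp_has_derivative[OF clinear_functional_bounded[OF llin[OF that]]]])
    have 2: "((\<lambda>z. g i z *s b i) has_derivative (\<lambda>v. dder (g i) v z *s b i)) (at z)" if "i < r" for i
      by (rule bounded_linear.has_derivative[OF bl ghol_has_derivative[OF g[OF that] \<open>z \<in> W\<close>]])
    show ?thesis unfolding \<Phi>_def D_def
      by (intro has_derivative_add has_derivative_diff has_derivative_ident has_derivative_sum 1 2) auto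
  qed
  define f' where "f' = (\<lambda>z. Blinfun (D z))"
  have f': "blinfun_apply (f' z) = D z" if "z \<in> W" for z
    unfolding f'_def using clinear_scaleR[OF Dlin[OF that]] by (simp add: bounded_linear_Blinfun_apply)
  have Dp: "D p v = v" for v by (simp add: D_def l_def)
  have contf': "continuous_on W f'"
  proof (rule continuous_on_blinfun_componentwise)
    fix k :: "complex ^ 'n"
    have "continuous_on W (\<lambda>z. D z k)" unfolding D_def
      by (intro continuous_intros ghol_continuous[OF ghol_dder[OF g]]) auto
    then show "continuous_on W (\<lambda>z. f' z k)" by (rule continuous_on_eq) (simp add: f')
  qed
  have inv: "id_blinfun o\<^sub>L f' p = id_blinfun"
    by (rule blinfun_eqI) (simp add: f'[OF W(2)] Dp)
  obtain U' V \<psi> \<psi>' where U': "open U'" "U' \<subseteq> W" "p \<in> U'" and V: "open V" "\<Phi> p \<in> V" and hom: "homeomorphism U' V \<Phi> \<psi>"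
    and \<psi>der: "\<And>y. y \<in> V \<Longrightarrow> (\<psi> has_derivative \<psi>' y) (at y)"
    and \<psi>'eq: "\<And>y. y \<in> V \<Longrightarrow> \<psi>' y = inv (blinfun_apply (f' (\<psi> y)))"
    and bij: "\<And>y. y \<in> V \<Longrightarrow> bij (blinfun_apply (f' (\<psi> y)))"
  proof (rule inverse_function_theorem[OF W(1) _ contf' W(2) inv])
    show "(\<Phi> has_derivative blinfun_apply (f' z)) (at z)" if "z \<in> W" for z
      using D[OF that] by (simp only: f'[OF that])
  qed (rule that)
  have \<psi>U: "\<psi> y \<in> U'" "\<Phi> (\<psi> y) = y" if "y \<in> V" for y using hom that by (auto simp: homeomorphism_def)
  have \<Phi>V: "\<Phi> z \<in> V" "\<psi> (\<Phi> z) = z" if "z \<in> U'" for z using hom that by (auto simp: homeomorphism_def)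
  have \<psi>'lin: "Vector_Spaces.linear (*s) (*s) (\<psi>' y)" if "y \<in> V" for y
  proof -
    have "\<psi> y \<in> W" using \<psi>U(1)[OF that] U'(2) by blast
    then show ?thesis using \<psi>'eq[OF that] bij[OF that] f' by (simp add: clinear_inv[OF Dlin])
  qed
  define L where "L = {y. \<forall>i<r. l i y = 0}"
  have Lsub: "vec.subspace L"
  proof -
    have 1: "l i (x + y) = l i x + l i y" "l i (c *s x) = c * l i x" "l i 0 = 0" if "i < r" for i c x y
      using dder_add[OF g[OF that] W(2)] dder_scale[OF g[OF that] W(2)] dder_scale[OF g[OF that] W(2), of 0 0] by (simp_all add: l_def)
    show ?thesis by (auto simp: vec.subspace_def L_def 1)
  qed
  have lb: "l i (b j) = (if i = j then 1 else 0)" if "i < r" "j < r" for i j using dual[OF that] by (simp add: l_def)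
  have l\<Phi>: "l i (\<Phi> z) = g i z" if i: "i < r" for i z
  proof -
    interpret li: Vector_Spaces.linear "(*s)" "(*)" "l i" by (rule llin[OF i])
    have s: "(\<Sum>j<r. c j * l i (b j)) = c i" for c
    proof -
      have "(\<Sum>j<r. c j * l i (b j)) = (\<Sum>j<r. if j = i then c j else 0)"
        by (rule sum.cong) (auto simp: lb i)
      then show ?thesis using i by simp
    qed
    show ?thesis unfolding \<Phi>_def by (simp add: li.add li.diff li.sum li.scale s)
  qed
  obtain \<epsilon> where \<epsilon>: "0 < \<epsilon>" "ball (\<Phi> p) \<epsilon> \<subseteq> V" using openE[OF V] by blast
  \<comment> \<open>A ball, so that every point is reached from \<open>\<Phi> p\<close> by a Taylor
    expansion along one line.\<close>
  define W1 where "W1 = ball (\<Phi> p) \<epsilon>"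
  define V1 where "V1 = \<psi> ` W1"
  have W1V: "W1 \<subseteq> V" using \<epsilon> by (simp add: W1_def)
  have V1U: "V1 \<subseteq> U'" using \<psi>U(1) W1V by (auto simp: V1_def)
  have V1eq: "V1 = U' \<inter> \<Phi> -` W1"
  proof
    show "V1 \<subseteq> U' \<inter> \<Phi> -` W1"
    proof
      fix z assume "z \<in> V1"
      then obtain y where y: "y \<in> W1" "z = \<psi> y" by (auto simp: V1_def)
      then show "z \<in> U' \<inter> \<Phi> -` W1" using \<psi>U[of y] W1V by auto
    qed
    show "U' \<inter> \<Phi> -` W1 \<subseteq> V1"
    proof
      fix z assume "z \<in> U' \<inter> \<Phi> -` W1"
      then show "z \<in> V1" using \<Phi>V(2)[of z] by (auto simp: V1_def intro!: image_eqI[of _ _ "\<Phi> z"])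
    qed
  qed
  have "continuous_on U' \<Phi>" using hom by (simp add: homeomorphism_def)
  then have oV1: "open V1" unfolding V1eq by (intro continuous_open_preimage U'(1)) (simp_all add: W1_def)
  have pV1: "p \<in> V1" unfolding V1eq using U'(3) \<epsilon>(1) by (simp add: W1_def)
  have hom1: "homeomorphism V1 W1 \<Phi> \<psi>"
  proof (rule homeomorphism_of_subsets[OF hom V1U W1V])
    show "\<Phi> ` V1 = W1"
    proof
      show "\<Phi> ` V1 \<subseteq> W1" unfolding V1eq by auto
      show "W1 \<subseteq> \<Phi> ` V1"
      proof
        fix y assume "y \<in> W1"
        then have "\<psi> y \<in> V1" "\<Phi> (\<psi> y) = y" using \<psi>U(2)[of y] W1V by (auto simp: V1_def)
        then show "y \<in> \<Phi> ` V1" by (metis imageI)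
      qed
    qed
  qed
  have V1W: "V1 \<subseteq> W" using V1U U'(2) by blast
  have holo\<Phi>: "holo_map_on \<Phi> V1" unfolding holo_map_on_def using oV1 D Dlin V1W by blast
  have holo\<psi>: "holo_map_on \<psi> W1" unfolding holo_map_on_def using \<psi>der \<psi>'lin W1V by (auto simp: W1_def)
  have \<psi>V1: "\<psi> y \<in> V1" if "y \<in> W1" for y using that by (simp add: V1_def)
  have \<Phi>W1: "\<Phi> z \<in> W1" if "z \<in> V1" for z using that by (simp add: V1eq)
  \<comment> \<open>A nonzero derivative along \<open>L\<close> at a point of \<open>Y\<close> would
    make \<open>h\<close> independent of the \<open>g i\<close> there, giving rank
    \<open>r + 1\<close>.\<close>
  have tang: "dder h e y = 0"
    if h: "ghol h W1" "\<And>y. y \<in> W1 \<Longrightarrow> \<psi> y \<in> Y \<Longrightarrow> h y = 0" and e: "e \<in> L" and y: "y \<in> W1" "\<psi> y \<in> Y" for h e y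
  proof (rule ccontr)
    assume nz: "dder h e y \<noteq> 0"
    define z where "z = \<psi> y"
    have z: "z \<in> V1" "z \<in> Y" using \<psi>V1[OF y(1)] y(2) by (simp_all add: z_def)
    have yV: "y \<in> V" using y(1) W1V by blast
    define k where "k = (\<lambda>x. h (\<Phi> x))"
    have ghk: "ghol k V1" unfolding k_def by (rule ghol_compose_holo_map[OF h(1) holo\<Phi>]) (rule \<Phi>W1)
    have gV1: "ghol (g i) V1" if "i < r" for i by (rule ghol_subset[OF g[OF that] V1W oV1])
    have dg: "dder (g i) (\<psi>' y v) z = l i v" if i: "i < r" for i v
    proof -
      interpret li: Vector_Spaces.linear "(*s)" "(*)" "l i" by (rule llin[OF i])
      have "dder (l i) v y = dder (g i) (\<psi>' y v) (\<psi> y)"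
      proof (rule dder_compose[OF gV1[OF i] \<psi>V1[OF y(1)] \<psi>der[OF yV]])
        show "ghol (l i) W1" by (rule ghol_functional[OF llin[OF i]]) (simp add: W1_def)
        show "g i (\<psi> x) = l i x" if "x \<in> W1" for x using l\<Phi>[OF i, of "\<psi> x"] \<psi>U(2)[of x] that W1V by auto
      qed (rule y(1))
      moreover have "dder (l i) v y = l i v"
      proof -
        have "((\<lambda>\<zeta>. l i (y + \<zeta> *s v)) has_field_derivative l i v) (at 0)"
          unfolding li.add li.scale by (auto intro!: derivative_eq_intros)
        then show ?thesis unfolding dder_def by (rule DERIV_imp_deriv)
      qed
      ultimately show ?thesis by (simp add: z_def)
    qed
    have dk: "dder k (\<psi>' y v) z = dder h v y" for v
    proof -
      have "dder h v y = dder k (\<psi>' y v) (\<psi> y)"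
      proof (rule dder_compose[OF ghk \<psi>V1[OF y(1)] \<psi>der[OF yV] h(1) y(1)])
        show "k (\<psi> x) = h x" if "x \<in> W1" for x using \<psi>U(2)[of x] that W1V by (auto simp: k_def)
      qed
      then show ?thesis by (simp add: z_def)
    qed
    \<comment> \<open>Subtracting \<beta>-multiples of the \<open>g j\<close> from \<open>k\<close>
      removes its derivatives along the transported \<open>b j\<close>, and division by \<kappa>
      normalises the one along the transported \<open>e\<close>. As \<open>e\<close> lies in
      \<open>L\<close>, the \<open>g i\<close> have derivative 0 along the latter, so the enlarged
      system is dual.\<close>
    define \<beta> where "\<beta> = (\<lambda>j. dder h (b j) y)"
    define \<kappa> where "\<kappa> = dder h e y"
    define gs where "gs = (\<lambda>x. \<Sum>j<r. \<beta> j * g j x)"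
    define gn where "gn = (\<lambda>x. inverse \<kappa> * (k x - gs x))"
    have ghs: "ghol gs V1" unfolding gs_def by (intro ghol_sum ghol_mult ghol_const oV1 gV1) auto
    have dgs: "dder gs v z = (\<Sum>j<r. \<beta> j * dder (g j) v z)" for v
    proof -
      have "dder gs v z = (\<Sum>j<r. dder (\<lambda>x. \<beta> j * g j x) v z)"
        unfolding gs_def by (rule dder_sum[OF _ z(1)]) (intro ghol_mult ghol_const oV1 gV1, auto)
      also have "\<dots> = (\<Sum>j<r. \<beta> j * dder (g j) v z)"
        by (rule sum.cong) (auto intro: dder_cmult[OF gV1 z(1)])
      finally show ?thesis .
    qed
    have ghn: "ghol gn V1" unfolding gn_def by (intro ghol_mult ghol_const oV1 ghol_diff ghk ghs)
    have dgn: "dder gn v z = inverse \<kappa> * (dder k v z - dder gs v z)" for v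
      unfolding gn_def using dder_cmult[OF ghol_diff[OF ghk ghs] z(1)] dder_sub[OF ghk ghs z(1)] by simp
    have le: "l i e = 0" if "i < r" for i using e that by (simp add: L_def)
    define g' where "g' = (\<lambda>i. if i < r then g i else gn)"
    define b' where "b' = (\<lambda>j. \<psi>' y (if j < r then b j else e))"
    have "Pr (Suc r) z"
      unfolding Pr_def
    proof (intro conjI exI[of _ g'] exI[of _ b'] exI[of _ V1] allI impI ballI)
      show "z \<in> O'" using z(1) V1W W(4) by blast
      show "ghol (g' i) V1" if "i < Suc r" for i using gV1 ghn by (simp add: g'_def)
      show "g' i x = 0" if "i < Suc r" "x \<in> Y \<inter> V1" for i x
      proof (cases "i < r")
        case True
        then show ?thesis using gY[OF True, of x] that(2) V1W W(3) by (auto simp: g'_def)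
      next
        case False
        have "x \<in> U'" using that(2) V1U by blast
        then have "k x = 0" using h(2)[OF \<Phi>W1, of x] that(2) \<Phi>V(2)[of x] by (simp add: k_def)
        moreover have "gs x = 0" unfolding gs_def
          by (rule sum.neutral) (use gY that(2) V1W W(3) in auto)
        ultimately show ?thesis using False by (simp add: g'_def gn_def)
      qed
      show "dder (g' i) (b' j) z = (if i = j then 1 else 0)" if ij: "i < Suc r" "j < Suc r" for i j
      proof (cases "i < r")
        case True
        then show ?thesis using ij lb[OF True] le[OF True] by (auto simp: g'_def b'_def dg)
      next
        case False
        then have i: "i = r" using ij by simp
        show ?thesis
        proof (cases "j < r")
          case True
          have "dder gs (\<psi>' y (b j)) z = (\<Sum>m<r. if m = j then \<beta> m else 0)"
            unfolding dgs by (rule sum.cong) (auto simp: dg lb True)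
          then have "dder gs (\<psi>' y (b j)) z = \<beta> j" using True by simp
          then show ?thesis using True i by (simp add: g'_def b'_def dgn dk \<beta>_def)
        next
          case False
          then have j: "j = r" using ij by simp
          have "dder gs (\<psi>' y e) z = 0" unfolding dgs by (rule sum.neutral) (auto simp: dg le)
          then show ?thesis using i j nz by (simp add: g'_def b'_def dgn dk \<kappa>_def)
        qed
      qed
    qed (use z oV1 in auto)
    then show False using rmax by fastforce
  qed
  \<comment> \<open>A separating function composed with \<psi> would, by iterating
    \<open>tang\<close>, have all derivatives along \<open>y - \<Phi> p\<close> equal to 0 at
    \<open>\<Phi> p\<close>, hence vanish at \<open>y\<close>.\<close>
  have LY: "\<psi> y \<in> Y" if y: "y \<in> W1" "y \<in> L" for y
  proof (rule ccontr)
    assume "\<psi> y \<notin> Y"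
    then obtain G where G: "ghol G UNIV" "\<And>x. x \<in> Y \<Longrightarrow> G x = 0" "G (\<psi> y) \<noteq> 0" using Y by blast
    define h where "h = (\<lambda>x. G (\<psi> x))"
    have gh: "ghol h W1" unfolding h_def by (rule ghol_compose_holo_map[OF G(1) holo\<psi>]) simp
    define e where "e = y - \<Phi> p"
    have "\<Phi> p \<in> L" using l\<Phi> gY pY W0 by (simp add: L_def)
    then have e: "e \<in> L" unfolding e_def using y(2) by (intro vec.subspace_diff[OF Lsub])
    have it: "ghol (((\<lambda>g. dder g e) ^^ k) h) W1 \<and> (\<forall>x\<in>W1. \<psi> x \<in> Y \<longrightarrow> ((\<lambda>g. dder g e) ^^ k) h x = 0)" for k
    proof (induction k)
      case 0
      then show ?case using gh G(2) by (simp add: h_def)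
    next
      case (Suc k)
      then show ?case using tang[OF _ _ e] ghol_dder by auto
    qed
    have "h (\<Phi> p + e) = 0"
    proof (rule iterated_dder_zero[where \<epsilon> = \<epsilon>])
      show "ghol h (ball (\<Phi> p) \<epsilon>)" using gh by (simp add: W1_def)
      show "norm e < \<epsilon>" using y(1) by (simp add: e_def W1_def dist_norm norm_minus_commute)
      show "((\<lambda>g. dder g e) ^^ k) h (\<Phi> p) = 0" for k
        using it[of k] \<Phi>W1[OF pV1] \<Phi>V(2)[OF U'(3)] pY by simp
    qed
    then show False using G(3) by (simp add: e_def h_def)
  qed
  have img: "\<Phi> ` (Y \<inter> V1) = W1 \<inter> L"
  proof
    show "\<Phi> ` (Y \<inter> V1) \<subseteq> W1 \<inter> L"
    proof clarify
      fix x assume x: "x \<in> Y" "x \<in> V1"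
      have "x \<in> W0" using x(2) V1W W(3) by blast
      then show "\<Phi> x \<in> W1 \<inter> L" using \<Phi>W1[OF x(2)] l\<Phi> gY x(1) by (simp add: L_def)
    qed
    show "W1 \<inter> L \<subseteq> \<Phi> ` (Y \<inter> V1)"
    proof
      fix y assume y: "y \<in> W1 \<inter> L"
      then have "\<psi> y \<in> Y \<inter> V1" using LY \<psi>V1 by blast
      moreover have "y = \<Phi> (\<psi> y)" using \<psi>U(2)[of y] y W1V by auto
      ultimately show "y \<in> \<Phi> ` (Y \<inter> V1)" by (rule rev_image_eqI)
    qed
  qed
  have "regular_point_dim Y p (vec.dim L)"
    unfolding regular_point_dim_def
    by (intro conjI pY exI[of _ V1] exI[of _ W1] exI[of _ \<Phi>] exI[of _ \<psi>] exI[of _ L])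
       (use oV1 pV1 holo\<Phi> holo\<psi> hom1 Lsub img in \<open>auto simp: W1_def\<close>)
  then show ?thesis using pY(2) by blast
qed

section \<open>Dimension and blow-ups of bi-Lipschitz germs\<close>

text \<open>Invariance of dimension speaks of real dimension. Each complex direction
  \<open>w\<close> added to the kernel contributes the two real directions \<open>w\<close> and
  \<open>\<i> *s w\<close>.\<close>

lemma real_dim_eq_twice_complex_dim:
  fixes L :: "(complex ^ 'n) set"
  assumes "vec.subspace L"
  shows "dim L = 2 * vec.dim L"
  using assms
proof (induction "vec.dim L" arbitrary: L rule: less_induct)
  case less
  show ?case
  proof (cases "L \<subseteq> {0}")
    case True
    then have L: "L = {0}" using vec.subspace_0[OF less.prems] by blast
    have "vec.dim L \<le> 0" using vec.dim_le_card[of L "{}"] by (simp add: L)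
    moreover have "dim L = 0" by (simp add: L dim_eq_0)
    ultimately show ?thesis by linarith
  next
    case False
    then obtain w where w: "w \<in> L" "w \<noteq> 0" by blast
    obtain \<tau> where \<tau>: "Vector_Spaces.linear (*s) (*) \<tau>" "\<tau> w = 1" by (rule exists_dual_functional[OF w(2)])
    interpret l: Vector_Spaces.linear "(*s)" "(*)" \<tau> by (rule \<tau>(1))
    define L' where "L' = {z\<in>L. \<tau> z = 0}"
    have L': "vec.subspace L'" unfolding L'_def by (rule subspace_kernel[OF \<tau>(1) less.prems])
    have lt: "vec.dim L' < vec.dim L" unfolding L'_def by (rule dim_kernel_less[OF \<tau>(1) less.prems w(1)]) (simp add: \<tau>)
    have rsub: "subspace S" if "vec.subspace S" for S :: "(complex ^ 'n) set"
      using that unfolding subspace_def vec.subspace_def by (metis smult_of_real_vec)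
    have proj: "z - \<tau> z *s w \<in> L'" if "z \<in> L" for z
      unfolding L'_def using that w(1) \<tau>(2)
      by (auto simp: l.diff l.scale intro!: vec.subspace_diff[OF less.prems] vec.subspace_scale[OF less.prems])
    have cspan: "vec.span (insert w L') = L"
    proof
      show "vec.span (insert w L') \<subseteq> L" by (rule vec.span_minimal) (use w less.prems in \<open>auto simp: L'_def\<close>)
      show "L \<subseteq> vec.span (insert w L')"
        unfolding vec.span_insert using proj vec.span_base[of _ L'] by blast
    qed
    have "w \<notin> vec.span L'" using L' \<tau>(2) by (simp add: vec.span_eq_iff[THEN iffD2] L'_def)
    then have cdim: "vec.dim L = vec.dim L' + 1" using vec.dim_insert[of w L'] vec.dim_span[of "insert w L'"] cspan by simp
    have spL': "span L' = L'" using rsub[OF L'] by (simp add: span_eq_iff)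
    let ?iw = "\<i> *s w"
    have rspan: "span (insert w (insert ?iw L')) = L"
    proof
      show "span (insert w (insert ?iw L')) \<subseteq> L"
        by (rule span_minimal) (use w less.prems rsub in \<open>auto simp: L'_def intro: vec.subspace_scale\<close>)
      show "L \<subseteq> span (insert w (insert ?iw L'))"
      proof
        fix z assume z: "z \<in> L"
        have eq: "z - Re (\<tau> z) *\<^sub>R w - Im (\<tau> z) *\<^sub>R ?iw = z - \<tau> z *s w"
        proof -
          have "Re (\<tau> z) *\<^sub>R w + Im (\<tau> z) *\<^sub>R ?iw = (of_real (Re (\<tau> z)) + of_real (Im (\<tau> z)) * \<i>) *s w"
            by (simp add: vec.scale_left_distrib flip: smult_of_real_vec)
          also have "of_real (Re (\<tau> z)) + of_real (Im (\<tau> z)) * \<i> = \<tau> z" by (simp add: complex_eq_iff)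
          finally show ?thesis by (simp add: diff_diff_eq)
        qed
        have "z - Re (\<tau> z) *\<^sub>R w - Im (\<tau> z) *\<^sub>R ?iw \<in> span L'"
          unfolding eq spL' by (rule proj[OF z])
        then show "z \<in> span (insert w (insert ?iw L'))" unfolding span_insert by blast
      qed
    qed
    have iw: "?iw \<notin> span L'" unfolding spL' using \<tau>(2) by (simp add: L'_def l.scale)
    have "w \<notin> span (insert ?iw L')"
    proof
      assume "w \<in> span (insert ?iw L')"
      then obtain k where "w - k *\<^sub>R ?iw \<in> L'" unfolding span_insert spL' by blast
      then have "\<tau> (w - k *\<^sub>R ?iw) = 0" by (simp add: L'_def)
      then have "1 - of_real k * \<i> = 0" by (simp add: l.diff l.scale \<tau>(2) flip: smult_of_real_vec)
      then show False by (simp add: complex_eq_iff)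
    qed
    then have "dim L = dim L' + 2" using dim_insert[of w "insert ?iw L'"] dim_insert[of ?iw L'] iw dim_span[of "insert w (insert ?iw L')"] rspan by simp
    then show ?thesis using less.hyps[OF lt L'] cdim by simp
  qed
qed

lemma regular_chart_openin:
  assumes hom: "homeomorphism V W \<phi> \<psi>" and oV: "open V" "open W" and img: "\<phi> ` (Y \<inter> V) = W \<inter> L"
    and S: "openin (top_of_set Y) S" "S \<subseteq> V"
  shows "openin (top_of_set L) (\<phi> ` S)" "\<phi> ` S \<subseteq> W \<inter> L"
proof -
  obtain T where T: "open T" "S = Y \<inter> T" using S(1) by (auto simp: openin_open)
  have inv: "\<psi> (\<phi> x) = x" "\<phi> x \<in> W" if "x \<in> V" for x using hom that by (auto simp: homeomorphism_def)
  have inv': "\<phi> (\<psi> y) = y" "\<psi> y \<in> V" if "y \<in> W" for y using hom that by (auto simp: homeomorphism_def)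
  show sub: "\<phi> ` S \<subseteq> W \<inter> L" using S(2) T(2) img by blast
  have "\<phi> ` S = L \<inter> (W \<inter> \<psi> -` T)"
  proof
    show "\<phi> ` S \<subseteq> L \<inter> (W \<inter> \<psi> -` T)"
    proof
      fix y assume y: "y \<in> \<phi> ` S"
      then obtain x where x: "x \<in> S" "y = \<phi> x" by blast
      then show "y \<in> L \<inter> (W \<inter> \<psi> -` T)" using y sub inv[of x] S(2) T(2) by auto
    qed
    show "L \<inter> (W \<inter> \<psi> -` T) \<subseteq> \<phi> ` S"
    proof
      fix y assume y: "y \<in> L \<inter> (W \<inter> \<psi> -` T)"
      then have "y \<in> \<phi> ` (Y \<inter> V)" using img by blast
      then obtain x where x: "x \<in> Y" "x \<in> V" "y = \<phi> x" by blast
      then have "x \<in> T" using y inv[of x] by auto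
      then show "y \<in> \<phi> ` S" using x T(2) by blast
    qed
  qed
  moreover have "open (W \<inter> \<psi> -` T)"
    using hom oV T(1) by (intro continuous_open_preimage) (auto simp: homeomorphism_def)
  ultimately show "openin (top_of_set L) (\<phi> ` S)" by (auto simp: openin_open)
qed

text \<open>The image of \<open>p\<close> may be singular, but by density the open image of its
  chart contains a regular point \<open>p'\<close> of \<open>Y2\<close>. The linear models at
  \<open>p\<close> and \<open>p'\<close> are compared on a common relatively open piece, and
  invariance of dimension in both directions gives equality.\<close>

lemma regular_dim_transfer:
  fixes Y1 Y2 :: "(complex ^ 'n) set"
  assumes hom: "homeomorphism Y1 Y2 f g" and reg: "regular_point_dim Y1 p d"
    and dense: "\<And>O' q. open O' \<Longrightarrow> q \<in> O' \<Longrightarrow> q \<in> Y2 \<Longrightarrow> \<exists>p\<in>O'. \<exists>d. regular_point_dim Y2 p d"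
  shows "\<exists>p'. regular_point_dim Y2 p' d"
proof -
  obtain V W L and \<phi> \<psi> :: "complex ^ 'n \<Rightarrow> complex ^ 'n" where p: "p \<in> Y1" "p \<in> V" and oV: "open V" "open W" and h1: "homeomorphism V W \<phi> \<psi>"
    and L: "vec.subspace L" "vec.dim L = d" and img: "\<phi> ` (Y1 \<inter> V) = W \<inter> L"
    using reg unfolding regular_point_dim_def by blast
  have "openin (top_of_set Y2) (f ` (Y1 \<inter> V))"
    by (rule homeomorphism_imp_open_map[OF hom]) (use oV in \<open>simp add: openin_open_Int\<close>)
  then obtain T where T: "open T" "f ` (Y1 \<inter> V) = Y2 \<inter> T" by (auto simp: openin_open)
  have "f p \<in> Y2 \<inter> T" using T(2) p by blast
  then obtain p' e where p': "p' \<in> T" and reg2: "regular_point_dim Y2 p' e" using dense[OF T(1)] by blast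
  obtain V2 W2 L2 and \<phi>2 \<psi>2 :: "complex ^ 'n \<Rightarrow> complex ^ 'n" where p2: "p' \<in> Y2" "p' \<in> V2" and oV2: "open V2" "open W2" and h2: "homeomorphism V2 W2 \<phi>2 \<psi>2"
    and L2: "vec.subspace L2" "vec.dim L2 = e" and img2: "\<phi>2 ` (Y2 \<inter> V2) = W2 \<inter> L2"
    using reg2 unfolding regular_point_dim_def by blast
  have fg: "g (f x) = x" "f x \<in> Y2" if "x \<in> Y1" for x using hom that by (auto simp: homeomorphism_def)
  have gf: "f (g y) = y" "g y \<in> Y1" if "y \<in> Y2" for y using hom that by (auto simp: homeomorphism_def)
  define S2 where "S2 = Y2 \<inter> (T \<inter> V2)"
  have S2: "openin (top_of_set Y2) S2" "S2 \<subseteq> V2" "S2 \<subseteq> Y2" "p' \<in> S2"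
  proof -
    show "openin (top_of_set Y2) S2" unfolding S2_def by (rule openin_open_Int[OF open_Int[OF T(1) oV2(1)]])
    show "p' \<in> S2" unfolding S2_def by (intro IntI p' p2)
  qed (auto simp: S2_def)
  define S1 where "S1 = g ` S2"
  have S1: "openin (top_of_set Y1) S1"
    unfolding S1_def by (rule homeomorphism_imp_open_map[OF homeomorphism_sym[THEN iffD1, OF hom] S2(1)])
  have S1V: "S1 \<subseteq> V" "S1 \<subseteq> Y1"
  proof -
    have "g y \<in> Y1 \<inter> V" if "y \<in> S2" for y
    proof -
      have "y \<in> f ` (Y1 \<inter> V)" using that unfolding T(2) S2_def by blast
      then show ?thesis using fg(1) by auto
    qed
    then show "S1 \<subseteq> V" "S1 \<subseteq> Y1" by (auto simp: S1_def)
  qed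
  have fS1: "f ` S1 = S2"
  proof -
    have "f (g y) = y" if "y \<in> S2" for y using gf(1) S2(3) that by blast
    then show ?thesis unfolding S1_def image_image by simp
  qed
  have hS: "homeomorphism S1 S2 f g"
    by (rule homeomorphism_of_subsets[OF hom S1V(2) S2(3) fS1])
  have hS1: "homeomorphism S1 (\<phi> ` S1) \<phi> \<psi>"
    by (rule homeomorphism_of_subsets[OF h1 S1V(1)]) (use h1 S1V(1) in \<open>auto simp: homeomorphism_def\<close>)
  have hS2: "homeomorphism S2 (\<phi>2 ` S2) \<phi>2 \<psi>2"
    by (rule homeomorphism_of_subsets[OF h2 S2(2)]) (use h2 S2(2) in \<open>auto simp: homeomorphism_def\<close>)
  obtain u v where uv: "homeomorphism (\<phi> ` S1) (\<phi>2 ` S2) u v"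
    using homeomorphism_compose[OF homeomorphism_compose[OF homeomorphism_sym[THEN iffD1, OF hS1] hS] hS2] by blast
  note o1 = regular_chart_openin[OF h1 oV img S1 S1V(1)] and o2 = regular_chart_openin[OF h2 oV2 img2 S2(1,2)]
  have rsub: "subspace S" if "vec.subspace S" for S :: "(complex ^ 'n) set"
    using that unfolding subspace_def vec.subspace_def by (metis smult_of_real_vec)
  have ne: "\<phi> ` S1 \<noteq> {}" "\<phi>2 ` S2 \<noteq> {}" using S2(4) by (auto simp: S1_def)
  have "dim L \<le> dim L2"
  proof (rule invariance_of_dimension_subspaces[OF o1(1) rsub[OF L(1)] rsub[OF L2(1)]])
    show "continuous_on (\<phi> ` S1) u" using uv by (simp add: homeomorphism_def)
    show "u \<in> \<phi> ` S1 \<rightarrow> L2" using uv o2(2) by (force simp: homeomorphism_def)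
    show "inj_on u (\<phi> ` S1)" using uv by (metis homeomorphism_def inj_on_inverseI)
  qed (rule ne)
  moreover have "dim L2 \<le> dim L"
  proof (rule invariance_of_dimension_subspaces[OF o2(1) rsub[OF L2(1)] rsub[OF L(1)]])
    show "continuous_on (\<phi>2 ` S2) v" using uv by (simp add: homeomorphism_def)
    show "v \<in> \<phi>2 ` S2 \<rightarrow> L" using uv o1(2) by (force simp: homeomorphism_def)
    show "inj_on v (\<phi>2 ` S2)" using uv by (metis homeomorphism_def inj_on_inverseI)
  qed (rule ne)
  ultimately have "e = d" using real_dim_eq_twice_complex_dim[OF L(1)] real_dim_eq_twice_complex_dim[OF L2(1)] L L2 by simp
  then show ?thesis using reg2 by blast
qed

lemma cdim_homeomorphic:
  fixes Y1 Y2 :: "(complex ^ 'n) set"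
  assumes hom: "homeomorphism Y1 Y2 f g"
    and "\<And>v. v \<notin> Y1 \<Longrightarrow> \<exists>G. ghol G UNIV \<and> (\<forall>y\<in>Y1. G y = 0) \<and> G v \<noteq> 0"
    and "\<And>v. v \<notin> Y2 \<Longrightarrow> \<exists>G. ghol G UNIV \<and> (\<forall>y\<in>Y2. G y = 0) \<and> G v \<noteq> 0"
  shows "cdim Y1 = cdim Y2"
proof -
  have "(\<exists>p. regular_point_dim Y1 p d) \<longleftrightarrow> (\<exists>p. regular_point_dim Y2 p d)" for d
  proof
    assume "\<exists>p. regular_point_dim Y1 p d"
    then obtain p where "regular_point_dim Y1 p d" ..
    from regular_dim_transfer[OF hom this] show "\<exists>p. regular_point_dim Y2 p d"
      using regular_points_dense[of Y2] assms(3) by simp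
  next
    assume "\<exists>p. regular_point_dim Y2 p d"
    then obtain p where "regular_point_dim Y2 p d" ..
    from regular_dim_transfer[OF homeomorphism_sym[THEN iffD1, OF hom] this] show "\<exists>p. regular_point_dim Y1 p d"
      using regular_points_dense[of Y1] assms(2) by simp
  qed
  then show ?thesis by (simp add: cdim_def)
qed

text \<open>The Lipschitz bound is asked only from an index depending on the pair, because a germ
  controls a rescaled point only once the point has shrunk into its domain.\<close>

lemma convergent_by_density:
  fixes F :: "nat \<Rightarrow> 'a::metric_space \<Rightarrow> 'b::complete_space"
  assumes S: "\<And>x e. 0 < e \<Longrightarrow> \<exists>s\<in>S. dist x s < e" and conv: "\<And>s. s \<in> S \<Longrightarrow> convergent (\<lambda>n. F n s)"
    and lip: "\<And>x y. \<forall>\<^sub>F n in sequentially. dist (F n x) (F n y) \<le> K * dist x y" and K: "0 < K"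
  shows "convergent (\<lambda>n. F n x)"
proof -
  have "Cauchy (\<lambda>n. F n x)"
  proof (rule metric_CauchyI)
    fix e :: real assume e: "0 < e"
    obtain s where s: "s \<in> S" "dist x s < e / (3 * K)" using S[of "e / (3 * K)" x] e K by auto
    have Ks: "K * dist x s < e / 3" using s(2) K by (simp add: field_simps)
    have "Cauchy (\<lambda>n. F n s)" using conv[OF s(1)] by (rule convergent_Cauchy)
    then obtain M1 where M1: "\<And>m n. m \<ge> M1 \<Longrightarrow> n \<ge> M1 \<Longrightarrow> dist (F m s) (F n s) < e / 3"
      using metric_CauchyD[of "\<lambda>n. F n s" "e/3"] e by auto
    obtain M2 where M2: "\<And>n. n \<ge> M2 \<Longrightarrow> dist (F n x) (F n s) \<le> K * dist x s"
      using lip[of x s] by (auto simp: eventually_sequentially)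
    have "dist (F m x) (F n x) < e" if "m \<ge> max M1 M2" "n \<ge> max M1 M2" for m n
    proof -
      have "dist (F m x) (F n x) \<le> dist (F m x) (F m s) + dist (F m s) (F n s) + dist (F n x) (F n s)"
        using dist_triangle[of "F m x" "F n x" "F m s"] dist_triangle[of "F m s" "F n x" "F n s"] by (simp add: dist_commute)
      then show ?thesis using M1[of m n] M2[of m] M2[of n] that Ks by simp
    qed
    then show "\<exists>M. \<forall>m\<ge>M. \<forall>n\<ge>M. dist (F m x) (F n x) < e" by blast
  qed
  then show ?thesis by (rule Cauchy_convergent)
qed

section \<open>Rescalings of a bi-Lipschitz germ and their limits\<close>

definition blowup :: "('a::real_vector \<Rightarrow> 'b::real_vector) \<Rightarrow> nat \<Rightarrow> 'a \<Rightarrow> 'b" where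
  "blowup h i x = real (Suc i) *\<^sub>R h (inverse (real (Suc i)) *\<^sub>R x)"

lemma blowup_eventually_inside:
  fixes x :: "'a::real_normed_vector"
  assumes "open U" "0 \<in> U"
  shows "\<forall>\<^sub>F i in sequentially. inverse (real (Suc i)) *\<^sub>R x \<in> U"
proof (rule topological_tendstoD[OF _ assms(1)])
  show "(\<lambda>i. inverse (real (Suc i)) *\<^sub>R x) \<longlonglongrightarrow> 0"
    using tendsto_scaleR[OF LIMSEQ_inverse_real_of_nat tendsto_const[of x]] by simp
qed fact

lemma blowup_lipschitz:
  fixes h :: "'a::real_normed_vector \<Rightarrow> 'b::real_normed_vector"
  assumes "\<And>x y. x \<in> U \<Longrightarrow> y \<in> U \<Longrightarrow> dist (h x) (h y) \<le> K * dist x y"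
    and "inverse (real (Suc i)) *\<^sub>R x \<in> U" "inverse (real (Suc i)) *\<^sub>R y \<in> U"
  shows "dist (blowup h i x) (blowup h i y) \<le> K * dist x y"
proof -
  let ?n = "real (Suc i)"
  have "dist (blowup h i x) (blowup h i y) = ?n * dist (h (inverse ?n *\<^sub>R x)) (h (inverse ?n *\<^sub>R y))"
    by (simp add: blowup_def dist_norm del: of_nat_Suc flip: scaleR_diff_right)
  also have "\<dots> \<le> ?n * (K * dist (inverse ?n *\<^sub>R x) (inverse ?n *\<^sub>R y))"
    by (intro mult_left_mono assms) auto
  also have "\<dots> = K * dist x y"
    by (simp add: dist_norm del: of_nat_Suc flip: scaleR_diff_right)
  finally show ?thesis .
qed

text \<open>Arzela-Ascoli; \<open>trunc\<close> makes the rescalings total and uniformly bounded.\<close>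

lemma blowup_limits:
  fixes h g :: "'a::euclidean_space \<Rightarrow> 'a"
  assumes U: "open U" "0 \<in> U" "open U'" "0 \<in> U'" and 0: "h 0 = 0" "g 0 = 0"
    and inv: "\<And>x. x \<in> U \<Longrightarrow> h x \<in> U' \<and> g (h x) = x" "\<And>y. y \<in> U' \<Longrightarrow> g y \<in> U \<and> h (g y) = y"
    and K: "0 < K" and lip: "\<And>x y. x \<in> U \<Longrightarrow> y \<in> U \<Longrightarrow> dist (h x) (h y) \<le> K * dist x y"
      "\<And>x y. x \<in> U' \<Longrightarrow> y \<in> U' \<Longrightarrow> dist (g x) (g y) \<le> K * dist x y"
  obtains k h' g' where "strict_mono k" "\<And>x. (\<lambda>n. blowup h (k n) x) \<longlonglongrightarrow> h' x" "\<And>x. (\<lambda>n. blowup g (k n) x) \<longlonglongrightarrow> g' x"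
    "\<And>x. g' (h' x) = x" "\<And>x. h' (g' x) = x" "continuous_on UNIV h'" "continuous_on UNIV g'"
proof -
  obtain S :: "'a set" where S: "countable S" "\<And>X. open X \<Longrightarrow> X \<noteq> {} \<Longrightarrow> \<exists>d\<in>S. d \<in> X"
    using countable_dense_exists by metis
  have dense: "\<exists>s\<in>S. dist x s < e" if "0 < e" for x e using S(2)[of "ball x e"] that by auto
  define trunc where "trunc = (\<lambda>(f :: 'a \<Rightarrow> 'a) V n x.
    (if inverse (real (Suc n)) *\<^sub>R x \<in> V then inverse (norm x + 1) *\<^sub>R blowup f n x else 0))"
  have b: "norm (trunc f V n x) \<le> K"
    if V: "0 \<in> V" "f 0 = 0" and fl: "\<And>x y. x \<in> V \<Longrightarrow> y \<in> V \<Longrightarrow> dist (f x) (f y) \<le> K * dist x y" for f V n x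
  proof (cases "inverse (real (Suc n)) *\<^sub>R x \<in> V")
    case True
    have "dist (blowup f n x) (blowup f n 0) \<le> K * dist x 0" by (rule blowup_lipschitz[OF fl True]) (use V in auto)
    moreover have "blowup f n 0 = 0" using V by (simp add: blowup_def)
    ultimately have "norm (blowup f n x) \<le> K * norm x" by simp
    also have "\<dots> \<le> K * (norm x + 1)" using K by simp
    finally have "norm (blowup f n x) / (norm x + 1) \<le> K"
      using add_nonneg_pos[OF norm_ge_zero zero_less_one, of x] by (simp add: pos_divide_le_eq)
    then show ?thesis using True by (simp add: trunc_def divide_inverse mult.commute)
  qed (use K in \<open>simp add: trunc_def\<close>)
  \<comment> \<open>Pairing the rescalings of \<open>h\<close> and \<open>g\<close> yields one
    subsequence for both, so that the limits can be inverse to each other.\<close>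
  define P where "P = (\<lambda>n x. (trunc h U n x, trunc g U' n x))"
  have "norm (P n x) \<le> K + K" for n x
    using norm_Pair_le[of "trunc h U n x" "trunc g U' n x"] b[of U h n x] b[of U' g n x] U 0 lip by (simp add: P_def)
  then obtain k where k: "strict_mono k" "\<And>x. x \<in> S \<Longrightarrow> \<exists>l. (\<lambda>n. P (k n) x) \<longlonglongrightarrow> l"
    using function_convergent_subsequence[OF S(1), of P "K + K"] by blast
  have sub: "filterlim k sequentially sequentially" using k(1) by (rule filterlim_subseq)
  have inside: "\<forall>\<^sub>F n in sequentially. inverse (real (Suc (k n))) *\<^sub>R x \<in> V" if "open V" "0 \<in> V" for V and x :: 'a
    using eventually_compose_filterlim[OF blowup_eventually_inside[OF that] sub] .
  have conv: "convergent (\<lambda>n. blowup f (k n) x)"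
    if V: "open V" "0 \<in> V" and fl: "\<And>x y. x \<in> V \<Longrightarrow> y \<in> V \<Longrightarrow> dist (f x) (f y) \<le> K * dist x y"
      and cS: "\<And>x. x \<in> S \<Longrightarrow> convergent (\<lambda>n. trunc f V (k n) x)" for f V x
  proof (rule convergent_by_density[OF dense _ _ K])
    fix s assume s: "s \<in> S"
    obtain l where "(\<lambda>n. trunc f V (k n) s) \<longlonglongrightarrow> l" using cS[OF s] by (auto simp: convergent_def)
    then have "(\<lambda>n. (norm s + 1) *\<^sub>R trunc f V (k n) s) \<longlonglongrightarrow> (norm s + 1) *\<^sub>R l" by (intro tendsto_intros)
    moreover have "\<forall>\<^sub>F n in sequentially. (norm s + 1) *\<^sub>R trunc f V (k n) s = blowup f (k n) s"
      using inside[OF V, of s]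
    proof eventually_elim
      case (elim n)
      have "norm s + 1 \<noteq> 0" using add_nonneg_pos[OF norm_ge_zero zero_less_one, of s] by linarith
      then show ?case using elim by (simp add: trunc_def)
    qed
    ultimately have "(\<lambda>n. blowup f (k n) s) \<longlonglongrightarrow> (norm s + 1) *\<^sub>R l" by (rule Lim_transform_eventually)
    then show "convergent (\<lambda>n. blowup f (k n) s)" by (auto simp: convergent_def)
  next
    fix x y
    show "\<forall>\<^sub>F n in sequentially. dist (blowup f (k n) x) (blowup f (k n) y) \<le> K * dist x y"
      using inside[OF V, of x] inside[OF V, of y]
      by eventually_elim (rule blowup_lipschitz[OF fl])
  qed
  have cP: "convergent (\<lambda>n. trunc h U (k n) x)" "convergent (\<lambda>n. trunc g U' (k n) x)" if xS: "x \<in> S" for x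
  proof -
    obtain l where l: "(\<lambda>n. P (k n) x) \<longlonglongrightarrow> l" using k(2)[OF xS] by blast
    show "convergent (\<lambda>n. trunc h U (k n) x)" using tendsto_fst[OF l] by (auto simp: P_def convergent_def)
    show "convergent (\<lambda>n. trunc g U' (k n) x)" using tendsto_snd[OF l] by (auto simp: P_def convergent_def)
  qed
  have "\<exists>l. (\<lambda>n. blowup h (k n) x) \<longlonglongrightarrow> l" "\<exists>l. (\<lambda>n. blowup g (k n) x) \<longlonglongrightarrow> l" for x
    using conv[OF U(1,2) lip(1) cP(1), of x] conv[OF U(3,4) lip(2) cP(2), of x] by (simp_all add: convergent_def)
  then obtain h' g' where h': "\<And>x. (\<lambda>n. blowup h (k n) x) \<longlonglongrightarrow> h' x" and g': "\<And>x. (\<lambda>n. blowup g (k n) x) \<longlonglongrightarrow> g' x" by metis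
  have limlip: "dist (f' x) (f' y) \<le> K * dist x y"
    if V: "open V" "0 \<in> V" and fl: "\<And>x y. x \<in> V \<Longrightarrow> y \<in> V \<Longrightarrow> dist (f x) (f y) \<le> K * dist x y"
      and f': "\<And>x. (\<lambda>n. blowup f (k n) x) \<longlonglongrightarrow> f' x" for f f' :: "'a \<Rightarrow> 'a" and V x y
  proof (rule tendsto_upperbound[OF tendsto_dist[OF f' f']])
    show "\<forall>\<^sub>F n in sequentially. dist (blowup f (k n) x) (blowup f (k n) y) \<le> K * dist x y"
      using inside[OF V, of x] inside[OF V, of y] by eventually_elim (rule blowup_lipschitz[OF fl])
  qed simp
  have cont: "continuous_on UNIV f'" if l: "\<And>x y. dist (f' x) (f' y) \<le> K * dist x y" for f' :: "'a \<Rightarrow> 'a"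
  proof -
    have "K-lipschitz_on UNIV f'" by (rule lipschitz_onI) (use l K in auto)
    then show ?thesis by (rule lipschitz_on_continuous_on)
  qed
  \<comment> \<open>At each scale the blow-up of \<open>f2\<close> takes the blow-up of
    \<open>f1\<close> at \<open>x\<close> back to \<open>x\<close>. Its Lipschitz bound allows that
    argument to be replaced by its limit \<open>f1' x\<close>.\<close>
  have inverse': "f2' (f1' x) = x"
    if V1: "open V1" "0 \<in> V1" and V2: "open V2" "0 \<in> V2" and i: "\<And>x. x \<in> V1 \<Longrightarrow> f1 x \<in> V2 \<and> f2 (f1 x) = x"
      and fl: "\<And>x y. x \<in> V2 \<Longrightarrow> y \<in> V2 \<Longrightarrow> dist (f2 x) (f2 y) \<le> K * dist x y"
      and f1': "\<And>x. (\<lambda>n. blowup f1 (k n) x) \<longlonglongrightarrow> f1' x" and f2': "\<And>x. (\<lambda>n. blowup f2 (k n) x) \<longlonglongrightarrow> f2' x"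
    for f1 f2 f1' f2' :: "'a \<Rightarrow> 'a" and V1 V2 x
  proof -
    have "dist (f2' (f1' x)) x \<le> K * dist (f1' x) (f1' x)"
    proof (rule tendsto_le[OF _ _ tendsto_dist[OF f2' tendsto_const]])
      show "(\<lambda>n. K * dist (f1' x) (blowup f1 (k n) x)) \<longlonglongrightarrow> K * dist (f1' x) (f1' x)"
        by (intro tendsto_intros f1')
      show "\<forall>\<^sub>F n in sequentially. dist (blowup f2 (k n) (f1' x)) x \<le> K * dist (f1' x) (blowup f1 (k n) x)"
        using inside[OF V1, of x] inside[OF V2, of "f1' x"]
      proof eventually_elim
        case (elim n)
        let ?n = "real (Suc (k n))"
        have e1: "inverse ?n *\<^sub>R blowup f1 (k n) x = f1 (inverse ?n *\<^sub>R x)" by (simp add: blowup_def del: of_nat_Suc)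
        have "inverse ?n *\<^sub>R blowup f1 (k n) x \<in> V2" unfolding e1 using i[OF elim(1)] by simp
        from blowup_lipschitz[OF fl elim(2) this]
        have "dist (blowup f2 (k n) (f1' x)) (blowup f2 (k n) (blowup f1 (k n) x)) \<le> K * dist (f1' x) (blowup f1 (k n) x)" .
        moreover have "blowup f2 (k n) (blowup f1 (k n) x) = x"
          unfolding blowup_def[of f2] e1 using i[OF elim(1)] by (simp del: of_nat_Suc)
        ultimately show ?case by simp
      qed
    qed simp
    then show ?thesis by simp
  qed
  show ?thesis
  proof (rule that[OF k(1) h' g'])
    show "g' (h' x) = x" for x by (rule inverse'[OF U inv(1) lip(2) h' g'])
    show "h' (g' x) = x" for x by (rule inverse'[OF U(3,4,1,2) inv(2) lip(1) g' h'])
    show "continuous_on UNIV h'" by (rule cont) (rule limlip[OF U(1,2) lip(1) h'])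
    show "continuous_on UNIV g'" by (rule cont) (rule limlip[OF U(3,4) lip(2) g'])
  qed
qed

text \<open>With points of \<open>A\<close> available at every scale, those at the scales of the
  subsequence, rescaled, tend to \<open>v\<close>; the rescaled images then tend to
  \<open>h' v\<close> and exhibit it as a tangent vector.\<close>

lemma blowup_limit_maps_LD_star:
  fixes h :: "complex ^ 'n \<Rightarrow> complex ^ 'n"
  assumes U: "open U" "0 \<in> U" "h 0 = 0" and inj: "inj_on h U" and K: "0 < K"
    and lip: "\<And>x y. x \<in> U \<Longrightarrow> y \<in> U \<Longrightarrow> dist (h x) (h y) \<le> K * dist x y"
    and k: "strict_mono k" and lim: "\<And>x. (\<lambda>n. blowup h (k n) x) \<longlonglongrightarrow> h' x" and inj': "inj h'"
    and A: "analytic_germ_at0 A" "0 \<in> A" and v: "v \<in> LD_star A"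
  shows "h' v \<in> LD_star (h ` (A \<inter> U))"
proof (cases "v = 0")
  case True
  have h0: "h' 0 = 0" using LIMSEQ_unique[OF lim[of 0], of 0] U(3) by (simp add: blowup_def)
  \<comment> \<open>For the vertex, nonzero points of the image tending to 0 are still required;
    injectivity of \<open>h\<close> keeps the images of nonzero points of \<open>A\<close>
    nonzero.\<close>
  obtain c a where a: "\<And>i. a i \<in> A - {0}" "a \<longlonglongrightarrow> 0" using v by (auto simp: LD_star_def)
  have "\<forall>\<^sub>F i in sequentially. a i \<in> U" by (rule topological_tendstoD[OF a(2) U(1,2)])
  then obtain m where m: "\<And>i. i \<ge> m \<Longrightarrow> a i \<in> U" by (auto simp: eventually_sequentially)
  define b where "b = (\<lambda>i. h (a (i + m)))"
  have "b i \<in> h ` (A \<inter> U) - {0}" for i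
  proof -
    have "a (i + m) \<in> A \<inter> U" "a (i + m) \<noteq> 0" using a(1)[of "i + m"] m[of "i + m"] by auto
    then show ?thesis using inj_onD[OF inj, of "a (i + m)" 0] U by (auto simp: b_def)
  qed
  moreover have "b \<longlonglongrightarrow> 0"
  proof (rule Lim_null_comparison)
    show "\<forall>\<^sub>F i in sequentially. norm (b i) \<le> K * norm (a (i + m))"
      using lip[OF m U(2)] U(3) by (simp add: b_def)
    show "(\<lambda>i. K * norm (a (i + m))) \<longlonglongrightarrow> 0"
      by (intro tendsto_mult_right_zero tendsto_norm_zero LIMSEQ_ignore_initial_segment[OF a(2)])
  qed
  ultimately have "0 \<in> LD_star (h ` (A \<inter> U))" unfolding LD_star_def by (auto intro!: exI[of _ "\<lambda>_. 0"] exI[of _ b])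
  then show ?thesis using True h0 by simp
next
  case False
  have h0: "h' 0 = 0" using LIMSEQ_unique[OF lim[of 0], of 0] U(3) by (simp add: blowup_def)
  have hv: "h' v \<noteq> 0" using injD[OF inj', of v 0] False h0 by auto
  obtain a where a: "\<And>i. a i \<in> A" "(\<lambda>i. of_nat (Suc i) *s a i) \<longlonglongrightarrow> v" by (rule LD_star_sequence[OF A v]) (rule that)
  define x where "x = (\<lambda>i. real (Suc i) *\<^sub>R a i)"
  have "x \<longlonglongrightarrow> v"
  proof -
    have "of_nat (Suc i) *s a i = x i" for i using smult_of_real_vec[of "real (Suc i)" "a i"] by (simp add: x_def)
    then show ?thesis using a(2) by simp
  qed
  then have xk: "(\<lambda>n. x (k n)) \<longlonglongrightarrow> v" using k by (rule_tac LIMSEQ_subseq_LIMSEQ[unfolded o_def])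
  have sub: "filterlim k sequentially sequentially" using k by (rule filterlim_subseq)
  have invk: "(\<lambda>n. inverse (real (Suc (k n)))) \<longlonglongrightarrow> 0"
    using filterlim_compose[OF LIMSEQ_inverse_real_of_nat sub] by simp
  have ax: "inverse (real (Suc i)) *\<^sub>R x i = a i" for i by (simp add: x_def del: of_nat_Suc)
  have "(\<lambda>n. a (k n)) \<longlonglongrightarrow> 0" using tendsto_scaleR[OF invk xk] by (simp only: ax scaleR_zero_left)
  then have aU: "\<forall>\<^sub>F n in sequentially. a (k n) \<in> U" by (rule topological_tendstoD) (use U in auto)
  have vU: "\<forall>\<^sub>F n in sequentially. inverse (real (Suc (k n))) *\<^sub>R v \<in> U"
    using eventually_compose_filterlim[OF blowup_eventually_inside[OF U(1,2)] sub] .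
  \<comment> \<open>The arguments move with \<open>n\<close>, so pointwise convergence at
    \<open>v\<close> is complemented by the Lipschitz bound.\<close>
  have d0: "(\<lambda>n. blowup h (k n) (x (k n)) - blowup h (k n) v) \<longlonglongrightarrow> 0"
  proof (rule Lim_null_comparison)
    show "\<forall>\<^sub>F n in sequentially. norm (blowup h (k n) (x (k n)) - blowup h (k n) v) \<le> K * dist (x (k n)) v"
      using aU vU
    proof eventually_elim
      case (elim n)
      show ?case unfolding dist_norm[symmetric] by (rule blowup_lipschitz[OF lip]) (use elim ax in auto)
    qed
    show "(\<lambda>n. K * dist (x (k n)) v) \<longlonglongrightarrow> 0"
      using xk by (intro tendsto_mult_right_zero) (simp add: tendsto_dist_iff[symmetric])
  qed
  have lim2: "(\<lambda>n. blowup h (k n) (x (k n))) \<longlonglongrightarrow> h' v" using tendsto_add[OF d0 lim[of v]] by simp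
  obtain m where m: "\<And>n. n \<ge> m \<Longrightarrow> a (k n) \<in> U" using aU by (auto simp: eventually_sequentially)
  define t where "t = (\<lambda>n. complex_of_real (inverse (real (Suc (k (n + m))))))"
  define b where "b = (\<lambda>n. blowup h (k (n + m)) (x (k (n + m))))"
  show ?thesis
  proof (rule LD_starI_scaled[where t = t and b = b])
    have "(\<lambda>n. complex_of_real (inverse (real (Suc (k n))))) \<longlonglongrightarrow> of_real 0" by (intro tendsto_of_real invk)
    then show "t \<longlonglongrightarrow> 0" unfolding t_def by (intro LIMSEQ_ignore_initial_segment) simp
    show "b \<longlonglongrightarrow> h' v" unfolding b_def by (rule LIMSEQ_ignore_initial_segment[OF lim2])
    show "t n \<noteq> 0" for n by (simp add: t_def del: of_nat_Suc)
    show "t n *s b n \<in> h ` (A \<inter> U)" for n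
    proof -
      have "t n *s b n = h (a (k (n + m)))"
        unfolding t_def b_def smult_of_real_vec blowup_def ax by (simp del: of_nat_Suc)
      then show ?thesis using a(1) m[of "n + m"] by simp
    qed
  qed (rule hv)
qed

lemma LD_star_mono: "A \<subseteq> B \<Longrightarrow> LD_star A \<subseteq> LD_star B"
  unfolding LD_star_def by blast

theorem theorem3p2:
  fixes h :: "complex ^ 'n \<Rightarrow> complex ^ 'n" and U A B :: "(complex ^ 'n) set"
  assumes "bilip_homeo_germ h U"
    and "analytic_germ_at0 A" and "analytic_germ_at0 B"
    and "0 \<in> A" and "0 \<in> B"
    and "analytic_germ_at0 (h ` (A \<inter> U))" and "analytic_germ_at0 (h ` (B \<inter> U))"
  shows "transverse_at0 A B \<longleftrightarrow> transverse_at0 (h ` (A \<inter> U)) (h ` (B \<inter> U))"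
proof -
  obtain g K1 K2 where U: "open U" "0 \<in> U" "h 0 = 0" "open (h ` U)" and hom: "homeomorphism U (h ` U) h g"
    and K: "0 < K1" "K1 \<le> K2" and lip: "\<And>x y. x \<in> U \<Longrightarrow> y \<in> U \<Longrightarrow> K1 * dist x y \<le> dist (h x) (h y) \<and> dist (h x) (h y) \<le> K2 * dist x y"
    using assms(1) unfolding bilip_homeo_germ_def by blast
  have gh: "g (h x) = x" if "x \<in> U" for x using hom that by (auto simp: homeomorphism_def)
  have h0: "0 \<in> h ` U" using U(2,3) by force
  have g0: "g 0 = 0" using gh[OF U(2)] U(3) by simp
  \<comment> \<open>A common Lipschitz constant for \<open>h\<close> and its inverse, the latter
    having constant \<open>inverse K1\<close>.\<close>
  define K where "K = max K2 (inverse K1)"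
  have KK: "0 < K" "K2 \<le> K" "inverse K1 \<le> K" using K by (auto simp: K_def)
  have lh: "dist (h x) (h y) \<le> K * dist x y" if "x \<in> U" "y \<in> U" for x y
    using lip[OF that] mult_right_mono[OF KK(2), of "dist x y"] by simp
  have lg: "dist (g x) (g y) \<le> K * dist x y" if xy: "x \<in> h ` U" "y \<in> h ` U" for x y
  proof -
    obtain x' y' where x': "x' \<in> U" "x = h x'" "y' \<in> U" "y = h y'" using xy by blast
    have "K1 * dist x' y' \<le> dist x y" using lip[OF x'(1,3)] x' by simp
    then have "dist x' y' \<le> inverse K1 * dist x y" using K(1) by (simp add: field_simps)
    also have "\<dots> \<le> K * dist x y" by (intro mult_right_mono KK) simp
    finally show ?thesis using gh x' by simp
  qed
  obtain k h' g' where k: "strict_mono k" and h': "\<And>x. (\<lambda>n. blowup h (k n) x) \<longlonglongrightarrow> h' x"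
    and g': "\<And>x. (\<lambda>n. blowup g (k n) x) \<longlonglongrightarrow> g' x"
    and g'h': "\<And>x. g' (h' x) = x" and h'g': "\<And>x. h' (g' x) = x" and cont: "continuous_on UNIV h'" "continuous_on UNIV g'"
  proof (rule blowup_limits[of U "h ` U" h g K, OF U(1,2,4) h0 U(3) g0 _ _ KK(1)])
    show "h x \<in> h ` U \<and> g (h x) = x" if "x \<in> U" for x using gh that by simp
    show "g y \<in> U \<and> h (g y) = y" if "y \<in> h ` U" for y using gh that by auto
    show "dist (h x) (h y) \<le> K * dist x y" if "x \<in> U" "y \<in> U" for x y by (rule lh[OF that])
    show "dist (g x) (g y) \<le> K * dist x y" if "x \<in> h ` U" "y \<in> h ` U" for x y by (rule lg[OF that])
  qed (rule that)
  have injh': "inj h'" "inj g'" using g'h' h'g' by (metis injI)+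
  have injh: "inj_on h U" by (rule inj_on_inverseI[of U g]) (rule gh)
  have injg: "inj_on g (h ` U)" by (rule inj_on_inverseI[of _ h]) (use gh in auto)
  have maps: "h' ` LD_star X \<subseteq> LD_star (h ` (X \<inter> U))" "g' ` LD_star (h ` (X \<inter> U)) \<subseteq> LD_star X"
    if X: "analytic_germ_at0 X" "0 \<in> X" "analytic_germ_at0 (h ` (X \<inter> U))" for X
  proof -
    show "h' ` LD_star X \<subseteq> LD_star (h ` (X \<inter> U))"
      using blowup_limit_maps_LD_star[OF U(1-3) injh KK(1) lh k h' injh'(1) X(1,2)] by blast
    have hX0: "0 \<in> h ` (X \<inter> U)" using U(2,3) X(2) by force
    have "g ` (h ` (X \<inter> U) \<inter> h ` U) \<subseteq> X"
    proof
      fix z assume "z \<in> g ` (h ` (X \<inter> U) \<inter> h ` U)"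
      then obtain x where "x \<in> X" "x \<in> U" "z = g (h x)" by blast
      then show "z \<in> X" using gh by simp
    qed
    \<comment> \<open>Applied to \<open>g\<close>, the mapping lemma lands in the cone of the part
      of \<open>X\<close> inside \<open>U\<close>, which lies in the cone of
      \<open>X\<close>.\<close>
    from LD_star_mono[OF this]
    show "g' ` LD_star (h ` (X \<inter> U)) \<subseteq> LD_star X"
      using blowup_limit_maps_LD_star[OF U(4) h0 g0 injg KK(1) lg k g' injh'(2) X(3) hX0] by blast
  qed
  have homI: "homeomorphism Y1 Y2 h' g'" if "h' ` Y1 \<subseteq> Y2" "g' ` Y2 \<subseteq> Y1" for Y1 Y2
    by (rule homeomorphismI) (use that g'h' h'g' cont in \<open>auto intro: continuous_on_subset\<close>)
  have sep: "\<exists>G. ghol G UNIV \<and> (\<forall>y\<in>LD_star X. G y = 0) \<and> G v \<noteq> 0"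
    if X: "analytic_germ_at0 X" "0 \<in> X" "v \<notin> LD_star X" for X :: "(complex ^ 'n) set" and v
    by (rule LD_star_separation[OF X]) blast
  \<comment> \<open>A vector outside the intersection lies outside one of the cones, and the
    function separating it from that cone vanishes on the intersection.\<close>
  have sep2: "\<exists>G. ghol G UNIV \<and> (\<forall>y\<in>LD_star X \<inter> LD_star Y. G y = 0) \<and> G v \<noteq> 0"
    if X: "analytic_germ_at0 X" "0 \<in> X" and Y: "analytic_germ_at0 Y" "0 \<in> Y" and v: "v \<notin> LD_star X \<inter> LD_star Y"
    for X Y :: "(complex ^ 'n) set" and v
    using sep[OF X, of v] sep[OF Y, of v] v by blast
  have im0: "0 \<in> h ` (A \<inter> U)" "0 \<in> h ` (B \<inter> U)" using U(2,3) assms(4,5) by force+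
  note mA = maps[OF assms(2,4,6)] and mB = maps[OF assms(3,5,7)]
  have "cdim (LD_star A) = cdim (LD_star (h ` (A \<inter> U)))"
    by (rule cdim_homeomorphic[OF homI[OF mA] sep[OF assms(2,4)] sep[OF assms(6) im0(1)]])
  moreover have "cdim (LD_star B) = cdim (LD_star (h ` (B \<inter> U)))"
    by (rule cdim_homeomorphic[OF homI[OF mB] sep[OF assms(3,5)] sep[OF assms(7) im0(2)]])
  moreover have "cdim (LD_star A \<inter> LD_star B) = cdim (LD_star (h ` (A \<inter> U)) \<inter> LD_star (h ` (B \<inter> U)))"
  proof (rule cdim_homeomorphic[OF homI sep2[OF assms(2,4,3,5)] sep2[OF assms(6) im0(1) assms(7) im0(2)]])
    show "h' ` (LD_star A \<inter> LD_star B) \<subseteq> LD_star (h ` (A \<inter> U)) \<inter> LD_star (h ` (B \<inter> U))" using mA(1) mB(1) by blast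
    show "g' ` (LD_star (h ` (A \<inter> U)) \<inter> LD_star (h ` (B \<inter> U))) \<subseteq> LD_star A \<inter> LD_star B" using mA(2) mB(2) by blast
  qed
  ultimately show ?thesis by (simp add: transverse_at0_def)
qed

end
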